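(* For every $L$ there is a constant $c>0$ depending only on $L$ such that the following holds. Let $m\le n$ be positive integers, let $\Omega\subset\{1,\dots,n\}$ be an arbitrary fixed set with $|\Omega|=m$, and let $\xi=(\xi_j)_{j=1}^n$ be a random vector with independent, mean-zero, variance one, $L$-subgaussian (real) entries. If, for a positive integer $s\le n$ and $\eta,\delta\in(0,1)$, $$m\ge c\,\delta^{-2}\,s\,\max\{(\log s)^2(\log n)^2,\ \log(\eta^{-1})\},$$ then with probability at least $1-\eta$ the restricted isometry constant $\delta_s$ of the partial random circulant matrix $\Phi=\frac1{\sqrt m}R_\Omega H_\xi\in\mathbb{R}^{m\times n}$ generated by $\xi$ satisfies $\delta_s\le\delta$.
   Context: A mean-zero, variance-one random variable $X$ is $L$-subgaussian if $\mathbb{P}(|X|\ge t)\le2\exp(-t^2/(2L^2))$ for all $t>0$. For $z,x\in\mathbb{C}^n$ the circular convolution is $(z*x)_j=\sum_{k=1}^n z_{j\ominus k}x_k$, $j=1,\dots,n$, where $j\ominus k=j-k\bmod n$ is cyclic subtraction (indices taken in $\{1,\dots,n\}$). The circulant matrix $H_z\in\mathbb{C}^{n\times n}$ is defined by $H_zx=z*x$. The operator $R_\Omega:\mathbb{C}^n\to\mathbb{C}^m$ restricts a vector to its entries indexed by $\Omega$. Thus $\Phi x=\frac1{\sqrt m}R_\Omega(\xi*x)$. A vector $x\in\mathbb{C}^n$ is $s$-sparse if it has at most $s$ nonzero entries. The restricted isometry constant $\delta_s$ of $\Phi\in\mathbb{C}^{m\times n}$ is the smallest number such that $(1-\delta_s)\|x\|_2^2\le\|\Phi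 x\|_2^2\le(1+\delta_s)\|x\|_2^2$ for all $s$-sparse $x\in\mathbb{C}^n$.
   Formalization: The formal theorem assumes s ≥ 2 rather than s ≥ 1: for s = 1 the factor (log s)² vanishes, the bound on m no longer depends on n, and the claim fails, e.g. for Gaussian entries with m fixed and n → ∞. *)

theory Defs
  imports "HOL-Probability.Probability"
begin

text \<open>
  The dimensions vary inside the statement, so a vector of length \<open>n\<close> is a function on \<open>nat\<close> of
  which only the values on \<open>{1..n}\<close> are ever inspected, and an \<open>m \<times> n\<close> matrix is a function
  \<open>nat \<Rightarrow> nat \<Rightarrow> complex\<close> of which only the values on \<open>{1..m} \<times> {1..n}\<close> are ever inspected.
\<close>

definition l2norm :: "nat \<Rightarrow> (nat \<Rightarrow> complex) \<Rightarrow> real" where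
  "l2norm n x = L2_set (\<lambda>j. cmod (x j)) {1..n}"

definition mat_vec :: "nat \<Rightarrow> (nat \<Rightarrow> nat \<Rightarrow> complex) \<Rightarrow> (nat \<Rightarrow> complex) \<Rightarrow> nat \<Rightarrow> complex" where
  "mat_vec n A x = (\<lambda>i. \<Sum>k=1..n. A i k * x k)"

definition sparse :: "nat \<Rightarrow> nat \<Rightarrow> (nat \<Rightarrow> complex) \<Rightarrow> bool" where
  "sparse n s x \<longleftrightarrow> card {j \<in> {1..n}. x j \<noteq> 0} \<le> s"

text \<open>The representative in \<open>{1..n}\<close> (not in \<open>{0..<n}\<close>) of \<open>j - k\<close> modulo \<open>n\<close>.\<close>

definition cyc_sub :: "nat \<Rightarrow> nat \<Rightarrow> nat \<Rightarrow> nat" where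
  "cyc_sub n j k = nat ((int j - int k - 1) mod int n) + 1"

definition circ_conv :: "nat \<Rightarrow> (nat \<Rightarrow> complex) \<Rightarrow> (nat \<Rightarrow> complex) \<Rightarrow> nat \<Rightarrow> complex" where
  "circ_conv n z x = (\<lambda>j. \<Sum>k=1..n. z (cyc_sub n j k) * x k)"

definition circulant :: "nat \<Rightarrow> (nat \<Rightarrow> complex) \<Rightarrow> nat \<Rightarrow> nat \<Rightarrow> complex" where
  "circulant n z = (\<lambda>j k. z (cyc_sub n j k))"

text \<open>
  The entries indexed by \<open>\<Omega>\<close> are listed in increasing order, as entries \<open>1, \<dots>, card \<Omega>\<close>. Applied
  to a matrix (\<open>'a\<close> being a row type) this selects the rows indexed by \<open>\<Omega>\<close>, which is the matrix
  product with the restriction operator.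
\<close>

definition restrict_to :: "nat set \<Rightarrow> (nat \<Rightarrow> 'a) \<Rightarrow> nat \<Rightarrow> 'a" where
  "restrict_to \<Omega> y = (\<lambda>i. y (sorted_list_of_set \<Omega> ! (i - 1)))"

definition partial_circulant ::
    "nat \<Rightarrow> nat \<Rightarrow> nat set \<Rightarrow> (nat \<Rightarrow> real) \<Rightarrow> nat \<Rightarrow> nat \<Rightarrow> complex" where
  "partial_circulant m n \<Omega> z = (\<lambda>i k.
     complex_of_real (1 / sqrt (real m)) *
       restrict_to \<Omega> (circulant n (\<lambda>j. complex_of_real (z j))) i k)"

definition rip_bound ::
    "nat \<Rightarrow> nat \<Rightarrow> nat \<Rightarrow> (nat \<Rightarrow> nat \<Rightarrow> complex) \<Rightarrow> real \<Rightarrow> bool" where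
  "rip_bound m n s A d \<longleftrightarrow> (\<forall>x. sparse n s x \<longrightarrow>
     (1 - d) * (l2norm n x)\<^sup>2 \<le> (l2norm m (mat_vec n A x))\<^sup>2 \<and>
     (l2norm m (mat_vec n A x))\<^sup>2 \<le> (1 + d) * (l2norm n x)\<^sup>2)"

text \<open>
  The minimum exists whenever \<open>n \<ge> 1\<close> and \<open>s \<ge> 1\<close>; see \<open>rip_bound_ri_const\<close> below.
\<close>

definition ri_const :: "nat \<Rightarrow> nat \<Rightarrow> nat \<Rightarrow> (nat \<Rightarrow> nat \<Rightarrow> complex) \<Rightarrow> real" where
  "ri_const m n s A = (LEAST d. rip_bound m n s A d)"

text \<open>Mean zero and variance one are required separately.\<close>

definition subgaussian :: "'a measure \<Rightarrow> real \<Rightarrow> ('a \<Rightarrow> real) \<Rightarrow> bool" where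
  "subgaussian M L X \<longleftrightarrow>
     (\<forall>t>0. measure M {\<omega> \<in> space M. \<bar>X \<omega>\<bar> \<ge> t} \<le> 2 * exp (- t\<^sup>2 / (2 * L\<^sup>2)))"


lemma cyc_sub_in: "n \<ge> 1 \<Longrightarrow> cyc_sub n j k \<in> {1..n}"
proof -
  assume n: "n \<ge> 1"
  have "(int j - int k - 1) mod int n < int n" "0 \<le> (int j - int k - 1) mod int n"
    using n by auto
  then show ?thesis unfolding cyc_sub_def by auto
qed

lemma cyc_sub_cong: "n \<ge> 1 \<Longrightarrow> int (cyc_sub n j k) mod int n = (int j - int k) mod int n"
  unfolding cyc_sub_def by (simp add: mod_simps)

lemma circulant_mat_vec: "mat_vec n (circulant n z) x = circ_conv n z x"
  by (simp add: mat_vec_def circulant_def circ_conv_def)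

lemma partial_circulant_mat_vec:
  "mat_vec n (partial_circulant m n \<Omega> z) x =
     (\<lambda>i. complex_of_real (1 / sqrt (real m)) *
        restrict_to \<Omega> (circ_conv n (\<lambda>j. complex_of_real (z j)) x) i)"
  by (simp add: mat_vec_def partial_circulant_def circulant_def circ_conv_def restrict_to_def
      sum_distrib_left mult.assoc)

lemma l2norm_sq: "(l2norm n x)\<^sup>2 = (\<Sum>j=1..n. (cmod (x j))\<^sup>2)"
  by (simp add: l2norm_def L2_set_def sum_nonneg)

lemma l2norm_mat_vec_bound: "\<exists>B\<ge>0. \<forall>x. (l2norm m (mat_vec n A x))\<^sup>2 \<le> B * (l2norm n x)\<^sup>2"
proof -
  define B where "B = (\<Sum>i=1..m. \<Sum>k=1..n. (cmod (A i k))\<^sup>2)"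
  have "(l2norm m (mat_vec n A x))\<^sup>2 \<le> B * (l2norm n x)\<^sup>2" for x
  proof -
    have "(cmod (mat_vec n A x i))\<^sup>2 \<le> (\<Sum>k=1..n. (cmod (A i k))\<^sup>2) * (l2norm n x)\<^sup>2" for i
    proof -
      have "cmod (mat_vec n A x i) \<le> (\<Sum>k=1..n. cmod (A i k) * cmod (x k))"
        unfolding mat_vec_def by (rule order_trans[OF norm_sum]) (simp add: norm_mult)
      then have "(cmod (mat_vec n A x i))\<^sup>2 \<le> (\<Sum>k=1..n. cmod (A i k) * cmod (x k))\<^sup>2"
        by (rule power_mono) simp
      also have "\<dots> \<le> (\<Sum>k=1..n. (cmod (A i k))\<^sup>2) * (\<Sum>k=1..n. (cmod (x k))\<^sup>2)"
        by (rule Cauchy_Schwarz_ineq_sum)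
      finally show ?thesis by (simp add: l2norm_sq)
    qed
    then have "(\<Sum>i=1..m. (cmod (mat_vec n A x i))\<^sup>2) \<le>
        (\<Sum>i=1..m. (\<Sum>k=1..n. (cmod (A i k))\<^sup>2) * (l2norm n x)\<^sup>2)"
      by (intro sum_mono)
    then show ?thesis by (simp add: l2norm_sq B_def sum_distrib_right)
  qed
  moreover have "B \<ge> 0" unfolding B_def by (intro sum_nonneg) simp
  ultimately show ?thesis by blast
qed

lemma rip_bound_mono: "rip_bound m n s A d \<Longrightarrow> d \<le> e \<Longrightarrow> rip_bound m n s A e"
  unfolding rip_bound_def
  by (meson add_left_mono diff_left_mono mult_right_mono order_trans zero_le_power2)

lemma rip_bound_ri_const:
  assumes n: "n \<ge> 1" and s: "s \<ge> 1"
  shows "rip_bound m n s A (ri_const m n s A)"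
    and "rip_bound m n s A d \<Longrightarrow> ri_const m n s A \<le> d"
    and "ri_const m n s A \<ge> 0"
proof -
  let ?S = "{d. rip_bound m n s A d}"
  define d0 where "d0 = Inf ?S"
  have nonneg: "d \<ge> 0" if "d \<in> ?S" for d
  proof -
    define e where "e = (\<lambda>j::nat. if j = 1 then 1 else 0 :: complex)"
    have "{j \<in> {1..n}. e j \<noteq> 0} = {1}" using n by (auto simp: e_def)
    then have sp: "sparse n s e" using s by (simp add: sparse_def)
    have "(l2norm n e)\<^sup>2 = (\<Sum>j=1..n. if j = 1 then 1 else 0)"
      unfolding l2norm_sq by (rule sum.cong) (auto simp: e_def)
    also have "\<dots> = 1" using n by (subst sum.delta) auto
    finally have "(l2norm n e)\<^sup>2 = 1" .
    then have "1 - d \<le> 1 + d" using that sp unfolding rip_bound_def by fastforce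
    then show ?thesis by simp
  qed
  then have bdd: "bdd_below ?S" by (rule bdd_belowI)
  obtain B where B: "B \<ge> 0" "\<And>x. (l2norm m (mat_vec n A x))\<^sup>2 \<le> B * (l2norm n x)\<^sup>2"
    using l2norm_mat_vec_bound by blast
  have "rip_bound m n s A (1 + B)"
    unfolding rip_bound_def
  proof (intro allI impI conjI)
    fix x
    have "(1 - (1 + B)) * (l2norm n x)\<^sup>2 \<le> 0" using B(1) by (simp add: mult_nonneg_nonneg)
    then show "(1 - (1 + B)) * (l2norm n x)\<^sup>2 \<le> (l2norm m (mat_vec n A x))\<^sup>2"
      by (rule order_trans) simp
    show "(l2norm m (mat_vec n A x))\<^sup>2 \<le> (1 + (1 + B)) * (l2norm n x)\<^sup>2"
      by (rule order_trans[OF B(2)]) (intro mult_right_mono, auto)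
  qed
  then have ne: "?S \<noteq> {}" by blast
  have "closed ?S"
    unfolding rip_bound_def
    by (intro closed_Collect_all closed_Collect_imp closed_Collect_conj closed_Collect_le
        open_Collect_const continuous_intros)
  then have d0: "rip_bound m n s A d0"
    using closed_contains_Inf[OF ne bdd] by (simp add: d0_def)
  have le: "d0 \<le> d" if "rip_bound m n s A d" for d
    unfolding d0_def using that bdd by (intro cInf_lower) auto
  have eq: "ri_const m n s A = d0"
    unfolding ri_const_def using d0 le by (rule Least_equality)
  show "rip_bound m n s A (ri_const m n s A)" using d0 eq by simp
  show "rip_bound m n s A d \<Longrightarrow> ri_const m n s A \<le> d" using le eq by simp
  show "ri_const m n s A \<ge> 0" using nonneg d0 eq by simp
qed

end

theory Submission
  imports Defs
begin

text \<open>
  For \<open>x\<close> in the set of \<open>s\<close>-sparse unit vectors, \<open>\<Phi> x = V\<^sub>x \<xi>\<close> for a matrix \<open>V\<^sub>x\<close>, and the deviation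
  of the square norm of \<open>\<Phi> x\<close> from that of \<open>x\<close> splits into a diagonal part and an off-diagonal
  chaos. The diagonal part is a convex combination of \<open>n\<close> averages of the \<open>\<xi>\<^sub>j\<^sup>2 - 1\<close>, so Bernstein's
  inequality and a union bound suffice. The chaos is the average over all \<open>I\<close> of the bilinear forms
  \<open>4 \<langle>V\<^sub>x \<xi>\<^sub>I, V\<^sub>x \<xi>\<^sub>J\<rangle>\<close> with \<open>J\<close> the complement of \<open>I\<close>; given \<open>\<xi>\<^sub>J\<close>, an increment of such a form
  in \<open>\<xi>\<^sub>I\<close> is subgaussian with parameter the operator norm of an increment of \<open>V\<close> times the supremum
  of the image norms. Chaining therefore bounds the \<open>p\<close>-th moment of the supremum by Dudley's sum
  times the moment of the image norms, and the latter are again controlled by the chaos, which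
  closes the estimate. The operator norm of \<open>V\<^sub>x\<close> is at most the sup norm of the Fourier transform of
  \<open>x\<close> divided by the square root of \<open>m\<close>, and in this norm Maurey's empirical method provides nets
  of cardinality \<open>exp (O (4\<^sup>k (log n)^2))\<close> at the scales \<open>2\<^sup>-\<^sup>k sqrt (s / m)\<close>. About \<open>log s\<close> of these
  scales suffice, since the finest net can be taken to be a grid of logarithmic size \<open>O (s log n)\<close>.
\<close>

subsection \<open>Moment generating functions of subgaussian variables\<close>

text \<open>The circularity is resolved at the level of moments. Decoupling a chaos on
  \<open>J\<close> produces image norms of the blocks \<open>I\<close> and \<open>J - I\<close>,
  hence chaoses on these blocks, so the recursion closes only for the maximum of the
  \<open>p\<close>-th moments over all blocks. In an increment the supremum of image norms
  multiplies a normalised linear form that depends on the same variables; a weighted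
  arithmetic-geometric inequality separates the two factors, and its weight is the free parameter
  that makes the recursion contractive. Finite nets keep suprema measurable and all moments finite.
  The order \<open>p\<close> is comparable to the maximum in the hypothesis on \<open>m\<close>. At
  scale \<open>k\<close> the radius \<open>2^-k sqrt (s / m)\<close> times the root
  \<open>2^k ln n\<close> of the entropy does not depend on \<open>k\<close>, so about
  \<open>ln s\<close> scales contribute \<open>sqrt (s / m) * ln s * ln n\<close>, which is at most
  \<open>sqrt (s * p / m)\<close>. Markov's inequality for the \<open>p\<close>-th moment then
  yields a failure probability \<open>exp (- p)\<close>; this is where
  \<open>ln (1 / \<eta>)\<close> enters.\<close>

lemma exp_le_one_plus_quadratic:
  fixes y :: real
  shows "exp y \<le> 1 + y + y^2 * exp \<bar>y\<bar>"
proof -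
  obtain t where t: "\<bar>t\<bar> \<le> \<bar>y\<bar>" "exp y = (\<Sum>m<2. y ^ m / fact m) + exp t / fact 2 * y ^ 2"
    using Maclaurin_exp_le[of y 2] by blast
  have "exp t / 2 \<le> exp \<bar>y\<bar>" using t(1)
    by (smt (verit) exp_ge_zero exp_le_cancel_iff field_sum_of_halves)
  then have "exp t / 2 * y^2 \<le> exp \<bar>y\<bar> * y^2" by (rule mult_right_mono) simp
  then show ?thesis using t(2) by (simp add: numeral_2_eq_2 mult.commute)
qed

text \<open>For a centred bounded variable the linear term drops out in the mean, which leaves a
  Hoeffding bound valid for every multiple of the variable. The greedy selection of atoms rests on
  it.\<close>

lemma exp_le_self_plus_exp_square:
  fixes y :: real
  shows "exp y \<le> y + exp (y^2)"
proof -
  define E where "E = exp (y^2)"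
  have e: "1 + y^2 \<le> E" by (simp add: E_def)
  consider "y > 1" | "0 \<le> y" "y \<le> 1" | "-1 \<le> y" "y < 0" | "y < -1" by linarith
  then have "exp y \<le> y + E"
  proof cases
    case 1
    then have "y \<le> y^2" by (simp add: power2_eq_square)
    then have "exp y \<le> E" by (simp add: E_def)
    with 1 show ?thesis by linarith
  next
    case 2
    then have "exp y \<le> 1 + y + y^2" by (rule exp_bound)
    then show ?thesis using e by linarith
  next
    case 3
    define t where "t = - y"
    have t: "0 \<le> t" "t \<le> 1" using 3 by (auto simp: t_def)
    have l: "1 + t + t^2 / 2 \<le> exp t" using exp_lower_Taylor_quadratic t by simp
    have "1 \<le> (1 - t + t^2) * (1 + t + t^2 / 2)"
    proof -
      have "(1 - t + t^2) * (1 + t + t^2 / 2) = 1 + t^2/2 + t^3/2 + t^4/2"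
        by (simp add: field_simps power2_eq_square power3_eq_cube power4_eq_xxxx)
      then show ?thesis using t by simp
    qed
    also have "\<dots> \<le> (1 - t + t^2) * exp t"
      using l t by (intro mult_left_mono) auto
    finally have "exp (-t) \<le> 1 - t + t^2" by (simp add: exp_minus field_simps)
    then show ?thesis using e by (simp add: t_def)
  next
    case 4
    then have "exp y \<le> 1" by simp
    moreover have "0 \<le> y + y^2" using mult_nonpos_nonpos[of y "1+y"] 4
      by (simp add: power2_eq_square algebra_simps)
    ultimately show ?thesis using e by linarith
  qed
  then show ?thesis by (simp add: E_def)
qed

text \<open>Centring cancels the linear term of the pointwise bound. The weight
  \<open>exp (t * \<bar>X w\<bar>)\<close> lets a single moment serve all
  \<open>\<bar>l\<bar> \<le> t\<close>. It is applied both to the variable and to its centred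
  square.\<close>

lemma (in prob_space) mgf_bound:
  fixes X :: "'a \<Rightarrow> real"
  assumes "integrable M X" "expectation X = 0"
    and "integrable M (\<lambda>w. (X w)^2 * exp (t * \<bar>X w\<bar>))"
    and "expectation (\<lambda>w. (X w)^2 * exp (t * \<bar>X w\<bar>)) \<le> C"
    and "\<bar>l\<bar> \<le> t"
  shows "integrable M (\<lambda>w. exp (l * X w))" "expectation (\<lambda>w. exp (l * X w)) \<le> exp (C * l^2)" (is ?goal2)
proof -
  let ?g = "\<lambda>w. 1 + l * X w + l^2 * ((X w)^2 * exp (t * \<bar>X w\<bar>))"
  have [measurable]: "X \<in> borel_measurable M" using assms(1) by simp
  have le: "exp (l * X w) \<le> ?g w" for w
  proof -
    have "exp \<bar>l * X w\<bar> \<le> exp (t * \<bar>X w\<bar>)"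
      using assms(5) by (simp add: abs_mult mult_right_mono)
    then have "(l * X w)^2 * exp \<bar>l * X w\<bar> \<le> (l * X w)^2 * exp (t * \<bar>X w\<bar>)"
      by (rule mult_left_mono) simp
    then show ?thesis using exp_le_one_plus_quadratic[of "l * X w"]
      by (simp add: power_mult_distrib mult.assoc)
  qed
  have gi: "integrable M ?g" using assms by auto
  show int: "integrable M (\<lambda>w. exp (l * X w))"
    by (rule Bochner_Integration.integrable_bound[OF gi])
      (use le in \<open>auto intro!: AE_I2 order_trans[OF _ abs_ge_self]\<close>)
  have "expectation (\<lambda>w. exp (l * X w)) \<le> expectation ?g"
    by (intro integral_mono int gi le)
  also have "\<dots> = 1 + l^2 * expectation (\<lambda>w. (X w)^2 * exp (t * \<bar>X w\<bar>))"
    using assms by (simp add: prob_space)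
  also have "\<dots> \<le> 1 + l^2 * C" using assms(4) by (intro add_left_mono mult_left_mono) auto
  also have "\<dots> \<le> exp (C * l^2)" using exp_ge_add_one_self[of "C * l^2"] by (simp add: mult.commute)
  finally show ?goal2 .
qed

text \<open>Sum over \<open>k\<close> of the series
  \<open>2 * exp ((k + 1) / 4) * exp (- k / 2)\<close>.\<close>

definition sg_const :: real where "sg_const = 2 * exp (1/4) / (1 - exp (-1/4))"

text \<open>Split by the integer part \<open>k\<close> of \<open>(X w)^2 / L^2\<close>: the
  exponential is at most \<open>exp ((k + 1) / 4)\<close> there, the tail at most
  \<open>2 * exp (- k / 2)\<close>. Half of the critical exponent leaves a convergent geometric
  series.\<close>

lemma (in prob_space) subgaussian_exp_square:
  assumes [measurable]: "X \<in> borel_measurable M" and "L > 0" and sg: "subgaussian M L X"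
  shows "integrable M (\<lambda>w. exp ((X w)^2 / (4 * L^2)))"
    and "expectation (\<lambda>w. exp ((X w)^2 / (4 * L^2))) \<le> sg_const"
proof -
  let ?e = "\<lambda>k::nat. exp ((real k + 1) / 4)"
  define E where "E k = {w \<in> space M. \<bar>X w\<bar> \<ge> L * sqrt (real k)}" for k :: nat
  have [measurable]: "E k \<in> sets M" for k unfolding E_def by simp
  have prb: "prob (E k) \<le> 2 * exp (- real k / 2)" for k
  proof (cases "k = 0")
    case True
    then show ?thesis using order_trans[OF prob_le_1[of "E k"], of 2] by simp
  next
    case False
    then have "prob (E k) \<le> 2 * exp (- (L * sqrt (real k))\<^sup>2 / (2 * L^2))"
      using sg \<open>L > 0\<close> unfolding subgaussian_def E_def by simp
    also have "- (L * sqrt (real k))\<^sup>2 / (2 * L^2) = - real k / 2"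
      using \<open>L > 0\<close> by (simp add: power_mult_distrib)
    finally show ?thesis .
  qed
  let ?h = "\<lambda>w. exp ((X w)^2 / (4 * L^2))"
  have pt: "ennreal (?h w) \<le> (\<Sum>k. ennreal (?e k) * indicator (E k) w)"
    if "w \<in> space M" for w
  proof -
    define k where "k = nat \<lfloor>(X w)^2 / L^2\<rfloor>"
    have k: "real k \<le> (X w)^2 / L^2" "(X w)^2 / L^2 \<le> real k + 1"
    proof -
      have "0 \<le> (X w)^2 / L^2" by simp
      then have "real k = of_int \<lfloor>(X w)^2 / L^2\<rfloor>" unfolding k_def by (simp only: of_nat_nat zero_le_floor)
      then show "real k \<le> (X w)^2 / L^2" "(X w)^2 / L^2 \<le> real k + 1"
        by linarith+
    qed
    have "L^2 * real k \<le> (X w)^2" using k(1) \<open>L > 0\<close> by (simp add: field_simps)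
    then have "sqrt (L^2 * real k) \<le> sqrt ((X w)^2)" by (rule real_sqrt_le_mono)
    then have "w \<in> E k" using \<open>L > 0\<close> that by (simp add: E_def real_sqrt_mult)
    have "?h w \<le> ?e k" using k(2) by (simp add: field_simps)
    then have "ennreal (?h w) \<le> ennreal (?e k) * indicator (E k) w"
      using \<open>w \<in> E k\<close> by (simp add: ennreal_leI)
    also have "\<dots> = (\<Sum>i\<in>{k}. ennreal (exp ((real i + 1) / 4)) * indicator (E i) w)"
      by (simp only: sum.insert[OF finite.emptyI] empty_iff not_False_eq_True sum.empty add_0_right)
    also have "\<dots> \<le> (\<Sum>i. ennreal (exp ((real i + 1) / 4)) * indicator (E i) w)"
      by (rule sum_le_suminf) auto
    finally show ?thesis .
  qed
  have gs: "(\<lambda>k. 2 * exp (1/4) * exp (- (1/4)) ^ k) sums (2 * exp (1/4) * (1 / (1 - exp (- (1/4::real)))))"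
    by (intro sums_mult geometric_sums) simp
  have "(\<integral>\<^sup>+w. ennreal (?h w) \<partial>M) \<le> (\<integral>\<^sup>+w. (\<Sum>k. ennreal (?e k) * indicator (E k) w) \<partial>M)"
    by (intro nn_integral_mono pt)
  also have "\<dots> = (\<Sum>k. \<integral>\<^sup>+w. ennreal (?e k) * indicator (E k) w \<partial>M)"
    by (rule nn_integral_suminf) measurable
  also have "\<dots> = (\<Sum>k. ennreal (?e k * prob (E k)))"
    by (simp add: nn_integral_cmult_indicator emeasure_eq_measure ennreal_mult)
  also have "\<dots> \<le> (\<Sum>k. ennreal (2 * exp (1/4) * exp (- (1/4)) ^ k))"
  proof (intro suminf_le ennreal_leI)
    fix k
    have "?e k * prob (E k) \<le> ?e k * (2 * exp (- real k / 2))"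
      using prb by (intro mult_left_mono) auto
    also have "\<dots> = 2 * exp (1/4) * exp (- (1/4)) ^ k"
      by (simp add: exp_add[symmetric] exp_of_nat_mult[symmetric] add_divide_distrib)
    finally show "?e k * prob (E k) \<le> 2 * exp (1/4) * exp (- (1/4)) ^ k" .
  qed auto
  also have "\<dots> = ennreal sg_const"
    using gs by (subst suminf_ennreal_eq[OF _ gs]) (auto simp: sg_const_def)
  finally have le: "(\<integral>\<^sup>+w. ennreal (?h w) \<partial>M) \<le> ennreal sg_const" .
  show i: "integrable M ?h"
    by (rule integrableI_nonneg) (use le in \<open>auto simp: top.not_eq_extremum intro: le_less_trans\<close>)
  have "ennreal (expectation ?h) \<le> ennreal sg_const"
    using le nn_integral_eq_integral[OF i] by simp
  moreover have "sg_const \<ge> 0" by (simp add: sg_const_def)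
  ultimately show "expectation ?h \<le> sg_const" by simp
qed

lemma sg_const_ge1: "sg_const \<ge> 1"
proof -
  have "exp (-(1/4)::real) < 1" "exp (-(1/4)::real) > 0" "exp (1/4::real) \<ge> 1" by auto
  then have "exp (-(1/4)::real) < 1" "1 - exp (-(1/4)::real) \<le> 2 * exp (1/4)" by linarith+
  then show ?thesis unfolding sg_const_def by (simp add: le_divide_eq)
qed

text \<open>A sum of nonnegative terms, so that it dominates three constants at once: those for
  small \<open>l\<close>, for the centred square and for large \<open>l\<close>.\<close>

definition mgf_const :: "real \<Rightarrow> real" where
  "mgf_const L = 2 * sg_const * (8 * L^2 * exp 1 + 128 * L^4 * exp (1 / (4 * L^2))) + L^2 + 4 * L^2 * ln sg_const"

lemma mgf_const_pos: assumes "L > 0" shows "mgf_const L > 0"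
proof -
  have "0 \<le> 2 * sg_const * (8 * L^2 * exp 1 + 128 * L^4 * exp (1 / (4 * L^2)))" "0 \<le> 4 * L^2 * ln sg_const"
    using sg_const_ge1 by (auto intro!: mult_nonneg_nonneg add_nonneg_nonneg)
  moreover have "L^2 > 0" using assms by simp
  ultimately show ?thesis unfolding mgf_const_def by linarith
qed

text \<open>Near zero centring gives the quadratic exponent. For \<open>l^2 \<ge> a\<close>
  completing the square suffices: the surplus factor \<open>sg_const\<close> moves into the exponent
  because \<open>l^2 / a \<ge> 1\<close>. The square of \<open>X\<close> has only exponential tails,
  hence the bounded range of \<open>l\<close> in its two bounds.\<close>

lemma (in prob_space) subgaussian_mgf:
  assumes L: "L > 0" and X: "integrable M X" "expectation X = 0" "variance X = 1"
    and sg: "subgaussian M L X"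
  defines "k \<equiv> mgf_const L"
  shows "integrable M (\<lambda>w. exp (l * X w))"
    and "expectation (\<lambda>w. exp (l * X w)) \<le> exp (k * l^2)" (is ?goal2)
    and "\<bar>l\<bar> \<le> 1 / (8 * L^2) \<Longrightarrow> integrable M (\<lambda>w. exp (l * ((X w)^2 - 1)))"
    and "\<bar>l\<bar> \<le> 1 / (8 * L^2) \<Longrightarrow> expectation (\<lambda>w. exp (l * ((X w)^2 - 1))) \<le> exp (k * l^2)"
proof -
  define a where "a = 1 / (4 * L^2)"
  have a: "a > 0" using L by (simp add: a_def)
  have [measurable]: "X \<in> borel_measurable M" using X(1) by simp
  let ?h = "\<lambda>w. exp (a * (X w)^2)"
  have h: "integrable M ?h" "expectation ?h \<le> sg_const"
    using subgaussian_exp_square[OF _ L sg] by (simp_all add: a_def)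
  have quad: "y^2 \<le> 2 * exp y" if "y \<ge> 0" for y :: real
    using exp_lower_Taylor_quadratic[OF that] that by linarith
  have lin: "y \<le> exp y" for y :: real using exp_ge_add_one_self[of y] by linarith
  have s1: "2 / a * exp (1/2) \<le> 8 * L^2 * exp 1" "8 / a^2 * exp a = 128 * L^4 * exp (1 / (4 * L^2))"
    using L by (auto simp: a_def field_simps power2_eq_square power4_eq_xxxx)
  have C0: "0 < sg_const" using sg_const_ge1 by linarith
  have sq: "integrable M (\<lambda>w. (X w)^2)"
  proof (rule Bochner_Integration.integrable_bound[where f = "\<lambda>w. (1/a) * ?h w"])
    show "AE x in M. norm ((X x)^2) \<le> norm (1 / a * exp (a * (X x)^2))"
      using lin[of "a * (X _)^2"] a by (auto simp: field_simps)
  qed (use h in auto)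
  have e2: "expectation (\<lambda>w. (X w)^2) = 1" using X(2,3) by simp
  define C1 where "C1 = 2 / a * exp (1/2) * sg_const"
  define C2 where "C2 = 8 / a^2 * exp a * sg_const"
  \<comment> \<open>Half of the exponent \<open>a * (X w)^2\<close> absorbs the polynomial factor,
    the other half the exponential of \<open>sqrt a * \<bar>X w\<bar>\<close>.\<close>
  have p1: "(X w)^2 * exp (sqrt a * \<bar>X w\<bar>) \<le> 2 / a * exp (1/2) * ?h w" for w
  proof -
    have 1: "(X w)^2 \<le> 2 / a * exp (a * (X w)^2 / 2)"
      using lin[of "a * (X w)^2 / 2"] a by (simp add: field_simps)
    have "0 \<le> (sqrt a * \<bar>X w\<bar> - 1)^2" by simp
    then have "sqrt a * \<bar>X w\<bar> \<le> 1/2 + a * (X w)^2 / 2"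
      using a by (simp add: power2_diff power_mult_distrib)
    then have 2: "exp (sqrt a * \<bar>X w\<bar>) \<le> exp (1/2 + a * (X w)^2 / 2)" by simp
    have "(X w)^2 * exp (sqrt a * \<bar>X w\<bar>) \<le> 2 / a * exp (a * (X w)^2 / 2) * exp (1/2 + a * (X w)^2 / 2)"
      using 1 2 a by (intro mult_mono) auto
    also have "\<dots> = 2 / a * exp (1/2) * ?h w" by (simp add: exp_add[symmetric])
    finally show ?thesis .
  qed
  have p2: "((X w)^2 - 1)^2 * exp (a / 2 * \<bar>(X w)^2 - 1\<bar>) \<le> 8 / a^2 * exp a * ?h w" for w
  proof -
    define z where "z = \<bar>(X w)^2 - 1\<bar>"
    have z: "z \<ge> 0" "z \<le> (X w)^2 + 1" unfolding z_def by (auto simp: abs_le_iff)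
    have "(a / 2 * z)^2 \<le> 2 * exp (a / 2 * z)" using quad a z by simp
    then have "z^2 \<le> 8 / a^2 * exp (a / 2 * z)" using a by (simp add: field_simps power_mult_distrib)
    then have "z^2 * exp (a / 2 * z) \<le> 8 / a^2 * exp (a / 2 * z) * exp (a / 2 * z)"
      by (rule mult_right_mono) simp
    also have "\<dots> = 8 / a^2 * exp (a * z)" by (simp add: exp_add[symmetric])
    also have "\<dots> \<le> 8 / a^2 * exp (a * ((X w)^2 + 1))"
      using z a by (intro mult_left_mono) auto
    also have "\<dots> = 8 / a^2 * exp a * ?h w" by (simp add: exp_add[symmetric] algebra_simps)
    finally show ?thesis by (simp add: z_def)
  qed
  have i1: "integrable M (\<lambda>w. (X w)^2 * exp (sqrt a * \<bar>X w\<bar>))"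
    by (rule Bochner_Integration.integrable_bound[where f = "\<lambda>w. 2 / a * exp (1/2) * ?h w"])
      (use h p1 a in \<open>auto simp: abs_mult\<close>)
  have i2: "integrable M (\<lambda>w. ((X w)^2 - 1)^2 * exp (a / 2 * \<bar>(X w)^2 - 1\<bar>))"
    by (rule Bochner_Integration.integrable_bound[where f = "\<lambda>w. 8 / a^2 * exp a * ?h w"])
      (use h p2 a in \<open>auto simp: abs_mult\<close>)
  have b1: "expectation (\<lambda>w. (X w)^2 * exp (sqrt a * \<bar>X w\<bar>)) \<le> C1"
  proof -
    have "expectation (\<lambda>w. (X w)^2 * exp (sqrt a * \<bar>X w\<bar>)) \<le> expectation (\<lambda>w. 2 / a * exp (1/2) * ?h w)"
      by (intro integral_mono i1 p1) (use h in auto)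
    also have "\<dots> \<le> C1" unfolding C1_def using h a by (simp add: divide_right_mono)
    finally show ?thesis .
  qed
  have b2: "expectation (\<lambda>w. ((X w)^2 - 1)^2 * exp (a / 2 * \<bar>(X w)^2 - 1\<bar>)) \<le> C2"
  proof -
    have "expectation (\<lambda>w. ((X w)^2 - 1)^2 * exp (a / 2 * \<bar>(X w)^2 - 1\<bar>)) \<le> expectation (\<lambda>w. 8 / a^2 * exp a * ?h w)"
      by (intro integral_mono i2 p2) (use h in auto)
    also have "\<dots> \<le> C2" unfolding C2_def using h a by (simp add: divide_right_mono)
    finally show ?thesis .
  qed
  have lnC: "ln sg_const \<ge> 0" using sg_const_ge1 by simp
  have ka: "C1 \<le> k" "C2 \<le> k" "1 / (4 * a) + ln sg_const / a \<le> k"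
  proof -
    have A: "C1 \<le> 8 * L^2 * exp 1 * sg_const" "C2 = 128 * L^4 * exp (1 / (4 * L^2)) * sg_const"
      using mult_right_mono[OF s1(1), of sg_const] s1(2) C0 unfolding C1_def C2_def by auto
    have B: "0 \<le> 8 * L^2 * exp 1 * sg_const" "0 \<le> 128 * L^4 * exp (1 / (4 * L^2)) * sg_const" "0 \<le> 4 * L^2 * ln sg_const" "0 \<le> L^2"
      using C0 lnC by auto
    have C: "1 / (4 * a) + ln sg_const / a = L^2 + 4 * L^2 * ln sg_const" using L by (simp add: a_def)
    have "k = 2 * (8 * L^2 * exp 1 * sg_const) + 2 * (128 * L^4 * exp (1 / (4 * L^2)) * sg_const) + L^2 + 4 * L^2 * ln sg_const"
      unfolding k_def mgf_const_def by (simp add: algebra_simps)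
    then show "C1 \<le> k" "C2 \<le> k" "1 / (4 * a) + ln sg_const / a \<le> k"
      using A B C by linarith+
  qed
  have big: "exp (l * X w) \<le> exp (l^2 / (4 * a)) * ?h w" for w
  proof -
    have "0 \<le> (2 * a * X w - l)^2" by simp
    then have "l * X w \<le> l^2 / (4 * a) + a * (X w)^2"
      using a by (simp add: power2_eq_square field_simps)
    then show ?thesis by (simp add: exp_add[symmetric])
  qed
  show int: "integrable M (\<lambda>w. exp (l * X w))"
    by (rule Bochner_Integration.integrable_bound[where f = "\<lambda>w. exp (l^2 / (4 * a)) * ?h w"])
      (use h big in \<open>auto simp: abs_mult\<close>)
  show ?goal2
  proof (cases "\<bar>l\<bar> \<le> sqrt a")
    case True
    have "expectation (\<lambda>w. exp (l * X w)) \<le> exp (C1 * l^2)"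
      by (rule mgf_bound(2)[OF X(1,2) i1 b1 True])
    also have "\<dots> \<le> exp (k * l^2)" using ka by (simp add: mult_right_mono)
    finally show ?thesis .
  next
    case False
    then have la: "a \<le> l^2"
      by (metis a less_eq_real_def linorder_not_le not_le_imp_less real_sqrt_abs real_sqrt_le_iff)
    have "expectation (\<lambda>w. exp (l * X w)) \<le> expectation (\<lambda>w. exp (l^2 / (4 * a)) * ?h w)"
      by (intro integral_mono int big) (use h in auto)
    also have "\<dots> \<le> exp (l^2 / (4 * a)) * sg_const" using h by simp
    also have "\<dots> = exp (l^2 / (4 * a) + ln sg_const * 1)" using C0 by (simp add: exp_add)
    also have "\<dots> \<le> exp (l^2 / (4 * a) + ln sg_const * (l^2 / a))"
    proof -
      have "1 \<le> l^2 / a" using la a by simp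
      then have "ln sg_const * 1 \<le> ln sg_const * (l^2 / a)" using lnC by (rule mult_left_mono)
      then show ?thesis by simp
    qed
    also have "l^2 / (4 * a) + ln sg_const * (l^2 / a) = (1 / (4 * a) + ln sg_const / a) * l^2" by (simp add: algebra_simps)
    also have "exp \<dots> \<le> exp (k * l^2)"
      unfolding exp_le_cancel_iff by (rule mult_right_mono[OF ka(3)]) simp
    finally show ?thesis .
  qed
  have a2: "a / 2 = 1 / (8 * L^2)" by (simp add: a_def)
  have z: "integrable M (\<lambda>w. (X w)^2 - 1)" "expectation (\<lambda>w. (X w)^2 - 1) = 0"
    using sq e2 by (auto simp: prob_space)
  show "integrable M (\<lambda>w. exp (l * ((X w)^2 - 1)))" if "\<bar>l\<bar> \<le> 1 / (8 * L^2)"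
    by (rule mgf_bound(1)[OF z i2 b2]) (use that a2 in simp)
  have "expectation (\<lambda>w. exp (l * ((X w)^2 - 1))) \<le> exp (C2 * l^2)" if "\<bar>l\<bar> \<le> 1 / (8 * L^2)"
    by (rule mgf_bound(2)[OF z i2 b2]) (use that a2 in simp)
  also have "exp (C2 * l^2) \<le> exp (k * l^2)" using ka by (simp add: mult_right_mono)
  finally show "expectation (\<lambda>w. exp (l * ((X w)^2 - 1))) \<le> exp (k * l^2)" if "\<bar>l\<bar> \<le> 1 / (8 * L^2)"
    using that .
qed

subsection \<open>Linear forms with independent coefficients\<close>

text \<open>The law of the random vector is taken as a product measure on the coordinates, so that
  conditioning on a block of variables becomes Fubini. Subgaussianity enters only through the
  generating function.\<close>

locale subg_product = finite_product_prob_space \<mu> N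
  for \<mu> :: "nat \<Rightarrow> real measure" and N :: "nat set" +
  fixes \<kappa> :: real
  assumes sets_mu [measurable_cong, simp]: "\<And>j. sets (\<mu> j) = sets borel"
    and mgf_integrable: "\<And>j l. j \<in> N \<Longrightarrow> integrable (\<mu> j) (\<lambda>x. exp (l * x))"
    and mgf_le: "\<And>j l. j \<in> N \<Longrightarrow> (\<integral>x. exp (l * x) \<partial>\<mu> j) \<le> exp (\<kappa> * l^2)"
    and kappa_pos: "\<kappa> > 0"
begin

abbreviation "PP \<equiv> PiM N \<mu>"

text \<open>Conditionally on the coordinates outside \<open>I\<close> the coefficients are
  constants, so the inner integral over the block \<open>I\<close> factorises. The bound on the
  coefficients is uniform in \<open>w\<close>, hence so is the inner bound, and the outer integral
  costs nothing.\<close>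

lemma linear_mgf:
  assumes IN: "I \<subseteq> N"
    and cm: "\<And>j. j \<in> I \<Longrightarrow> c j \<in> borel_measurable PP"
    and dep: "\<And>j w w'. j \<in> I \<Longrightarrow> (\<And>k. k \<in> N - I \<Longrightarrow> w k = w' k) \<Longrightarrow> c j w = c j w'"
    and bnd: "\<And>w. (\<Sum>j\<in>I. (c j w)^2) \<le> 1"
  shows "(\<integral>\<^sup>+w. ennreal (exp (l * (\<Sum>j\<in>I. w j * c j w))) \<partial>PP) \<le> ennreal (exp (\<kappa> * l^2))"
proof -
  define J where "J = N - I"
  have fin: "finite I" "finite J" using finite_subset[OF IN finite_index] finite_index by (auto simp: J_def)
  have N: "N = J \<union> I" "J \<inter> I = {}" using IN by (auto simp: J_def)
  define f where "f w = ennreal (exp (l * (\<Sum>j\<in>I. w j * c j w)))" for w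
  have cw: "(\<lambda>w. w j) \<in> borel_measurable PP" if "j \<in> I" for j
    using measurable_component_singleton[of j N \<mu>] that IN sets_mu[of j]
    by (auto simp: measurable_cong_sets[OF refl sets_mu])
  have fm: "f \<in> borel_measurable (PiM (J \<union> I) \<mu>)"
    unfolding f_def N(1)[symmetric] using cw cm by measurable
  have inner: "(\<integral>\<^sup>+y. f (merge J I (x, y)) \<partial>PiM I \<mu>) \<le> ennreal (exp (\<kappa> * l^2))" for x
  proof -
    have cx: "c j (merge J I (x, y)) = c j x" if "j \<in> I" for j y
      by (rule dep[OF that]) (auto simp: merge_def J_def)
    have "f (merge J I (x, y)) = (\<Prod>j\<in>I. ennreal (exp ((l * c j x) * y j)))" for y
    proof -
      have "(\<Sum>j\<in>I. merge J I (x, y) j * c j (merge J I (x, y))) = (\<Sum>j\<in>I. y j * c j x)"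
        using N(2) cx by (intro sum.cong) auto
      then have "f (merge J I (x, y)) = ennreal (exp (\<Sum>j\<in>I. (l * c j x) * y j))"
        by (simp add: f_def sum_distrib_left mult_ac)
      then show ?thesis by (simp add: exp_sum fin prod_ennreal)
    qed
    then have "(\<integral>\<^sup>+y. f (merge J I (x, y)) \<partial>PiM I \<mu>)
        = (\<Prod>j\<in>I. \<integral>\<^sup>+y. ennreal (exp ((l * c j x) * y)) \<partial>\<mu> j)"
      using product_nn_integral_prod[OF fin(1), of "\<lambda>j y. ennreal (exp ((l * c j x) * y))"] by simp
    also have "\<dots> = (\<Prod>j\<in>I. ennreal (\<integral>y. exp ((l * c j x) * y) \<partial>\<mu> j))"
      using IN by (intro prod.cong refl nn_integral_eq_integral mgf_integrable) auto
    also have "\<dots> = ennreal (\<Prod>j\<in>I. (\<integral>y. exp ((l * c j x) * y) \<partial>\<mu> j))"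
      by (intro prod_ennreal integral_nonneg) auto
    also have "\<dots> \<le> ennreal (\<Prod>j\<in>I. exp (\<kappa> * (l * c j x)^2))"
      using IN mgf_le by (intro ennreal_leI prod_mono conjI integral_nonneg) auto
    also have "\<dots> = ennreal (exp (\<kappa> * l^2 * (\<Sum>j\<in>I. (c j x)^2)))"
      by (simp add: exp_sum[symmetric] fin sum_distrib_left power_mult_distrib mult.assoc)
    also have "\<dots> \<le> ennreal (exp (\<kappa> * l^2 * 1))"
      unfolding ennreal_le_iff[OF exp_ge_zero] exp_le_cancel_iff
      using bnd[of x] kappa_pos by (intro mult_left_mono) auto
    finally show ?thesis by simp
  qed
  interpret J: prob_space "PiM J \<mu>"
    by (intro prob_space_PiM M.prob_space_axioms)
  have "(\<integral>\<^sup>+w. f w \<partial>PP) = (\<integral>\<^sup>+x. (\<integral>\<^sup>+y. f (merge J I (x, y)) \<partial>PiM I \<mu>) \<partial>PiM J \<mu>)"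
    using product_nn_integral_fold[OF N(2) fin(2,1) fm] N(1) by simp
  also have "\<dots> \<le> (\<integral>\<^sup>+x. ennreal (exp (\<kappa> * l^2)) \<partial>PiM J \<mu>)"
    by (intro nn_integral_mono inner)
  also have "\<dots> = ennreal (exp (\<kappa> * l^2))" by (simp add: J.emeasure_space_1)
  finally show ?thesis by (simp add: f_def)
qed

lemma component_measurable [measurable]:
  "j \<in> N \<Longrightarrow> (\<lambda>w. w j) \<in> borel_measurable PP"
  using measurable_component_singleton[of j N \<mu>] by (auto simp: measurable_cong_sets[OF refl sets_mu])

lemma component_measurable_subset: "I \<subseteq> N \<Longrightarrow> j \<in> I \<Longrightarrow> (\<lambda>w. w j) \<in> borel_measurable PP"
  by (rule component_measurable) blast

text \<open>One term of the exponential series bounds a power by an exponential. The constant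
  \<open>24 = 4 * 2 * 3\<close> collects \<open>fact (2 * r) \<le> (4 * r^2)^r\<close>, the two
  signs with \<open>2 \<le> 2^r\<close>, and \<open>exp 1 \<le> 3\<close>.\<close>

lemma linear_moment_real:
  assumes IN: "I \<subseteq> N"
    and cm: "\<And>j. j \<in> I \<Longrightarrow> c j \<in> borel_measurable PP"
    and dep: "\<And>j w w'. j \<in> I \<Longrightarrow> (\<And>k. k \<in> N - I \<Longrightarrow> w k = w' k) \<Longrightarrow> c j w = c j w'"
    and bnd: "\<And>w. (\<Sum>j\<in>I. (c j w)^2) \<le> 1"
    and r: "r \<ge> 1"
  shows "integrable PP (\<lambda>w. (\<Sum>j\<in>I. w j * c j w) ^ (2 * r))" (is ?goal1)
    and "(\<integral>w. (\<Sum>j\<in>I. w j * c j w) ^ (2 * r) \<partial>PP) \<le> (24 * \<kappa> * real r) ^ r" (is ?goal2)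
proof -
  define X where "X w = (\<Sum>j\<in>I. w j * c j w)" for w
  \<comment> \<open>This value minimises \<open>exp (\<kappa> * l^2) / l^(2 * r)\<close>.\<close>
  define l where "l = sqrt (real r / \<kappa>)"
  have l: "l > 0" "l^2 = real r / \<kappa>" using r kappa_pos by (auto simp: l_def)
  note cw = component_measurable_subset[OF IN]
  have Xm[measurable]: "X \<in> borel_measurable PP"
    unfolding X_def using cw cm by measurable
  have mgf: "(\<integral>\<^sup>+w. ennreal (exp (a * X w)) \<partial>PP) \<le> ennreal (exp (\<kappa> * a^2))" for a
    unfolding X_def by (rule linear_mgf[OF IN cm dep bnd])
  define K where "K = fact (2 * r) / l ^ (2 * r)"
  have K0: "K \<ge> 0" using l by (simp add: K_def)
  have pt: "X w ^ (2 * r) \<le> K * (exp (l * X w) + exp (- l * X w))" for w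
  proof -
    have t: "\<bar>y\<bar> ^ (2*r) / fact (2*r) \<le> exp \<bar>y\<bar>" for y :: real
    proof -
      have "(\<Sum>i\<in>{2*r}. \<bar>y\<bar> ^ i / fact i) \<le> (\<Sum>i. \<bar>y\<bar> ^ i / fact i)"
        using summable_exp[of "\<bar>y\<bar>"] by (intro sum_le_suminf) (auto simp: field_simps)
      then show ?thesis by (simp add: exp_def field_simps scaleR_conv_of_real)
    qed
    have "(l * X w) ^ (2 * r) / fact (2 * r) \<le> exp \<bar>l * X w\<bar>"
      using t[of "l * X w"] by (simp only: power_even_abs[OF dvd_triv_left])
    also have "\<dots> \<le> exp (l * X w) + exp (- l * X w)" by (auto simp: abs_if)
    finally have "(l * X w) ^ (2 * r) \<le> fact (2*r) * (exp (l * X w) + exp (- l * X w))"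
      by (simp add: field_simps)
    then show ?thesis unfolding K_def using l by (simp add: field_simps power_mult_distrib)
  qed
  have "(\<integral>\<^sup>+w. ennreal (X w ^ (2 * r)) \<partial>PP)
      \<le> (\<integral>\<^sup>+w. ennreal K * (ennreal (exp (l * X w)) + ennreal (exp (- l * X w))) \<partial>PP)"
    using pt K0 by (intro nn_integral_mono) (simp add: ennreal_mult[symmetric] ennreal_plus[symmetric] del: ennreal_plus)
  also have "\<dots> = ennreal K * ((\<integral>\<^sup>+w. ennreal (exp (l * X w)) \<partial>PP) + (\<integral>\<^sup>+w. ennreal (exp (- l * X w)) \<partial>PP))"
    by (subst nn_integral_cmult, simp, subst nn_integral_add) auto
  also have "\<dots> \<le> ennreal K * (ennreal (exp (\<kappa> * l^2)) + ennreal (exp (\<kappa> * l^2)))"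
    using mgf[of l] mgf[of "-l"] by (intro mult_left_mono add_mono) auto
  also have "\<dots> = ennreal (K * (2 * exp (\<kappa> * l^2)))"
    using K0 by (simp add: ennreal_mult ennreal_plus[symmetric] del: ennreal_plus)
  also have "\<dots> \<le> ennreal ((24 * \<kappa> * real r) ^ r)"
  proof (rule ennreal_leI)
    have e: "exp (\<kappa> * l^2) = exp 1 ^ r" using kappa_pos l by (simp add: exp_of_nat_mult[symmetric])
    have "fact (2*r) \<le> (2 * real r) ^ (2*r)" using fact_le_power[of "2*r", where 'a = real] by simp
    also have "\<dots> = (4 * (real r)^2) ^ r" by (simp add: power_mult power_mult_distrib)
    finally have f: "fact (2*r) \<le> (4 * (real r)^2) ^ r" .
    have ll: "l ^ (2*r) = (real r / \<kappa>) ^ r" using l by (simp add: power_mult)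
    have "K * (2 * exp (\<kappa> * l^2)) \<le> (4 * (real r)^2) ^ r / (real r / \<kappa>) ^ r * (2 ^ r * 3 ^ r)"
      unfolding K_def ll e
    proof (intro mult_mono divide_right_mono f power_mono exp_le)
      show "(2::real) \<le> 2 ^ r" using power_increasing[of 1 r "2::real"] r by simp
    qed (use kappa_pos in auto)
    also have "\<dots> = (4 * (real r)^2 / (real r / \<kappa>) * (2 * 3)) ^ r"
      by (simp only: power_mult_distrib power_divide)
    also have "4 * (real r)^2 / (real r / \<kappa>) * (2 * 3) = 24 * \<kappa> * real r"
      using r kappa_pos by (simp add: field_simps power2_eq_square)
    finally show "K * (2 * exp (\<kappa> * l^2)) \<le> (24 * \<kappa> * real r) ^ r" .
  qed
  finally have le: "(\<integral>\<^sup>+w. ennreal (X w ^ (2 * r)) \<partial>PP) \<le> ennreal ((24 * \<kappa> * real r) ^ r)" .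
  have i: "integrable PP (\<lambda>w. X w ^ (2 * r))"
    by (rule integrableI_nonneg) (use le in \<open>auto simp: zero_le_even_power intro: le_less_trans\<close>)
  then show ?goal1 by (simp add: X_def)
  have "ennreal (\<integral>w. X w ^ (2 * r) \<partial>PP) \<le> ennreal ((24 * \<kappa> * real r) ^ r)"
    using le nn_integral_eq_integral[OF i] by (simp add: zero_le_even_power)
  then show ?goal2
    using kappa_pos by (simp add: X_def)
qed

text \<open>Real and imaginary part are treated separately; recombining them turns \<open>24\<close>
  into \<open>4 * 24\<close>, rounded up.\<close>

lemma linear_moment:
  fixes c :: "nat \<Rightarrow> (nat \<Rightarrow> real) \<Rightarrow> complex"
  assumes IN: "I \<subseteq> N"
    and cm: "\<And>j. j \<in> I \<Longrightarrow> c j \<in> borel_measurable PP"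
    and dep: "\<And>j w w'. j \<in> I \<Longrightarrow> (\<And>k. k \<in> N - I \<Longrightarrow> w k = w' k) \<Longrightarrow> c j w = c j w'"
    and bnd: "\<And>w. (\<Sum>j\<in>I. (cmod (c j w))^2) \<le> 1"
    and r: "r \<ge> 1"
  shows "integrable PP (\<lambda>w. cmod (\<Sum>j\<in>I. of_real (w j) * c j w) ^ (2 * r))" (is ?goal1)
    and "(\<integral>w. cmod (\<Sum>j\<in>I. of_real (w j) * c j w) ^ (2 * r) \<partial>PP) \<le> (100 * \<kappa> * real r) ^ r" (is ?goal2)
proof -
  define X where "X w = (\<Sum>j\<in>I. w j * Re (c j w))" for w
  define Y where "Y w = (\<Sum>j\<in>I. w j * Im (c j w))" for w
  have sq: "(\<Sum>j\<in>I. (Re (c j w))^2) \<le> 1" "(\<Sum>j\<in>I. (Im (c j w))^2) \<le> 1" for w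
    by (rule order_trans[OF sum_mono bnd[of w]]; simp add: cmod_def)+
  have rem: "(\<lambda>w. Re (c j w)) \<in> borel_measurable PP" "(\<lambda>w. Im (c j w)) \<in> borel_measurable PP"
    if "j \<in> I" for j using cm[OF that] by measurable
  have Xi: "integrable PP (\<lambda>w. X w ^ (2 * r))" "(\<integral>w. X w ^ (2 * r) \<partial>PP) \<le> (24 * \<kappa> * real r) ^ r"
    unfolding X_def by (rule linear_moment_real[OF IN rem(1) _ sq(1) r], assumption, metis dep)+
  have Yi: "integrable PP (\<lambda>w. Y w ^ (2 * r))" "(\<integral>w. Y w ^ (2 * r) \<partial>PP) \<le> (24 * \<kappa> * real r) ^ r"
    unfolding Y_def by (rule linear_moment_real[OF IN rem(2) _ sq(2) r], assumption, metis dep)+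
  have pt: "cmod (\<Sum>j\<in>I. of_real (w j) * c j w) ^ (2 * r) \<le> 2 ^ r * (X w ^ (2 * r) + Y w ^ (2 * r))" for w
  proof -
    have "cmod (\<Sum>j\<in>I. of_real (w j) * c j w) ^ (2 * r) = ((X w)^2 + (Y w)^2) ^ r"
      by (simp add: power_mult cmod_power2 X_def Y_def)
    also have "\<dots> \<le> (2 * max ((X w)^2) ((Y w)^2)) ^ r" by (intro power_mono) auto
    also have "\<dots> = 2 ^ r * max ((X w)^2) ((Y w)^2) ^ r" by (simp add: power_mult_distrib)
    also have "max ((X w)^2) ((Y w)^2) ^ r \<le> ((X w)^2) ^ r + ((Y w)^2) ^ r"
      by (auto simp: max_def)
    finally show ?thesis by (simp add: power_mult)
  qed
  have gi: "integrable PP (\<lambda>w. 2 ^ r * (X w ^ (2 * r) + Y w ^ (2 * r)))"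
    using Xi Yi by auto
  have m: "(\<lambda>w. cmod (\<Sum>j\<in>I. of_real (w j) * c j w) ^ (2 * r)) \<in> borel_measurable PP"
    using cm component_measurable_subset[OF IN] by measurable
  show i: ?goal1
    by (rule Bochner_Integration.integrable_bound[OF gi m])
      (use pt in \<open>auto intro!: AE_I2 order_trans[OF _ abs_ge_self]\<close>)
  have "(\<integral>w. cmod (\<Sum>j\<in>I. of_real (w j) * c j w) ^ (2 * r) \<partial>PP)
      \<le> (\<integral>w. 2 ^ r * (X w ^ (2 * r) + Y w ^ (2 * r)) \<partial>PP)"
    by (intro integral_mono i gi pt)
  also have "\<dots> \<le> 2 ^ r * ((24 * \<kappa> * real r) ^ r + (24 * \<kappa> * real r) ^ r)"
    using Xi Yi by simp
  also have "\<dots> \<le> 2 ^ r * (2 ^ r * (24 * \<kappa> * real r) ^ r)"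
  proof (rule mult_left_mono)
    have "2 * (24 * \<kappa> * real r) ^ r \<le> 2 ^ r * (24 * \<kappa> * real r) ^ r"
      using power_increasing[of 1 r "2::real"] r kappa_pos by (intro mult_right_mono) auto
    then show "(24 * \<kappa> * real r) ^ r + (24 * \<kappa> * real r) ^ r \<le> 2 ^ r * (24 * \<kappa> * real r) ^ r" by simp
  qed simp
  also have "\<dots> = (2 * (2 * (24 * \<kappa> * real r))) ^ r" by (simp only: power_mult_distrib)
  also have "\<dots> \<le> (100 * \<kappa> * real r) ^ r" using kappa_pos by (intro power_mono) auto
  finally show ?goal2 .
qed

end

subsection \<open>Decoupling of the chaos\<close>

text \<open>Jensen's inequality. It serves the average over subsets in the decoupling and the
  weighted sum over scales in the chaining, in both cases without loss of a constant.\<close>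

lemma power_sum_convex:
  fixes x \<theta> :: "'i \<Rightarrow> real"
  assumes "finite I" "I \<noteq> {}" "(\<Sum>i\<in>I. \<theta> i) = 1" "\<And>i. i \<in> I \<Longrightarrow> \<theta> i \<ge> 0" "\<And>i. i \<in> I \<Longrightarrow> x i \<ge> 0"
  shows "(\<Sum>i\<in>I. \<theta> i * x i) ^ p \<le> (\<Sum>i\<in>I. \<theta> i * x i ^ p)"
proof -
  have "convex_on {0..} (\<lambda>y::real. y ^ p)"
    by (cases "even p") (auto intro: convex_power_odd convex_on_subset[OF convex_power_even])
  from convex_on_sum[OF assms(1,2) this assms(3,4), of x] assms(5)
  show ?thesis by simp
qed

lemma power_sum_two:
  fixes a b :: real assumes "a \<ge> 0" "b \<ge> 0"
  shows "(a + b) ^ p \<le> 2 ^ p * (a ^ p + b ^ p)"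
proof -
  have "(a + b) ^ p \<le> (2 * max a b) ^ p" using assms by (intro power_mono) auto
  also have "\<dots> = 2 ^ p * max a b ^ p" by (simp add: power_mult_distrib)
  also have "max a b ^ p \<le> a ^ p + b ^ p" using assms by (auto simp: max_def)
  finally show ?thesis by simp
qed

text \<open>The correction term is for empty \<open>I\<close> and \<open>p = 0\<close>, where the
  left side is \<open>0 ^ 0 = 1\<close>.\<close>

lemma power_sum_card:
  fixes x :: "'i \<Rightarrow> real"
  assumes "finite I" "\<And>i. i \<in> I \<Longrightarrow> x i \<ge> 0"
  shows "(\<Sum>i\<in>I. x i) ^ p \<le> real (card I) ^ p * (\<Sum>i\<in>I. x i ^ p) + (if I = {} then 1 else 0)"
proof (cases "I = {}")
  case False
  define m where "m = Max (x ` I)"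
  have m: "x i \<le> m" if "i \<in> I" for i using assms(1) that by (simp add: m_def)
  have "m \<in> x ` I" unfolding m_def using assms(1) False by (intro Max_in) auto
  then obtain i where i: "i \<in> I" "x i = m" by blast
  have "(\<Sum>i\<in>I. x i) ^ p \<le> (real (card I) * m) ^ p"
    using sum_bounded_above[of I x m] m assms(2) by (intro power_mono sum_nonneg) auto
  also have "\<dots> = real (card I) ^ p * x i ^ p" by (simp add: power_mult_distrib i)
  also have "\<dots> \<le> real (card I) ^ p * (\<Sum>i\<in>I. x i ^ p)"
    using assms i by (intro mult_left_mono member_le_sum) auto
  finally show ?thesis using False by simp
qed (cases p; simp)

text \<open>After exchanging the sums it remains to count, for \<open>j \<noteq> k\<close>, the sets
  containing \<open>j\<close> but not \<open>k\<close>: inserting \<open>j\<close> matches them with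
  the \<open>2 ^ (card J - 2)\<close> subsets of \<open>J - {j, k}\<close>.\<close>

lemma sum_Pow_split:
  fixes a :: "'i \<Rightarrow> 'i \<Rightarrow> complex"
  assumes J: "finite J"
  shows "4 * (\<Sum>I\<in>Pow J. \<Sum>j\<in>I. \<Sum>k\<in>J - I. a j k) = 2 ^ card J * (\<Sum>j\<in>J. \<Sum>k\<in>J - {j}. a j k)"
proof -
  let ?b = "\<lambda>I j k. if j \<in> I \<and> k \<notin> I then a j k else 0"
  have "(\<Sum>I\<in>Pow J. \<Sum>j\<in>I. \<Sum>k\<in>J - I. a j k)
      = (\<Sum>I\<in>Pow J. \<Sum>j\<in>J. \<Sum>k\<in>J - {j}. ?b I j k)"
  proof (rule sum.cong[OF refl])
    fix I assume I: "I \<in> Pow J"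
    have "(\<Sum>j\<in>J. \<Sum>k\<in>J - {j}. ?b I j k)
        = (\<Sum>j\<in>J. if j \<in> I then (\<Sum>k\<in>J - I. a j k) else 0)"
    proof (rule sum.cong[OF refl])
      fix j assume "j \<in> J"
      show "(\<Sum>k\<in>J - {j}. ?b I j k) = (if j \<in> I then (\<Sum>k\<in>J - I. a j k) else 0)"
      proof (cases "j \<in> I")
        case True
        then have "(\<Sum>k\<in>J - {j}. ?b I j k) = (\<Sum>k\<in>(J - {j}) \<inter> {k. k \<notin> I}. a j k)"
          using J by (simp add: sum.If_cases)
        also have "(J - {j}) \<inter> {k. k \<notin> I} = J - I" using True by auto
        finally show ?thesis using True by simp
      qed simp
    qed
    also have "\<dots> = (\<Sum>j\<in>J \<inter> I. \<Sum>k\<in>J - I. a j k)" using J by (simp add: sum.If_cases Int_def)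
    also have "J \<inter> I = I" using I by auto
    finally show "(\<Sum>j\<in>I. \<Sum>k\<in>J - I. a j k) = (\<Sum>j\<in>J. \<Sum>k\<in>J - {j}. ?b I j k)" ..
  qed
  also have "\<dots> = (\<Sum>j\<in>J. \<Sum>I\<in>Pow J. \<Sum>k\<in>J - {j}. ?b I j k)"
    by (rule sum.swap)
  also have "\<dots> = (\<Sum>j\<in>J. \<Sum>k\<in>J - {j}. \<Sum>I\<in>Pow J. ?b I j k)"
    by (intro sum.cong refl sum.swap)
  finally have 1: "(\<Sum>I\<in>Pow J. \<Sum>j\<in>I. \<Sum>k\<in>J - I. a j k)
      = (\<Sum>j\<in>J. \<Sum>k\<in>J - {j}. \<Sum>I\<in>Pow J. ?b I j k)" .
  have 2: "4 * (\<Sum>I\<in>Pow J. ?b I j k) = 2 ^ card J * a j k"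
    if jk: "j \<in> J" "k \<in> J - {j}" for j k
  proof -
    have "bij_betw (insert j) (Pow (J - {j,k})) {I \<in> Pow J. j \<in> I \<and> k \<notin> I}"
      by (rule bij_betw_byWitness[where f' = "\<lambda>I. I - {j}"]) (use jk in auto)
    then have "card {I \<in> Pow J. j \<in> I \<and> k \<notin> I} = card (Pow (J - {j,k}))"
      by (simp add: bij_betw_same_card)
    also have "\<dots> = 2 ^ (card J - 2)"
    proof -
      have "card (J - {j,k}) = card J - card {j,k}" using jk J by (intro card_Diff_subset) auto
      also have "card {j,k} = 2" using jk by auto
      finally show ?thesis using J by (simp add: card_Pow)
    qed
    finally have c: "card {I \<in> Pow J. j \<in> I \<and> k \<notin> I} = 2 ^ (card J - 2)" .
    have "card {j, k} \<le> card J" using jk J by (intro card_mono) auto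
    moreover have "card {j, k} = 2" using jk by auto
    ultimately have "card J \<ge> 2" by simp
    then have "4 * 2 ^ (card J - 2) = (2::complex) ^ card J"
      using power_add[of "2::complex" 2 "card J - 2"] by (simp only: le_add_diff_inverse) simp
    moreover have "(\<Sum>I\<in>Pow J. ?b I j k) = of_nat (card {I \<in> Pow J. j \<in> I \<and> k \<notin> I}) * a j k"
      using J by (simp add: sum.If_cases Int_def)
    ultimately show ?thesis unfolding c by (simp add: mult.assoc[symmetric])
  qed
  show ?thesis unfolding 1 sum_distrib_left
    by (intro sum.cong refl) (use 2 in \<open>simp add: sum_distrib_left\<close>)
qed

context subg_product begin

text \<open>Purely qualitative: it licenses integrating the moment inequalities for the chaos term
  by term. The size of the moments comes from the chaining.\<close>

lemma integrable_quadratic_power: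
  fixes f :: "(nat \<Rightarrow> real) \<Rightarrow> real"
  assumes [measurable]: "f \<in> borel_measurable PP"
    and le: "\<And>w. 0 \<le> f w" "\<And>w. f w \<le> C * (\<Sum>j\<in>N. (w j)^2)" and p: "p \<ge> 1" and C: "C \<ge> 0"
  shows "integrable PP (\<lambda>w. f w ^ p)"
proof -
  have wi: "integrable PP (\<lambda>w. (w j) ^ (2 * p))" if "j \<in> N" for j
    using linear_moment_real(1)[of "{j}" "\<lambda>_ _. 1" p] that p by simp
  let ?g = "\<lambda>w. C ^ p * (real (card N) ^ p * (\<Sum>j\<in>N. (w j) ^ (2 * p)) + (if N = {} then 1 else 0))"
  have gi: "integrable PP ?g" using wi by auto
  have "f w ^ p \<le> ?g w" for w
  proof -
    have "f w ^ p \<le> (C * (\<Sum>j\<in>N. (w j)^2)) ^ p" using le by (intro power_mono) auto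
    also have "\<dots> = C ^ p * (\<Sum>j\<in>N. (w j)^2) ^ p" by (simp add: power_mult_distrib)
    also have "\<dots> \<le> ?g w"
      using power_sum_card[OF finite_index, of "\<lambda>j. (w j)^2" p] C
      by (intro mult_left_mono) (auto simp: power_mult)
    finally show ?thesis .
  qed
  then have "norm (f w ^ p) \<le> norm (?g w)" for w
    using order_trans[OF _ abs_ge_self] le(1)[of w] by (metis abs_of_nonneg real_norm_def zero_le_power)
  then show ?thesis
    by (intro Bochner_Integration.integrable_bound[OF gi]) auto
qed

end

text \<open>Rows of the matrices \<open>A t\<close> are indexed by \<open>R\<close>, columns by
  \<open>N\<close>. With \<open>T\<close> finite all suprema are maxima, hence measurable.\<close>

locale chaos = subg_product \<mu> N \<kappa> for \<mu> :: "nat \<Rightarrow> real measure" and N \<kappa> +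
  fixes T :: "'x set" and R :: "nat set" and A :: "'x \<Rightarrow> nat \<Rightarrow> nat \<Rightarrow> complex"
  assumes finT: "finite T" "T \<noteq> {}" and finO: "finite R"
begin

definition Y :: "'x \<Rightarrow> nat set \<Rightarrow> (nat \<Rightarrow> real) \<Rightarrow> nat \<Rightarrow> complex" where
  "Y t I w i = (\<Sum>j\<in>I. of_real (w j) * A t i j)"

text \<open>Entry of the Gram matrix of \<open>A t\<close>.\<close>

definition G :: "'x \<Rightarrow> nat \<Rightarrow> nat \<Rightarrow> complex" where
  "G t j k = (\<Sum>i\<in>R. cnj (A t i j) * A t i k)"

text \<open>The decoupled bilinear form: for disjoint \<open>I\<close> and \<open>J\<close> it is
  linear in the variables of each block when the other block is fixed.\<close>

definition q :: "'x \<Rightarrow> nat set \<Rightarrow> nat set \<Rightarrow> (nat \<Rightarrow> real) \<Rightarrow> complex" where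
  "q t I J w = (\<Sum>i\<in>R. cnj (Y t I w i) * Y t J w i)"

definition Nm :: "nat set \<Rightarrow> (nat \<Rightarrow> real) \<Rightarrow> real" where
  "Nm I w = Max ((\<lambda>t. \<Sum>i\<in>R. (cmod (Y t I w i))^2) ` T)"

definition off :: "'x \<Rightarrow> nat set \<Rightarrow> (nat \<Rightarrow> real) \<Rightarrow> complex" where
  "off t J w = (\<Sum>j\<in>J. \<Sum>k\<in>J - {j}. of_real (w j * w k) * G t j k)"

definition S :: "nat set \<Rightarrow> (nat \<Rightarrow> real) \<Rightarrow> real" where
  "S J w = Max ((\<lambda>t. cmod (off t J w)) ` T)"

definition D :: "(nat \<Rightarrow> real) \<Rightarrow> real" where
  "D w = Max ((\<lambda>t. \<Sum>j\<in>N. (w j)^2 * (\<Sum>i\<in>R. (cmod (A t i j))^2)) ` T)"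

lemma Max_ge_T: "t \<in> T \<Longrightarrow> f t \<le> Max (f ` T)" for f :: "'x \<Rightarrow> real"
  using finT by simp

lemma Max_le_T: "(\<And>t. t \<in> T \<Longrightarrow> f t \<le> b) \<Longrightarrow> Max (f ` T) \<le> b" for f :: "'x \<Rightarrow> real"
  using finT by simp

lemma Max_nonneg_T: "(\<And>t. t \<in> T \<Longrightarrow> 0 \<le> f t) \<Longrightarrow> 0 \<le> Max (f ` T)" for f :: "'x \<Rightarrow> real"
  using finT Max_ge_T order_trans by (metis all_not_in_conv)

lemma Nm_nonneg: "0 \<le> Nm I w" unfolding Nm_def by (intro Max_nonneg_T sum_nonneg) auto
lemma S_nonneg: "0 \<le> S I w" unfolding S_def by (intro Max_nonneg_T) auto
lemma D_nonneg: "0 \<le> D w" unfolding D_def by (intro Max_nonneg_T sum_nonneg mult_nonneg_nonneg) auto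

lemma q_expand: "q t I J w = (\<Sum>j\<in>I. \<Sum>k\<in>J. of_real (w j * w k) * G t j k)"
proof -
  have "q t I J w = (\<Sum>i\<in>R. \<Sum>j\<in>I. \<Sum>k\<in>J. of_real (w j * w k) * (cnj (A t i j) * A t i k))"
    unfolding q_def Y_def cnj_sum sum_product by (simp add: mult_ac)
  also have "\<dots> = (\<Sum>j\<in>I. \<Sum>i\<in>R. \<Sum>k\<in>J. of_real (w j * w k) * (cnj (A t i j) * A t i k))"
    by (rule sum.swap)
  also have "\<dots> = (\<Sum>j\<in>I. \<Sum>k\<in>J. \<Sum>i\<in>R. of_real (w j * w k) * (cnj (A t i j) * A t i k))"
    by (intro sum.cong refl sum.swap)
  finally show ?thesis by (simp add: G_def sum_distrib_left)
qed

lemma norm_square_expand: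
  assumes "finite I"
  shows "of_real (\<Sum>i\<in>R. (cmod (Y t I w i))^2)
    = of_real (\<Sum>j\<in>I. (w j)^2 * (\<Sum>i\<in>R. (cmod (A t i j))^2)) + off t I w"
proof -
  have "of_real (\<Sum>i\<in>R. (cmod (Y t I w i))^2) = q t I I w"
    unfolding q_def of_real_sum by (intro sum.cong refl) (simp add: complex_norm_square mult.commute flip: of_real_power)
  also have "\<dots> = (\<Sum>j\<in>I. of_real ((w j)^2) * G t j j + (\<Sum>k\<in>I - {j}. of_real (w j * w k) * G t j k))"
    unfolding q_expand using assms
    by (intro sum.cong refl) (simp add: sum.remove[of I] power2_eq_square)
  also have "\<dots> = (\<Sum>j\<in>I. of_real ((w j)^2) * G t j j) + off t I w"
    by (simp add: sum.distrib off_def)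
  finally have 1: "of_real (\<Sum>i\<in>R. (cmod (Y t I w i))^2) = (\<Sum>j\<in>I. of_real ((w j)^2) * G t j j) + off t I w" .
  have "G t j j = of_real (\<Sum>i\<in>R. (cmod (A t i j))^2)" for j
    unfolding G_def of_real_sum by (intro sum.cong refl) (simp add: complex_norm_square mult.commute flip: of_real_power)
  then show ?thesis using 1 by simp
qed

text \<open>Expanding the square gives a diagonal and an off-diagonal part. The diagonal terms are
  nonnegative, so enlarging \<open>I\<close> to \<open>N\<close> there yields one variable
  \<open>D\<close> that serves all blocks.\<close>

lemma Nm_le:
  assumes "I \<subseteq> N"
  shows "Nm I w \<le> D w + S I w"
  unfolding Nm_def
proof (rule Max_le_T)
  fix t assume t: "t \<in> T"
  have fI: "finite I" using assms finite_index finite_subset by blast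
  let ?d = "\<Sum>j\<in>I. (w j)^2 * (\<Sum>i\<in>R. (cmod (A t i j))^2)"
  have "(\<Sum>i\<in>R. (cmod (Y t I w i))^2) = ?d + Re (off t I w)"
    using arg_cong[OF norm_square_expand[OF fI, of t w], of Re] by simp
  also have "\<dots> \<le> D w + S I w"
  proof (rule add_mono)
    have "?d \<le> (\<Sum>j\<in>N. (w j)^2 * (\<Sum>i\<in>R. (cmod (A t i j))^2))"
      by (rule sum_mono2[OF finite_index assms]) (auto intro!: mult_nonneg_nonneg sum_nonneg)
    also have "\<dots> \<le> D w" unfolding D_def by (rule Max_ge_T[OF t])
    finally show "?d \<le> D w" .
    show "Re (off t I w) \<le> S I w"
      unfolding S_def by (rule order_trans[OF complex_Re_le_cmod Max_ge_T[OF t]])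
  qed
  finally show "(\<Sum>i\<in>R. (cmod (Y t I w i))^2) \<le> D w + S I w" .
qed

text \<open>Each off-diagonal pair is separated by exactly a quarter of all subsets \<open>I\<close> of \<open>J\<close>.\<close>

lemma decoupling:
  assumes "finite J"
  shows "cmod (off t J w) \<le> (\<Sum>I\<in>Pow J. (1 / 2 ^ card J) * (4 * cmod (q t I (J - I) w)))"
proof -
  have "2 ^ card J * off t J w = 4 * (\<Sum>I\<in>Pow J. q t I (J - I) w)"
    unfolding off_def q_expand by (rule sum_Pow_split[OF assms, symmetric])
  then have "2 ^ card J * cmod (off t J w) = 4 * cmod (\<Sum>I\<in>Pow J. q t I (J - I) w)"
    by (metis norm_mult norm_numeral norm_power)
  also have "\<dots> \<le> 4 * (\<Sum>I\<in>Pow J. cmod (q t I (J - I) w))" using norm_sum by (intro mult_left_mono) auto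
  finally have "cmod (off t J w) \<le> (1 / 2 ^ card J) * (4 * (\<Sum>I\<in>Pow J. cmod (q t I (J - I) w)))"
    by (simp add: field_simps)
  then show ?thesis by (simp only: sum_distrib_left)
qed

lemma Y_measurable [measurable]: "I \<subseteq> N \<Longrightarrow> (\<lambda>w. Y t I w i) \<in> borel_measurable PP"
proof -
  assume "I \<subseteq> N"
  from component_measurable_subset[OF this] show ?thesis unfolding Y_def by measurable
qed

lemma Nm_measurable [measurable]: "I \<subseteq> N \<Longrightarrow> Nm I \<in> borel_measurable PP"
  unfolding Nm_def using finT by measurable

lemma off_measurable [measurable]: "I \<subseteq> N \<Longrightarrow> off t I \<in> borel_measurable PP"
proof -
  assume "I \<subseteq> N"
  from component_measurable_subset[OF this] show ?thesis unfolding off_def by measurable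
qed

lemma S_measurable [measurable]: "I \<subseteq> N \<Longrightarrow> S I \<in> borel_measurable PP"
  unfolding S_def using finT by measurable

lemma D_measurable [measurable]: "D \<in> borel_measurable PP"
proof -
  from component_measurable show ?thesis unfolding D_def using finT by measurable
qed

lemma S_power_integrable:
  assumes I: "I \<subseteq> N" and p: "p \<ge> 1"
  shows "integrable PP (\<lambda>w. S I w ^ p)"
proof -
  define C where "C = (\<Sum>t\<in>T. \<Sum>j\<in>N. \<Sum>k\<in>N. cmod (G t j k))"
  show ?thesis
  proof (rule integrable_quadratic_power[OF _ S_nonneg _ p])
    show "S I w \<le> C * (\<Sum>j\<in>N. (w j)^2)" for w
      unfolding S_def
    proof (rule Max_le_T)
      fix t assume t: "t \<in> T"
      have fI: "finite I" using I finite_index finite_subset by blast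
      define s where "s = (\<Sum>j\<in>N. (w j)^2)"
      have ww: "\<bar>w j * w k\<bar> \<le> s" if "j \<in> N" "k \<in> N" for j k
      proof -
        have "(w j)^2 \<le> s" "(w k)^2 \<le> s" unfolding s_def
          using that finite_index by (auto intro!: member_le_sum)
        moreover have "2 * \<bar>w j * w k\<bar> \<le> (w j)^2 + (w k)^2"
          using sum_squares_bound[of "\<bar>w j\<bar>" "\<bar>w k\<bar>"] by (simp add: abs_mult)
        ultimately show ?thesis by linarith
      qed
      have "cmod (off t I w) \<le> (\<Sum>j\<in>I. \<Sum>k\<in>I - {j}. \<bar>w j * w k\<bar> * cmod (G t j k))"
        unfolding off_def by (intro sum_norm_le order_trans[OF norm_sum] sum_mono) (simp add: norm_mult abs_mult)
      also have "\<dots> \<le> (\<Sum>j\<in>I. \<Sum>k\<in>I - {j}. s * cmod (G t j k))"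
        using ww I by (intro sum_mono mult_right_mono) auto
      also have "\<dots> \<le> (\<Sum>j\<in>I. \<Sum>k\<in>N. s * cmod (G t j k))"
        using I finite_index by (intro sum_mono sum_mono2) (auto simp: s_def sum_nonneg)
      also have "\<dots> \<le> (\<Sum>j\<in>N. \<Sum>k\<in>N. s * cmod (G t j k))"
        using I finite_index by (intro sum_mono2) (auto simp: s_def intro!: sum_nonneg mult_nonneg_nonneg)
      also have "\<dots> = s * (\<Sum>j\<in>N. \<Sum>k\<in>N. cmod (G t j k))" by (simp add: sum_distrib_left)
      also have "\<dots> \<le> s * C" unfolding C_def
        using finT(1) t by (intro mult_left_mono member_le_sum[of t T "\<lambda>t. \<Sum>j\<in>N. \<Sum>k\<in>N. cmod (G t j k)"])
          (auto simp: s_def intro!: sum_nonneg)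
      finally show "cmod (off t I w) \<le> C * (\<Sum>j\<in>N. (w j)^2)" by (simp add: s_def mult.commute)
    qed
    show "0 \<le> C" unfolding C_def by (intro sum_nonneg) auto
  qed (use I in measurable)
qed

end

subsection \<open>Chaining\<close>

text \<open>Level \<open>k\<close> has approximation maps \<open>\<pi> k\<close>, operator norm
  radius \<open>d k\<close> (stated for the adjoint, which has the same norm) and logarithmic
  cardinality \<open>r k\<close>, which is also half the order of the moments taken there.
  \<open>p \<le> r k\<close> makes these moments strong enough for the final order \<open>p\<close>;
  the chain starts at a zero matrix, where the form vanishes.\<close>

locale chaos_chain = chaos \<mu> N \<kappa> T R A
  for \<mu> :: "nat \<Rightarrow> real measure" and N \<kappa> and T :: "'x set" and R A +
  fixes K :: nat and \<pi> :: "nat \<Rightarrow> 'x \<Rightarrow> 'x" and d :: "nat \<Rightarrow> real" and r :: "nat \<Rightarrow> nat" and p :: nat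
  assumes K: "K \<ge> 1" and p: "p \<ge> 1"
    and pi_in: "\<And>k t. k \<le> K \<Longrightarrow> t \<in> T \<Longrightarrow> \<pi> k t \<in> T"
    and pi_K: "\<And>t. t \<in> T \<Longrightarrow> \<pi> K t = t"
    and pi_0: "\<And>t i j. t \<in> T \<Longrightarrow> A (\<pi> 0 t) i j = 0"
    and d_pos: "\<And>k. k < K \<Longrightarrow> d k > 0"
    and op: "\<And>k t z. k < K \<Longrightarrow> t \<in> T \<Longrightarrow>
      (\<Sum>j\<in>N. (cmod (\<Sum>i\<in>R. cnj (A (\<pi> (Suc k) t) i j - A (\<pi> k t) i j) * z i))^2)
        \<le> (d k)^2 * (\<Sum>i\<in>R. (cmod (z i))^2)"
    and card_pairs: "\<And>k. k < K \<Longrightarrow> real (card ((\<lambda>t. (\<pi> (Suc k) t, \<pi> k t)) ` T)) \<le> exp (real (r k))"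
    and p_le_r: "\<And>k. k < K \<Longrightarrow> p \<le> r k"
begin

definition P :: "nat \<Rightarrow> ('x \<times> 'x) set" where
  "P k = (\<lambda>t. (\<pi> (Suc k) t, \<pi> k t)) ` T"

text \<open>The coefficients of an increment in \<open>\<xi>\<^sub>I\<close>, normalised to have norm at most one. If \<open>Nm J w = 0\<close> they
  vanish by the convention for division by zero, as does the increment itself.\<close>

definition cc :: "nat \<Rightarrow> 'x \<times> 'x \<Rightarrow> 'x \<Rightarrow> nat set \<Rightarrow> nat \<Rightarrow> (nat \<Rightarrow> real) \<Rightarrow> complex" where
  "cc k ab t J j w = (\<Sum>i\<in>R. cnj (A (fst ab) i j - A (snd ab) i j) * Y t J w i) / of_real (d k * sqrt (Nm J w))"

definition X :: "nat \<Rightarrow> 'x \<times> 'x \<Rightarrow> 'x \<Rightarrow> nat set \<Rightarrow> nat set \<Rightarrow> (nat \<Rightarrow> real) \<Rightarrow> real" where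
  "X k ab t I J w = cmod (\<Sum>j\<in>I. of_real (w j) * cc k ab t J j w)"

text \<open>Since \<open>100 exp 1 \<le> 300\<close>, dividing by \<open>\<rho> k\<close> leaves enough room for a union bound over the at most
  \<open>exp (r k)\<close> pairs of level \<open>k\<close>.\<close>

definition \<rho> :: "nat \<Rightarrow> real" where "\<rho> k = sqrt (300 * \<kappa> * real (r k))"
definition \<Gamma> :: real where "\<Gamma> = (\<Sum>k<K. d k * \<rho> k)"

text \<open>Both endpoints of a pair occur as the fixed argument of an increment, according to which
  side of the bilinear form is varied.\<close>

definition Z :: "nat \<Rightarrow> nat set \<Rightarrow> nat set \<Rightarrow> (nat \<Rightarrow> real) \<Rightarrow> 'x \<times> 'x \<Rightarrow> real" where
  "Z k I J w ab = (X k ab (fst ab) I J w / \<rho> k) ^ (2 * r k) + (X k ab (snd ab) I J w / \<rho> k) ^ (2 * r k)"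

text \<open>A majorant free of \<open>t\<close>: the weights sum to one, the summand
  \<open>1\<close> covers normalised increments below one, and the sum over all pairs replaces a
  maximum.\<close>

definition V :: "nat set \<Rightarrow> nat set \<Rightarrow> (nat \<Rightarrow> real) \<Rightarrow> real" where
  "V I J w = (\<Sum>k<K. d k * \<rho> k / \<Gamma> * (1 + (\<Sum>ab\<in>P k. Z k I J w ab)))"

lemma finite_P: "finite (P k)" by (simp add: P_def finT)

lemma r_pos: "k < K \<Longrightarrow> r k \<ge> 1" using p p_le_r[of k] by linarith

lemma rho_pos: "k < K \<Longrightarrow> \<rho> k > 0" using r_pos kappa_pos by (fastforce simp: \<rho>_def)

lemma Gamma_pos: "\<Gamma> > 0"
  unfolding \<Gamma>_def using K d_pos rho_pos by (intro sum_pos) (auto simp: lessThan_empty_iff)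

lemma P_in: "k < K \<Longrightarrow> ab \<in> P k \<Longrightarrow> fst ab \<in> T \<and> snd ab \<in> T"
  using pi_in by (auto simp: P_def)

lemma Y_energy_le: "t \<in> T \<Longrightarrow> (\<Sum>i\<in>R. (cmod (Y t J w i))^2) \<le> Nm J w"
  unfolding Nm_def by (rule Max_ge_T)

text \<open>The operator bound is applied to the image vector \<open>Y t J w\<close>, whose squared
  norm is at most \<open>Nm J w\<close>; the normalisation of \<open>cc\<close> cancels exactly this
  product.\<close>

lemma cc_energy_le:
  assumes k: "k < K" and ab: "ab \<in> P k" and t: "t \<in> T" and I: "I \<subseteq> N"
  shows "(\<Sum>j\<in>I. (cmod (cc k ab t J j w))^2) \<le> 1"
proof (cases "Nm J w = 0")
  case True
  then show ?thesis by (simp add: cc_def)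
next
  case False
  then have Np: "Nm J w > 0" using Nm_nonneg[of J w] by simp
  obtain t' where t': "t' \<in> T" "ab = (\<pi> (Suc k) t', \<pi> k t')" using ab by (auto simp: P_def)
  let ?s = "\<lambda>j. \<Sum>i\<in>R. cnj (A (fst ab) i j - A (snd ab) i j) * Y t J w i"
  have "(\<Sum>j\<in>I. (cmod (cc k ab t J j w))^2) = (\<Sum>j\<in>I. (cmod (?s j))^2) / ((d k)^2 * Nm J w)"
    unfolding sum_divide_distrib
  proof (rule sum.cong[OF refl])
    fix j
    have "cmod (cc k ab t J j w) = cmod (?s j) / (d k * sqrt (Nm J w))"
      using Np d_pos[OF k] unfolding cc_def norm_divide norm_of_real by simp
    then show "(cmod (cc k ab t J j w))^2 = (cmod (?s j))^2 / ((d k)^2 * Nm J w)"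
      using Np by (simp add: power_divide power_mult_distrib)
  qed
  also have "(\<Sum>j\<in>I. (cmod (?s j))^2) \<le> (\<Sum>j\<in>N. (cmod (?s j))^2)"
    using I finite_index by (intro sum_mono2) auto
  also have "(\<Sum>j\<in>N. (cmod (?s j))^2) \<le> (d k)^2 * (\<Sum>i\<in>R. (cmod (Y t J w i))^2)"
    using op[OF k t'(1), of "Y t J w"] t'(2) by simp
  also have "\<dots> \<le> (d k)^2 * Nm J w" by (intro mult_left_mono Y_energy_le t) simp
  finally show ?thesis using Np d_pos[OF k] by (simp add: divide_right_mono)
qed

lemma cc_measurable [measurable]:
  "J \<subseteq> N \<Longrightarrow> cc k ab t J j \<in> borel_measurable PP"
  unfolding cc_def by measurable

text \<open>This is what decoupling buys: as \<open>I\<close> and \<open>J\<close> are disjoint, the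
  coefficients of the form in the variables of \<open>I\<close> are functions of the variables of
  \<open>J\<close> alone.\<close>

lemma cc_dep:
  assumes "I \<inter> J = {}" "J \<subseteq> N" "\<And>k. k \<in> N - I \<Longrightarrow> w k = w' k"
  shows "cc k ab t J j w = cc k ab t J j w'"
proof -
  have "w k = w' k" if "k \<in> J" for k using that assms by (intro assms(3)) auto
  then have "Y t J w i = Y t J w' i" for t i unfolding Y_def by (intro sum.cong) auto
  then show ?thesis by (simp add: cc_def Nm_def)
qed

lemma X_moment:
  assumes k: "k < K" and ab: "ab \<in> P k" and t: "t \<in> T" and I: "I \<subseteq> N" and J: "J \<subseteq> N" "I \<inter> J = {}"
  shows "integrable PP (\<lambda>w. X k ab t I J w ^ (2 * r k))" (is ?goal1)
    and "(\<integral>w. X k ab t I J w ^ (2 * r k) \<partial>PP) \<le> (100 * \<kappa> * real (r k)) ^ r k" (is ?goal2)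
proof -
  note lm = linear_moment[OF I cc_measurable[OF J(1)] cc_dep[OF J(2,1)] cc_energy_le[OF k ab t I] r_pos[OF k]]
  show ?goal1
    unfolding X_def by (rule lm(1))
  show ?goal2
    unfolding X_def by (rule lm(2))
qed

text \<open>Each normalised moment is at most \<open>3^-r\<close>, with \<open>r = r k\<close>, and
  there are at most \<open>exp r \<le> 3^r\<close> pairs with two endpoints each, so every level
  contributes at most \<open>1 + 2\<close>.\<close>

lemma V_integrable:
  assumes I: "I \<subseteq> N" and J: "J \<subseteq> N" "I \<inter> J = {}"
  shows "integrable PP (V I J)" and "(\<integral>w. V I J w \<partial>PP) \<le> 3" (is ?goal2)
proof -
  have i: "integrable PP (\<lambda>w. (X k ab t I J w / \<rho> k) ^ (2 * r k))"
    if "k < K" "ab \<in> P k" "t \<in> T" for k ab t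
    using X_moment(1)[OF that I J] by (simp add: power_divide)
  have i2: "integrable PP (\<lambda>w. Z k I J w ab)"
    if "k < K" "ab \<in> P k" for k ab
    using i[OF that] P_in[OF that] by (auto simp: Z_def)
  have i3: "integrable PP (\<lambda>w. (\<Sum>ab\<in>P k. Z k I J w ab))"
    if "k < K" for k
    using i2[OF that] by (rule Bochner_Integration.integrable_sum)
  show "integrable PP (V I J)"
    unfolding V_def
    by (rule Bochner_Integration.integrable_sum, rule Bochner_Integration.integrable_mult_right,
        rule Bochner_Integration.integrable_add) (use i3 in auto)
  have e: "(\<integral>w. (X k ab t I J w / \<rho> k) ^ (2 * r k) \<partial>PP) \<le> 1 / 3 ^ r k"
    if "k < K" "ab \<in> P k" "t \<in> T" for k ab t
  proof -
    have rp: "300 * \<kappa> * real (r k) > 0" using r_pos[OF that(1)] kappa_pos by simp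
    have "\<rho> k ^ (2 * r k) = (300 * \<kappa> * real (r k)) ^ r k"
      using rp by (simp add: \<rho>_def power_mult)
    then have "(\<integral>w. (X k ab t I J w / \<rho> k) ^ (2 * r k) \<partial>PP)
        = (\<integral>w. X k ab t I J w ^ (2 * r k) \<partial>PP) / (300 * \<kappa> * real (r k)) ^ r k"
      by (simp add: power_divide)
    also have "\<dots> \<le> (100 * \<kappa> * real (r k)) ^ r k / (300 * \<kappa> * real (r k)) ^ r k"
      using rp by (intro divide_right_mono X_moment(2)[OF that I J]) auto
    also have "\<dots> = ((100 * \<kappa> * real (r k)) / (300 * \<kappa> * real (r k))) ^ r k" by (simp only: power_divide)
    also have "(100 * \<kappa> * real (r k)) / (300 * \<kappa> * real (r k)) = 1 / 3"
      using r_pos[OF that(1)] kappa_pos by simp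
    finally show ?thesis by (simp add: power_divide)
  qed
  have e3: "(\<integral>w. (\<Sum>ab\<in>P k. Z k I J w ab) \<partial>PP) \<le> 2"
    if k: "k < K" for k
  proof -
    have "(\<integral>w. (\<Sum>ab\<in>P k. Z k I J w ab) \<partial>PP)
      = (\<Sum>ab\<in>P k. (\<integral>w. (X k ab (fst ab) I J w / \<rho> k) ^ (2 * r k) \<partial>PP)
         + (\<integral>w. (X k ab (snd ab) I J w / \<rho> k) ^ (2 * r k) \<partial>PP))"
      using i[OF k] i2[OF k] P_in[OF k]
      by (subst Bochner_Integration.integral_sum) (auto simp: Z_def intro!: sum.cong Bochner_Integration.integral_add)
    also have "\<dots> \<le> (\<Sum>ab\<in>P k. 1 / 3 ^ r k + 1 / 3 ^ r k)"
      using P_in[OF k] by (intro sum_mono add_mono e[OF k]) auto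
    also have "\<dots> = 2 * (real (card (P k)) / 3 ^ r k)" by simp
    also have "real (card (P k)) \<le> 3 ^ r k"
    proof -
      have "real (card (P k)) \<le> exp 1 ^ r k"
        using card_pairs[OF k] by (simp add: P_def exp_of_nat_mult[symmetric])
      also have "\<dots> \<le> 3 ^ r k" by (intro power_mono exp_le) simp
      finally show ?thesis .
    qed
    finally show ?thesis by (simp add: divide_right_mono)
  qed
  have "(\<integral>w. V I J w \<partial>PP) = (\<Sum>k<K. d k * \<rho> k / \<Gamma> * (1 + (\<integral>w. (\<Sum>ab\<in>P k. Z k I J w ab) \<partial>PP)))"
    unfolding V_def using i3 
    by (subst Bochner_Integration.integral_sum) (auto simp: P.prob_space intro!: sum.cong)
  also have "\<dots> \<le> (\<Sum>k<K. d k * \<rho> k / \<Gamma> * (1 + 2))"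
    using e3 d_pos rho_pos Gamma_pos
    by (intro sum_mono mult_left_mono add_left_mono) (auto simp: less_imp_le)
  also have "\<dots> = 3 * (\<Gamma> / \<Gamma>)"
    by (simp add: \<Gamma>_def sum_distrib_left[symmetric] sum_divide_distrib[symmetric] sum_distrib_right[symmetric])
  finally show ?goal2 using Gamma_pos by simp
qed

text \<open>The chained increments, written as a convex combination of normalised ones so that
  Jensen applies; \<open>\<Gamma>\<close> is the factor taken out, and \<open>g\<close> selects the
  fixed endpoint.\<close>

definition U :: "nat set \<Rightarrow> nat set \<Rightarrow> (nat \<Rightarrow> real) \<Rightarrow> ('x \<times> 'x \<Rightarrow> 'x) \<Rightarrow> 'x \<Rightarrow> real" where
  "U I J w g t = (\<Sum>k<K. d k * \<rho> k / \<Gamma> *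
     (X k (\<pi> (Suc k) t, \<pi> k t) (g (\<pi> (Suc k) t, \<pi> k t)) I J w / \<rho> k))"

lemma U_nonneg: "U I J w g t \<ge> 0"
  unfolding U_def using d_pos rho_pos Gamma_pos
  by (auto intro!: sum_nonneg mult_nonneg_nonneg divide_nonneg_nonneg simp: X_def less_imp_le)

lemma Gamma_U: "\<Gamma> * U I J w g t = (\<Sum>k<K. d k * X k (\<pi> (Suc k) t, \<pi> k t) (g (\<pi> (Suc k) t, \<pi> k t)) I J w)"
  unfolding U_def sum_distrib_left
proof (rule sum.cong[OF refl])
  fix k assume "k \<in> {..<K}"
  then have "\<rho> k \<noteq> 0" using rho_pos[of k] by simp
  then show "\<Gamma> * (d k * \<rho> k / \<Gamma> * (X k (\<pi> (Suc k) t, \<pi> k t) (g (\<pi> (Suc k) t, \<pi> k t)) I J w / \<rho> k))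
      = d k * X k (\<pi> (Suc k) t, \<pi> k t) (g (\<pi> (Suc k) t, \<pi> k t)) I J w"
    using Gamma_pos by simp
qed

text \<open>Jensen moves the power inside; then \<open>x^(2 * p) \<le> 1 + x^(2 * r k)\<close>
  because \<open>p \<le> r k\<close>, and one pair is bounded by the sum over all pairs. The result
  is uniform in \<open>t\<close>.\<close>

lemma U_power_le_V:
  assumes I: "I \<subseteq> N" and t: "t \<in> T" and g: "g = fst \<or> g = snd"
  shows "U I J w g t ^ (2 * p) \<le> V I J w"
proof -
  let ?x = "\<lambda>k. X k (\<pi> (Suc k) t, \<pi> k t) (g (\<pi> (Suc k) t, \<pi> k t)) I J w / \<rho> k"
  have th: "(\<Sum>k<K. d k * \<rho> k / \<Gamma>) = 1"
    using Gamma_pos by (simp add: sum_divide_distrib[symmetric] \<Gamma>_def)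
  have th0: "0 \<le> d k * \<rho> k / \<Gamma>" if "k < K" for k
    using d_pos[OF that] rho_pos[OF that] Gamma_pos by simp
  have x0: "0 \<le> ?x k" if "k < K" for k using rho_pos[OF that] by (simp add: X_def)
  have "U I J w g t ^ (2 * p) \<le> (\<Sum>k<K. d k * \<rho> k / \<Gamma> * ?x k ^ (2 * p))"
    unfolding U_def using K by (intro power_sum_convex th th0 x0) (auto simp: lessThan_empty_iff)
  also have "\<dots> \<le> V I J w"
    unfolding V_def
  proof (intro sum_mono mult_left_mono)
    fix k assume "k \<in> {..<K}"
    then have k: "k < K" by simp
    show "0 \<le> d k * \<rho> k / \<Gamma>" by (rule th0[OF k])
    let ?ab = "(\<pi> (Suc k) t, \<pi> k t)"
    have "?x k ^ (2 * p) \<le> 1 + ?x k ^ (2 * r k)"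
    proof (cases "?x k \<le> 1")
      case True
      then have "?x k ^ (2 * p) \<le> 1" using x0[OF k] by (intro power_le_one) auto
      then show ?thesis by (simp add: zero_le_even_power add_increasing2)
    next
      case False
      then have "?x k ^ (2 * p) \<le> ?x k ^ (2 * r k)" using p_le_r[OF k] by (intro power_increasing) auto
      then show ?thesis by simp
    qed
    also have "?x k ^ (2 * r k) \<le> Z k I J w ?ab" using g by (auto simp: Z_def zero_le_even_power)
    also have "Z k I J w ?ab \<le> (\<Sum>ab\<in>P k. Z k I J w ab)"
      using t finite_P by (intro member_le_sum) (auto simp: P_def Z_def zero_le_even_power)
    finally show "?x k ^ (2 * p) \<le> 1 + (\<Sum>ab\<in>P k. Z k I J w ab)" by simp
  qed
  finally show ?thesis .
qed

text \<open>Each increment of the bilinear form is split so that one factor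
  is an increment of the matrices, controlled in operator norm, and the other one is bounded by
  the supremum of the image norms.\<close>

lemma q_chain:
  assumes t: "t \<in> T" and I: "I \<subseteq> N" and J: "J \<subseteq> N"
  shows "cmod (q t I J w) \<le> \<Gamma> * (sqrt (Nm J w) * U I J w fst t + sqrt (Nm I w) * U J I w snd t)"
proof -
  have q0: "q (\<pi> 0 t) I J w = 0" by (simp add: q_def Y_def pi_0[OF t])
  have Yd: "Y a I w i - Y b I w i = (\<Sum>j\<in>I. of_real (w j) * (A a i j - A b i j))" for a b I i
    by (simp add: Y_def sum_subtractf right_diff_distrib)
  have lin: "cmod (\<Sum>i\<in>R. cnj (Y a I w i - Y b I w i) * Y c J w i) \<le> sqrt (Nm J w) * (d k * X k (a, b) c I J w)"
    if k: "k < K" and c: "c \<in> T" for k a b c I J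
  proof -
    have e: "(\<Sum>i\<in>R. cnj (Y a I w i - Y b I w i) * Y c J w i)
        = (\<Sum>j\<in>I. of_real (w j) * (\<Sum>i\<in>R. cnj (A a i j - A b i j) * Y c J w i))"
      unfolding Yd cnj_sum sum_distrib_right sum_distrib_left
      by (subst sum.swap) (simp add: mult_ac)
    show ?thesis
    proof (cases "Nm J w = 0")
      case True
      then have "(\<Sum>i\<in>R. (cmod (Y c J w i))^2) = 0"
        using Y_energy_le[OF c, of J w] sum_nonneg[of R "\<lambda>i. (cmod (Y c J w i))^2"] by simp
      then have "\<forall>i\<in>R. Y c J w i = 0" using finO by (simp add: sum_nonneg_eq_0_iff)
      then show ?thesis using True by simp
    next
      case False
      then have Np: "Nm J w > 0" using Nm_nonneg[of J w] by simp
      have "(\<Sum>i\<in>R. cnj (A a i j - A b i j) * Y c J w i) = of_real (d k * sqrt (Nm J w)) * cc k (a, b) c J j w" for j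
        using Np d_pos[OF k] by (simp add: cc_def)
      then have "(\<Sum>i\<in>R. cnj (Y a I w i - Y b I w i) * Y c J w i)
          = of_real (d k * sqrt (Nm J w)) * (\<Sum>j\<in>I. of_real (w j) * cc k (a, b) c J j w)"
        unfolding e by (simp add: sum_distrib_left mult_ac)
      then show ?thesis using Np d_pos[OF k] by (simp add: norm_mult X_def mult_ac)
    qed
  qed
  have inc: "cmod (q (\<pi> (Suc k) t) I J w - q (\<pi> k t) I J w)
      \<le> sqrt (Nm J w) * (d k * X k (\<pi> (Suc k) t, \<pi> k t) (\<pi> (Suc k) t) I J w)
       + sqrt (Nm I w) * (d k * X k (\<pi> (Suc k) t, \<pi> k t) (\<pi> k t) J I w)" if k: "k < K" for k
  proof -
    let ?a = "\<pi> (Suc k) t" and ?b = "\<pi> k t"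
    have ab: "?a \<in> T" "?b \<in> T" using pi_in k t by auto
    \<comment> \<open>The left argument is varied with the right one held at the new point, then the
      right argument with the left one held at the old point. Conjugating \<open>v\<close> brings
      its increment into the first slot, so that \<open>lin\<close> applies to both.\<close>
    define u where "u = (\<Sum>i\<in>R. cnj (Y ?a I w i - Y ?b I w i) * Y ?a J w i)"
    define v where "v = (\<Sum>i\<in>R. cnj (Y ?a J w i - Y ?b J w i) * Y ?b I w i)"
    have "q ?a I J w - q ?b I J w = u + cnj v"
      by (simp add: u_def v_def q_def sum.distrib[symmetric] sum_subtractf[symmetric] algebra_simps)
    then have "cmod (q ?a I J w - q ?b I J w) \<le> cmod u + cmod v"
      using norm_triangle_ineq[of u "cnj v"] by simp
    also have "\<dots> \<le> sqrt (Nm J w) * (d k * X k (?a, ?b) ?a I J w) + sqrt (Nm I w) * (d k * X k (?a, ?b) ?b J I w)"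
      unfolding u_def v_def
      by (intro add_mono lin k ab)
    finally show ?thesis .
  qed
  have "q t I J w = (\<Sum>k<K. q (\<pi> (Suc k) t) I J w - q (\<pi> k t) I J w)"
    using sum_lessThan_telescope[of "\<lambda>k. q (\<pi> k t) I J w" K] by (simp only: pi_K[OF t] q0 diff_0_right)
  then have "cmod (q t I J w) \<le> (\<Sum>k<K. cmod (q (\<pi> (Suc k) t) I J w - q (\<pi> k t) I J w))"
    by (simp only: norm_sum)
  also have "\<dots> \<le> (\<Sum>k<K. sqrt (Nm J w) * (d k * X k (\<pi> (Suc k) t, \<pi> k t) (\<pi> (Suc k) t) I J w)
       + sqrt (Nm I w) * (d k * X k (\<pi> (Suc k) t, \<pi> k t) (\<pi> k t) J I w))"
    by (intro sum_mono inc) auto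
  also have "\<dots> = sqrt (Nm J w) * (\<Gamma> * U I J w fst t) + sqrt (Nm I w) * (\<Gamma> * U J I w snd t)"
    unfolding Gamma_U by (simp add: sum_distrib_left sum.distrib)
  finally show ?thesis by (simp add: algebra_simps)
qed

text \<open>The arithmetic-geometric inequality with weight \<open>\<tau> ^ p\<close> separates
  image norms from chained increments, which are not independent of each other; the image norms are
  then replaced by \<open>D + S\<close>.\<close>

lemma q_power_le:
  assumes t: "t \<in> T" and I: "I \<subseteq> N" and J: "J \<subseteq> N" and tau: "\<tau> > 0"
  shows "cmod (q t I J w) ^ p \<le> (2 * \<Gamma>) ^ p * ((2 * \<tau>) ^ p * (2 * D w ^ p + S I w ^ p + S J w ^ p) + (V I J w + V J I w) / \<tau> ^ p) / 2"
proof -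
  define \<alpha> where "\<alpha> = U I J w fst t"
  define \<beta> where "\<beta> = U J I w snd t"
  have a: "\<alpha> ^ (2 * p) \<le> V I J w" and b: "\<beta> ^ (2 * p) \<le> V J I w"
    unfolding \<alpha>_def \<beta>_def using U_power_le_V I J t by blast+
  have ab0: "\<alpha> \<ge> 0" "\<beta> \<ge> 0" unfolding \<alpha>_def \<beta>_def by (rule U_nonneg)+
  have key: "(sqrt (Nm J w) * a) ^ p \<le> (\<tau> ^ p * (2 ^ p * (D w ^ p + S J w ^ p)) + v / \<tau> ^ p) / 2"
    if "J \<subseteq> N" "a \<ge> 0" "a ^ (2 * p) \<le> v" for a v J
  proof -
    define x where "x = sqrt (Nm J w) ^ p"
    define y where "y = a ^ p"
    define s where "s = \<tau> ^ p"
    have s: "s > 0" using tau by (simp add: s_def)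
    have "2 * (x * y) \<le> s * x^2 + y^2 / s"
    proof (rule mult_right_le_imp_le[OF _ s])
      have "0 \<le> (s * x - y)^2" by simp
      also have "(s * x - y)^2 = (s * x^2 + y^2 / s) * s - 2 * (x * y) * s"
        using s by (simp add: power2_eq_square algebra_simps)
      finally show "2 * (x * y) * s \<le> (s * x^2 + y^2 / s) * s" by simp
    qed
    moreover have "x^2 = Nm J w ^ p"
      using Nm_nonneg by (simp add: x_def power_mult[symmetric] mult.commute[of p] power_mult)
    moreover have "Nm J w ^ p \<le> 2 ^ p * (D w ^ p + S J w ^ p)"
      using power_mono[OF Nm_le[OF that(1), of w] Nm_nonneg, of p] power_sum_two[OF D_nonneg S_nonneg, of w J w p]
      by linarith
    then have "s * Nm J w ^ p \<le> s * (2 ^ p * (D w ^ p + S J w ^ p))" using s by (intro mult_left_mono) auto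
    moreover have "y^2 = a ^ (2 * p)" by (simp add: y_def power_mult[symmetric] mult.commute)
    then have "y^2 / s \<le> v / s" using that s by (simp add: divide_right_mono)
    moreover have "(sqrt (Nm J w) * a) ^ p = x * y" by (simp add: x_def y_def power_mult_distrib)
    ultimately show ?thesis by (simp add: s_def)
  qed
  have "cmod (q t I J w) ^ p \<le> (\<Gamma> * (sqrt (Nm J w) * \<alpha> + sqrt (Nm I w) * \<beta>)) ^ p"
    using q_chain[OF t I J, of w] by (intro power_mono) (simp_all add: \<alpha>_def \<beta>_def)
  also have "\<dots> = \<Gamma> ^ p * (sqrt (Nm J w) * \<alpha> + sqrt (Nm I w) * \<beta>) ^ p" by (simp add: power_mult_distrib)
  also have "\<dots> \<le> \<Gamma> ^ p * (2 ^ p * ((sqrt (Nm J w) * \<alpha>) ^ p + (sqrt (Nm I w) * \<beta>) ^ p))"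
    using Gamma_pos ab0 Nm_nonneg by (intro mult_left_mono power_sum_two) auto
  also have "\<dots> \<le> \<Gamma> ^ p * (2 ^ p * ((\<tau> ^ p * (2 ^ p * (D w ^ p + S J w ^ p)) + V I J w / \<tau> ^ p) / 2
      + (\<tau> ^ p * (2 ^ p * (D w ^ p + S I w ^ p)) + V J I w / \<tau> ^ p) / 2))"
    using Gamma_pos by (intro mult_left_mono add_mono key a b ab0 I J) auto
  also have "\<dots> = (2 * \<Gamma>) ^ p * ((2 * \<tau>) ^ p * (2 * D w ^ p + S I w ^ p + S J w ^ p) + (V I J w + V J I w) / \<tau> ^ p) / 2"
    by (simp add: power_mult_distrib algebra_simps add_divide_distrib)
  finally show ?thesis .
qed

lemma S_power_le:
  assumes J: "J \<subseteq> N" and tau: "\<tau> > 0"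
  shows "S J w ^ p \<le> (\<Sum>I\<in>Pow J. 1 / 2 ^ card J * (4 ^ p * ((2 * \<Gamma>) ^ p * ((2 * \<tau>) ^ p * (2 * D w ^ p + S I w ^ p + S (J - I) w ^ p)
     + (V I (J - I) w + V (J - I) I w) / \<tau> ^ p) / 2)))" (is "_ \<le> ?R")
proof -
  have fJ: "finite J" by (rule finite_subset[OF J finite_index])
  have "S J w \<in> (\<lambda>t. cmod (off t J w)) ` T" unfolding S_def using finT by (intro Max_in) auto
  then obtain t where t: "t \<in> T" "S J w = cmod (off t J w)" by auto
  have "S J w ^ p \<le> (\<Sum>I\<in>Pow J. 1 / 2 ^ card J * (4 * cmod (q t I (J - I) w))) ^ p"
    unfolding t(2) by (intro power_mono decoupling fJ) auto
  also have "\<dots> \<le> (\<Sum>I\<in>Pow J. 1 / 2 ^ card J * (4 * cmod (q t I (J - I) w)) ^ p)"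
    using fJ by (intro power_sum_convex) (auto simp: card_Pow)
  also have "\<dots> \<le> ?R"
  proof (intro sum_mono mult_left_mono)
    fix I assume "I \<in> Pow J"
    then have "I \<subseteq> N" "J - I \<subseteq> N" using J by auto
    from q_power_le[OF t(1) this tau, of w]
    show "(4 * cmod (q t I (J - I) w)) ^ p \<le> 4 ^ p * ((2 * \<Gamma>) ^ p * ((2 * \<tau>) ^ p * (2 * D w ^ p + S I w ^ p + S (J - I) w ^ p)
     + (V I (J - I) w + V (J - I) I w) / \<tau> ^ p) / 2)"
      unfolding power_mult_distrib[of 4] by (intro mult_left_mono) auto
  qed auto
  finally show ?thesis .
qed

text \<open>The moments of the chaos are first bounded by a constant and then, with that bound for the
  image norms, by a multiple of \<open>\<Gamma>\<close>.\<close>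

lemma chaos_moment:
  assumes Di: "integrable PP (\<lambda>w. D w ^ p)" and DB: "(\<integral>w. D w ^ p \<partial>PP) \<le> B ^ p"
    and B: "B \<ge> 1" and G: "\<Gamma> \<le> 1 / 16"
  shows "(\<integral>w. S N w ^ p \<partial>PP) \<le> (160 * \<Gamma> * B) ^ p"
proof -
  let ?E = "\<lambda>f. \<integral>w. f w \<partial>PP"
  \<comment> \<open>The maximum runs over all blocks because the decoupling of one block refers back
    to its sub-blocks.\<close>
  define F where "F = Max ((\<lambda>I. ?E (\<lambda>w. S I w ^ p)) ` Pow N)"
  let ?b = "\<lambda>t. (8 * \<Gamma>) ^ p * ((2 * t) ^ p * (B ^ p + F) + 3 / t ^ p)"
  have fN: "finite (Pow N)" using finite_index by simp
  have F_ge: "?E (\<lambda>w. S I w ^ p) \<le> F" if "I \<subseteq> N" for I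
    unfolding F_def using fN that by simp
  have F0: "F \<ge> 0"
    by (rule order_trans[OF Bochner_Integration.integral_nonneg F_ge[of "{}"]]) (use S_nonneg in auto)
  have step: "?E (\<lambda>w. S J w ^ p) \<le> ?b \<tau>"
    if J: "J \<subseteq> N" and tau: "\<tau> > 0" for J \<tau>
  proof -
    have fJ: "finite J" by (rule finite_subset[OF J finite_index])
    define h where "h I w = 4 ^ p * ((2 * \<Gamma>) ^ p * ((2 * \<tau>) ^ p * (2 * D w ^ p + S I w ^ p + S (J - I) w ^ p)
     + (V I (J - I) w + V (J - I) I w) / \<tau> ^ p) / 2)" for I w
    have h: "integrable PP (h I) \<and> ?E (h I) \<le> ?b \<tau>"
      if "I \<in> Pow J" for I
    proof -
      have I: "I \<subseteq> N" "J - I \<subseteq> N" "I \<inter> (J - I) = {}" "(J - I) \<inter> I = {}" using that J by auto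
      note i = Di S_power_integrable[OF I(1) p] S_power_integrable[OF I(2) p]
        V_integrable(1)[OF I(1-3)] V_integrable(1)[OF I(2,1,4)]
      have hi: "integrable PP (h I)" unfolding h_def using i by auto
      have "?E (h I) = 4 ^ p * ((2 * \<Gamma>) ^ p * ((2 * \<tau>) ^ p * (2 * ?E (\<lambda>w. D w ^ p) + ?E (\<lambda>w. S I w ^ p) + ?E (\<lambda>w. S (J - I) w ^ p))
           + (?E (V I (J - I)) + ?E (V (J - I) I)) / \<tau> ^ p) / 2)"
        unfolding h_def using i by simp
      also have "\<dots> \<le> 4 ^ p * ((2 * \<Gamma>) ^ p * ((2 * \<tau>) ^ p * (2 * B ^ p + F + F) + (3 + 3) / \<tau> ^ p) / 2)"
        using F_ge[OF I(1)] F_ge[OF I(2)] V_integrable(2)[OF I(1-3)] V_integrable(2)[OF I(2,1,4)] DB Gamma_pos tau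
        by (intro mult_left_mono divide_right_mono add_mono) auto
      also have "\<dots> = ?b \<tau>"
      proof -
        have e: "(8 * \<Gamma>) ^ p = 4 ^ p * (2 * \<Gamma>) ^ p" by (simp only: power_mult_distrib[symmetric]) simp
        have gen: "a * (b * (c * (2 * x + F + F) + (3 + 3) / t) / 2) = a * b * (c * (x + F) + 3 / t)" for a b c x t :: real
          by (simp add: algebra_simps add_divide_distrib)
        show ?thesis unfolding e by (rule gen)
      qed
      finally show ?thesis using hi by blast
    qed
    have "?E (\<lambda>w. S J w ^ p) \<le> ?E (\<lambda>w. \<Sum>I\<in>Pow J. 1 / 2 ^ card J * h I w)"
    proof (rule integral_mono)
      show "integrable PP (\<lambda>w. S J w ^ p)" by (rule S_power_integrable[OF J p])
      show "integrable PP (\<lambda>w. \<Sum>I\<in>Pow J. 1 / 2 ^ card J * h I w)"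
        using h by (intro Bochner_Integration.integrable_sum Bochner_Integration.integrable_mult_right) auto
      show "S J w ^ p \<le> (\<Sum>I\<in>Pow J. 1 / 2 ^ card J * h I w)" for w
        unfolding h_def by (rule S_power_le[OF J tau])
    qed
    also have "\<dots> = (\<Sum>I\<in>Pow J. 1 / 2 ^ card J * ?E (h I))"
      using h by (subst Bochner_Integration.integral_sum) auto
    also have "\<dots> \<le> (\<Sum>I\<in>Pow J. 1 / 2 ^ card J * (?b \<tau>))"
      using h by (intro sum_mono mult_left_mono) auto
    also have "\<dots> = ?b \<tau>"
      using fJ by (simp add: card_Pow)
    finally show ?thesis .
  qed
  have B1: "B ^ p \<ge> 1" using B by simp
  have "F \<in> (\<lambda>I. ?E (\<lambda>w. S I w ^ p)) ` Pow N" unfolding F_def using fN by (intro Max_in) auto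
  then obtain J where J: "J \<subseteq> N" "F = ?E (\<lambda>w. S J w ^ p)" by auto
  \<comment> \<open>Then \<open>8 * \<Gamma> * (2 * \<tau>) = 1 / 2\<close>, so \<open>F\<close> can
    be absorbed on the left, while \<open>8 * \<Gamma> / \<tau> = 256 * \<Gamma>^2\<close> is at
    most one by the bound on \<open>\<Gamma>\<close>.\<close>
  define \<tau> where "\<tau> = 1 / (32 * \<Gamma>)"
  have tau: "\<tau> > 0" using Gamma_pos by (simp add: \<tau>_def)
  have "F \<le> ?b \<tau>"
    using step[OF J(1) tau] J(2) by simp
  also have "\<dots> = (8 * \<Gamma> * (2 * \<tau>)) ^ p * (B ^ p + F) + 3 * (8 * \<Gamma> / \<tau>) ^ p"
  proof -
    have gen: "a * (c * y + 3 / t) = a * c * y + 3 * (a / t)" for a c y t :: real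
      by (simp add: algebra_simps)
    show ?thesis unfolding power_mult_distrib[of "8 * \<Gamma>" "2 * \<tau>"] power_divide by (rule gen)
  qed
  also have "8 * \<Gamma> * (2 * \<tau>) = 1 / 2" using Gamma_pos by (simp add: \<tau>_def)
  also have "(1 / 2) ^ p * (B ^ p + F) \<le> 1 / 2 * (B ^ p + F)"
    using power_decreasing[of 1 p "1/2::real"] p B1 F0 by (intro mult_right_mono) auto
  also have "(8 * \<Gamma> / \<tau>) ^ p \<le> 1"
  proof (rule power_le_one)
    have "\<Gamma> * \<Gamma> \<le> 1/16 * (1/16)" using G Gamma_pos by (intro mult_mono) auto
    then show "8 * \<Gamma> / \<tau> \<le> 1" by (simp add: \<tau>_def)
    show "0 \<le> 8 * \<Gamma> / \<tau>" using Gamma_pos tau by simp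
  qed
  finally have "F \<le> (B ^ p + F) / 2 + 3" by simp
  then have F7: "F \<le> 7 * B ^ p" using B1 by argo
  \<comment> \<open>The second pass takes \<open>\<tau> = 1\<close>: nothing has to be absorbed any
    more, so the prefactor \<open>(8 * \<Gamma>) ^ p\<close> survives.\<close>
  have "?E (\<lambda>w. S N w ^ p) \<le> (8 * \<Gamma>) ^ p * ((2 * 1) ^ p * (B ^ p + F) + 3 / 1 ^ p)"
    by (rule step) auto
  also have "\<dots> \<le> (8 * \<Gamma>) ^ p * (2 ^ p * (8 * B ^ p) + 2 ^ p * (2 * B ^ p))"
  proof (intro mult_left_mono add_mono)
    show "3 / 1 ^ p \<le> 2 ^ p * (2 * B ^ p)"
    proof -
      have "2 * 1 \<le> 2 ^ p * B ^ p" using B1 power_increasing[OF p, of "2::real"] by (intro mult_mono) auto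
      then have "3 \<le> 2 * (2 ^ p * B ^ p)" by linarith
      also have "\<dots> = 2 ^ p * (2 * B ^ p)" by (rule mult.left_commute)
      finally show ?thesis by (simp only: power_one div_by_1)
    qed
  qed (use F7 Gamma_pos in auto)
  also have "\<dots> = 10 * (16 * \<Gamma> * B) ^ p"
  proof -
    have e: "(16 * \<Gamma> * B) ^ p = (8 * \<Gamma>) ^ p * 2 ^ p * B ^ p" by (simp only: power_mult_distrib[symmetric]) simp
    have gen: "a * (b * (8 * c) + b * (2 * c)) = 10 * (a * b * c)" for a b c :: real
      by (simp add: algebra_simps)
    show ?thesis unfolding e by (rule gen)
  qed
  also have "\<dots> \<le> 10 ^ p * (16 * \<Gamma> * B) ^ p"
    using power_increasing[OF p, of "10::real"] Gamma_pos B by (intro mult_right_mono) auto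
  also have "\<dots> = (160 * \<Gamma> * B) ^ p" 
    by (subst power_mult_distrib[symmetric], rule arg_cong[where f = "\<lambda>x. x ^ p"]) simp
  finally show ?thesis .
qed

end

subsection \<open>The discrete Fourier transform and circulant matrices\<close>

text \<open>The characters of the cyclic group, with integer arguments so that differences of
  indices are not truncated.\<close>

definition chi :: "nat \<Rightarrow> int \<Rightarrow> int \<Rightarrow> complex" where
  "chi n l a = cis (2 * pi * real_of_int (l * a) / real n)"

definition dft :: "nat \<Rightarrow> (nat \<Rightarrow> complex) \<Rightarrow> nat \<Rightarrow> complex" where
  "dft n b l = (\<Sum>k=1..n. b k * chi n (int l) (int k))"

lemma norm_chi [simp]: "cmod (chi n l a) = 1" by (simp add: chi_def)

lemma chi_add: "chi n l (a + b) = chi n l a * chi n l b"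
  by (simp add: chi_def cis_mult distrib_left add_divide_distrib)

lemma chi_minus: "chi n l (- a) = cnj (chi n l a)"
  by (simp add: chi_def cis_cnj)

lemma chi_diff: "chi n l (a - b) = chi n l a * cnj (chi n l b)"
  using chi_add[of n l a "-b"] by (simp add: chi_minus)

lemma chi_multiple: assumes "n \<ge> 1" shows "chi n l (int n * c) = 1"
proof -
  have "2 * pi * real_of_int (l * (int n * c)) / real n = 2 * pi * real_of_int (l * c)"
    using assms by simp
  then show ?thesis unfolding chi_def by (simp only: cis_multiple_2pi Ints_of_int)
qed

lemma chi_cong: assumes "n \<ge> 1" "a mod int n = b mod int n" shows "chi n l a = chi n l b"
proof -
  have "int n dvd a - b" using assms(2) by (simp add: mod_eq_dvd_iff)
  then obtain c where "a = int n * c + b" by (auto simp: dvd_def algebra_simps)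
  then show ?thesis by (simp add: chi_add chi_multiple[OF assms(1)])
qed

lemma sum_chi:
  assumes "n \<ge> 1"
  shows "(\<Sum>l<n. chi n (int l) a) = (if int n dvd a then of_nat n else 0)"
proof -
  define \<omega> where "\<omega> = chi n 1 a"
  have pw: "chi n (int l) a = \<omega> ^ l" for l
    by (simp add: \<omega>_def chi_def Complex.DeMoivre mult_ac)
  show ?thesis
  proof (cases "int n dvd a")
    case True
    then have "chi n (int l) a = 1" for l using chi_multiple[OF assms] by (auto simp: dvd_def)
    then show ?thesis using True by simp
  next
    case False
    have "\<omega> ^ n = 1"
      using chi_multiple[OF assms, of 1 a] pw[of n] by (simp add: chi_def mult_ac)
    have "\<omega> \<noteq> 1"
    proof
      assume "\<omega> = 1"
      then have "cos (2 * pi * (real_of_int a / real n)) = 1"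
        unfolding \<omega>_def chi_def by (metis Re_complex_of_real cis.sel(1) mult_1 of_real_1 times_divide_eq_right)
      then obtain k :: int where "2 * pi * (real_of_int a / real n) = of_int k * 2 * pi"
        using cos_one_2pi_int by auto
      then have "2 * pi * (real_of_int a / real n) = 2 * pi * of_int k" by (simp only: mult_ac)
      then have "real_of_int a / real n = of_int k" by (subst (asm) mult_cancel_left) simp
      then have "real_of_int a = of_int (k * int n)" using assms by (simp add: field_simps)
      then have "a = k * int n" by linarith
      then show False using False by simp
    qed
    then have "(\<Sum>l<n. \<omega> ^ l) = 0" using \<open>\<omega> ^ n = 1\<close> by (simp add: geometric_sum)
    then show ?thesis using False by (simp add: pw)
  qed
qed

lemma parseval:
  assumes "n \<ge> 1"
  shows "(\<Sum>l<n. (cmod (dft n c l))^2) = real n * (\<Sum>j=1..n. (cmod (c j))^2)"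
proof -
  have "complex_of_real (\<Sum>l<n. (cmod (dft n c l))^2)
      = (\<Sum>l<n. \<Sum>j=1..n. \<Sum>k=1..n. c j * cnj (c k) * chi n (int l) (int j - int k))"
    unfolding of_real_sum complex_norm_square dft_def cnj_sum sum_product
    by (simp add: chi_diff mult_ac)
  also have "\<dots> = (\<Sum>j=1..n. \<Sum>l<n. \<Sum>k=1..n. c j * cnj (c k) * chi n (int l) (int j - int k))"
    by (rule sum.swap)
  also have "\<dots> = (\<Sum>j=1..n. \<Sum>k=1..n. \<Sum>l<n. c j * cnj (c k) * chi n (int l) (int j - int k))"
    by (intro sum.cong refl sum.swap)
  also have "\<dots> = (\<Sum>j=1..n. \<Sum>k=1..n. if k = j then c j * cnj (c j) * of_nat n else 0)"
  proof (intro sum.cong refl)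
    fix j k assume jk: "j \<in> {1..n}" "k \<in> {1..n}"
    have "int n dvd int j - int k \<longleftrightarrow> k = j"
    proof
      assume "int n dvd int j - int k"
      moreover have "\<bar>int j - int k\<bar> < int n" using jk by auto
      ultimately have "int j - int k = 0" using dvd_imp_le_int[of "int j - int k" "int n"] by linarith
      then show "k = j" by simp
    qed auto
    then show "(\<Sum>l<n. c j * cnj (c k) * chi n (int l) (int j - int k)) = (if k = j then c j * cnj (c j) * of_nat n else 0)"
      unfolding sum_distrib_left[symmetric] sum_chi[OF assms] by auto
  qed
  also have "\<dots> = (\<Sum>j=1..n. c j * cnj (c j) * of_nat n)" by simp
  also have "\<dots> = complex_of_real (real n * (\<Sum>j=1..n. (cmod (c j))^2))"
    by (simp add: sum_distrib_left mult_ac complex_norm_square flip: of_real_power)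
  finally show ?thesis using of_real_eq_iff by blast
qed

section \<open>Cyclic subtraction and the operator norm of partial circulant matrices\<close>

lemma cyc_sub_unique:
  assumes "n \<ge> 1" "k \<in> {1..n}" "k' \<in> {1..n}" "int k mod int n = int k' mod int n"
  shows "k = k'"
proof -
  have "int n dvd int k - int k'" using assms(4) by (simp add: mod_eq_dvd_iff)
  moreover have "\<bar>int k - int k'\<bar> < int n" using assms(2,3) by auto
  ultimately have "int k - int k' = 0" using dvd_imp_le_int[of "int k - int k'" "int n"] by linarith
  then show ?thesis by simp
qed

text \<open>For fixed \<open>i\<close> the map \<open>j \<mapsto> i - j\<close> modulo
  \<open>n\<close> is its own inverse. Every change between summing over the variables and over the
  entries of \<open>x\<close> is this substitution.\<close>

lemma cyc_sub_invol:
  assumes "n \<ge> 1" "j \<in> {1..n}"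
  shows "cyc_sub n i (cyc_sub n i j) = j"
proof (rule cyc_sub_unique[OF assms(1) cyc_sub_in[OF assms(1)] assms(2)])
  have "(int i - int (cyc_sub n i j)) mod int n = (int i - int (cyc_sub n i j) mod int n) mod int n"
    by (simp add: mod_simps)
  also have "\<dots> = (int i - (int i - int j) mod int n) mod int n" by (simp add: cyc_sub_cong[OF assms(1)])
  also have "\<dots> = int j mod int n" by (simp add: mod_simps)
  finally show "int (cyc_sub n i (cyc_sub n i j)) mod int n = int j mod int n"
    by (simp add: cyc_sub_cong[OF assms(1)])
qed

lemma bij_cyc_sub:
  assumes "n \<ge> 1" shows "bij_betw (cyc_sub n i) {1..n} {1..n}"
  by (rule bij_betw_byWitness[where f' = "cyc_sub n i"])
    (use cyc_sub_invol[OF assms] cyc_sub_in[OF assms] in auto)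

lemma sum_cyc_sub:
  assumes "n \<ge> 1"
  shows "(\<Sum>j=1..n. f j (cyc_sub n i j)) = (\<Sum>k=1..n. f (cyc_sub n i k) k)"
proof -
  have "(\<Sum>j=1..n. f j (cyc_sub n i j)) = (\<Sum>j=1..n. f (cyc_sub n i (cyc_sub n i j)) (cyc_sub n i j))"
    using cyc_sub_invol[OF assms] by (intro sum.cong) auto
  also have "\<dots> = (\<Sum>k=1..n. f (cyc_sub n i k) k)"
    by (rule sum.reindex_bij_betw[OF bij_cyc_sub[OF assms]])
  finally show ?thesis .
qed

text \<open>Restricting rows costs nothing: extend \<open>z\<close> by zero off
  \<open>\<Omega>\<close>. The map is then a cyclic correlation, on the Fourier side multiplication
  by the conjugate transform of \<open>b\<close>, and Parseval on both sides cancels the factor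
  \<open>n\<close>.\<close>

lemma convolution_bound:
  assumes n: "n \<ge> 1" and O: "\<Omega> \<subseteq> {1..n}" and b: "\<And>l. l < n \<Longrightarrow> cmod (dft n b l) \<le> \<beta>"
  shows "(\<Sum>j=1..n. (cmod (\<Sum>i\<in>\<Omega>. cnj (b (cyc_sub n i j)) * z i))^2) \<le> \<beta>^2 * (\<Sum>i\<in>\<Omega>. (cmod (z i))^2)"
proof -
  define c where "c j = (\<Sum>i\<in>\<Omega>. cnj (b (cyc_sub n i j)) * z i)" for j
  define y where "y i = (if i \<in> \<Omega> then z i else 0)" for i
  have ysum: "(\<Sum>i=1..n. f i (y i)) = (\<Sum>i\<in>\<Omega>. f i (z i))" if "\<And>i. f i 0 = 0" for f :: "nat \<Rightarrow> complex \<Rightarrow> 'b::comm_monoid_add"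
    by (rule sum.mono_neutral_cong_right) (use O that in \<open>auto simp: y_def\<close>)
  have "dft n c l = cnj (dft n b l) * dft n y l" for l
  proof -
    have "dft n c l = (\<Sum>i\<in>\<Omega>. \<Sum>j=1..n. cnj (b (cyc_sub n i j)) * z i * chi n (int l) (int j))"
      unfolding dft_def c_def sum_distrib_right by (rule sum.swap)
    also have "\<dots> = (\<Sum>i\<in>\<Omega>. \<Sum>k=1..n. cnj (b k) * z i * chi n (int l) (int (cyc_sub n i k)))"
    proof (rule sum.cong[OF refl])
      fix i
      show "(\<Sum>j=1..n. cnj (b (cyc_sub n i j)) * z i * chi n (int l) (int j))
          = (\<Sum>k=1..n. cnj (b k) * z i * chi n (int l) (int (cyc_sub n i k)))"
        by (rule sum_cyc_sub[OF n, of "\<lambda>j k. cnj (b k) * z i * chi n (int l) (int j)"])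
    qed
    also have "\<dots> = (\<Sum>i\<in>\<Omega>. \<Sum>k=1..n. cnj (b k * chi n (int l) (int k)) * (z i * chi n (int l) (int i)))"
    proof (intro sum.cong refl)
      fix i k
      have "chi n (int l) (int (cyc_sub n i k)) = chi n (int l) (int i - int k)"
        by (rule chi_cong[OF n cyc_sub_cong[OF n]])
      then show "cnj (b k) * z i * chi n (int l) (int (cyc_sub n i k)) = cnj (b k * chi n (int l) (int k)) * (z i * chi n (int l) (int i))"
        by (simp add: chi_diff)
    qed
    also have "\<dots> = cnj (dft n b l) * (\<Sum>i\<in>\<Omega>. z i * chi n (int l) (int i))"
      unfolding dft_def cnj_sum sum_distrib_left sum_distrib_right by simp
    also have "(\<Sum>i\<in>\<Omega>. z i * chi n (int l) (int i)) = dft n y l"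
      unfolding dft_def by (rule ysum[symmetric]) simp
    finally show ?thesis .
  qed
  then have "(\<Sum>l<n. (cmod (dft n c l))^2) \<le> (\<Sum>l<n. \<beta>^2 * (cmod (dft n y l))^2)"
    using b by (intro sum_mono) (auto simp: norm_mult power_mult_distrib intro!: mult_right_mono power_mono)
  then have "real n * (\<Sum>j=1..n. (cmod (c j))^2) \<le> real n * (\<beta>^2 * (\<Sum>j=1..n. (cmod (y j))^2))"
    unfolding sum_distrib_left[symmetric] parseval[OF n] by (simp add: mult_ac)
  then have "(\<Sum>j=1..n. (cmod (c j))^2) \<le> \<beta>^2 * (\<Sum>j=1..n. (cmod (y j))^2)" using n by simp
  also have "(\<Sum>j=1..n. (cmod (y j))^2) = (\<Sum>i\<in>\<Omega>. (cmod (z i))^2)" by (rule ysum) simp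
  finally show ?thesis by (simp add: c_def)
qed

subsection \<open>Maurey's empirical method\<close>

text \<open>A derandomised form: the elements of the list are chosen one
  after the other such that the exponential potential does not exceed its mean.\<close>

lemma empirical_list:
  fixes g :: "'a \<Rightarrow> 'f \<Rightarrow> real"
  assumes A: "finite A" and p: "\<And>a. a \<in> A \<Longrightarrow> p a \<ge> 0" "(\<Sum>a\<in>A. p a) = 1"
    and F: "finite F" and mean: "\<And>f. f \<in> F \<Longrightarrow> (\<Sum>a\<in>A. p a * g a f) = 0"
    and B: "\<And>a f. a \<in> A \<Longrightarrow> f \<in> F \<Longrightarrow> \<bar>g a f\<bar> \<le> B"
  shows "\<exists>ys. length ys = q \<and> set ys \<subseteq> A \<and>
    (\<Sum>f\<in>F. exp (l * (\<Sum>a\<leftarrow>ys. g a f)) + exp (- l * (\<Sum>a\<leftarrow>ys. g a f)))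
      \<le> 2 * real (card F) * exp (real q * (l^2 * B^2))"
proof (induction q)
  case 0
  then show ?case by (intro exI[of _ "[]"]) auto
next
  case (Suc q)
  then obtain ys where ys: "length ys = q" "set ys \<subseteq> A"
    "(\<Sum>f\<in>F. exp (l * (\<Sum>a\<leftarrow>ys. g a f)) + exp (- l * (\<Sum>a\<leftarrow>ys. g a f)))
      \<le> 2 * real (card F) * exp (real q * (l^2 * B^2))" by blast
  define S where "S f = (\<Sum>a\<leftarrow>ys. g a f)" for f
  define \<Phi> where "\<Phi> a = (\<Sum>f\<in>F. exp (l * (g a f + S f)) + exp (- l * (g a f + S f)))" for a
  have one: "(\<Sum>a\<in>A. p a * exp (c * g a f)) \<le> exp (c^2 * B^2)" if f: "f \<in> F" for c f
  proof -
    have "(\<Sum>a\<in>A. p a * exp (c * g a f)) \<le> (\<Sum>a\<in>A. c * (p a * g a f) + p a * exp (c^2 * B^2))"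
    proof (rule sum_mono)
      fix a assume a: "a \<in> A"
      have "(g a f)^2 \<le> B^2" using B[OF a f] by (metis power2_abs power_mono abs_ge_zero)
      then have "exp ((c * g a f)^2) \<le> exp (c^2 * B^2)"
        by (simp add: power_mult_distrib mult_left_mono)
      then have "exp (c * g a f) \<le> c * g a f + exp (c^2 * B^2)"
        using exp_le_self_plus_exp_square[of "c * g a f"] by linarith
      then have "p a * exp (c * g a f) \<le> p a * (c * g a f + exp (c^2 * B^2))"
        using p(1)[OF a] by (rule mult_left_mono)
      then show "p a * exp (c * g a f) \<le> c * (p a * g a f) + p a * exp (c^2 * B^2)"
        by (simp add: algebra_simps)
    qed
    also have "\<dots> = exp (c^2 * B^2)"
      using mean[OF f] p(2) by (simp add: sum.distrib sum_distrib_left[symmetric] sum_distrib_right[symmetric])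
    finally show ?thesis .
  qed
  have "(\<Sum>a\<in>A. p a * \<Phi> a) = (\<Sum>a\<in>A. \<Sum>f\<in>F. exp (l * S f) * (p a * exp (l * g a f)) + exp (- l * S f) * (p a * exp (- l * g a f)))"
    unfolding \<Phi>_def sum_distrib_left
    by (intro sum.cong refl) (simp add: algebra_simps exp_add exp_diff exp_minus field_simps)
  also have "\<dots> = (\<Sum>f\<in>F. exp (l * S f) * (\<Sum>a\<in>A. p a * exp (l * g a f)) + exp (- l * S f) * (\<Sum>a\<in>A. p a * exp (- l * g a f)))"
    by (subst sum.swap) (simp only: sum.distrib sum_distrib_left)
  also have "\<dots> \<le> (\<Sum>f\<in>F. exp (l * S f) * exp (l^2 * B^2) + exp (- l * S f) * exp ((- l)^2 * B^2))"
    by (intro sum_mono add_mono mult_left_mono one) auto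
  also have "\<dots> = (\<Sum>f\<in>F. exp (l * S f) + exp (- l * S f)) * exp (l^2 * B^2)"
    by (simp add: sum_distrib_right distrib_right)
  also have "\<dots> \<le> 2 * real (card F) * exp (real q * (l^2 * B^2)) * exp (l^2 * B^2)"
    using ys(3) by (intro mult_right_mono) (auto simp: S_def)
  also have "\<dots> = 2 * real (card F) * exp (real (Suc q) * (l^2 * B^2))"
    by (simp add: exp_add distrib_right)
  finally have avg: "(\<Sum>a\<in>A. p a * \<Phi> a) \<le> 2 * real (card F) * exp (real (Suc q) * (l^2 * B^2))" .
  have "\<exists>a\<in>A. \<Phi> a \<le> 2 * real (card F) * exp (real (Suc q) * (l^2 * B^2))"
  proof (rule ccontr)
    let ?R = "2 * real (card F) * exp (real (Suc q) * (l^2 * B^2))"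
    assume "\<not> ?thesis"
    then have gt: "\<Phi> a > ?R" if "a \<in> A" for a using that by force
    obtain a where a: "a \<in> A" "p a > 0"
    proof -
      have "\<exists>a\<in>A. p a \<noteq> 0" using p(2) by (metis sum.neutral zero_neq_one)
      then show ?thesis using that p(1) by force
    qed
    have "(\<Sum>a\<in>A. p a * ?R) < (\<Sum>a\<in>A. p a * \<Phi> a)"
    proof (rule sum_strict_mono_ex1[OF A])
      show "\<forall>a\<in>A. p a * ?R \<le> p a * \<Phi> a"
        using mult_left_mono[OF less_imp_le[OF gt] p(1)] by blast
      show "\<exists>a\<in>A. p a * ?R < p a * \<Phi> a"
        using mult_strict_left_mono[OF gt[OF a(1)] a(2)] a(1) by blast
    qed
    then show False using avg p(2) by (simp add: sum_distrib_right[symmetric])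
  qed
  then obtain a where "a \<in> A" "\<Phi> a \<le> 2 * real (card F) * exp (real (Suc q) * (l^2 * B^2))" by blast
  then show ?case using ys(1,2) by (intro exI[of _ "a # ys"]) (auto simp: \<Phi>_def S_def)
qed

text \<open>With \<open>H = ln (2 * card F)\<close> the parameter \<open>l\<close> is chosen so that
  \<open>q * l^2 * B^2 = H\<close>. The potential is then at most \<open>exp (2 * H)\<close> and
  bounds each single sum by \<open>2 * H / l\<close>.\<close>

lemma empirical_list_bound:
  fixes g :: "'a \<Rightarrow> 'f \<Rightarrow> real"
  assumes A: "finite A" and p: "\<And>a. a \<in> A \<Longrightarrow> p a \<ge> 0" "(\<Sum>a\<in>A. p a) = 1"
    and F: "finite F" "F \<noteq> {}" and mean: "\<And>f. f \<in> F \<Longrightarrow> (\<Sum>a\<in>A. p a * g a f) = 0"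
    and B: "\<And>a f. a \<in> A \<Longrightarrow> f \<in> F \<Longrightarrow> \<bar>g a f\<bar> \<le> B" and B0: "B > 0" and q: "q \<ge> 1"
  shows "\<exists>ys. length ys = q \<and> set ys \<subseteq> A \<and>
    (\<forall>f\<in>F. \<bar>\<Sum>a\<leftarrow>ys. g a f\<bar> \<le> 2 * B * sqrt (real q * ln (2 * real (card F))))"
proof -
  define H where "H = ln (2 * real (card F))"
  have c: "real (card F) \<ge> 1" using F by (simp add: card_gt_0_iff Suc_le_eq)
  have H: "H > 0" using c by (simp add: H_def)
  define l where "l = sqrt (H / real q) / B"
  let ?p = "\<lambda>ys. (\<Sum>f\<in>F. exp (l * (\<Sum>a\<leftarrow>ys. g a f)) + exp (- l * (\<Sum>a\<leftarrow>ys. g a f)))"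
  have l: "l > 0" using H q B0 by (simp add: l_def)
  have l2: "real q * (l^2 * B^2) = H" using H q B0 by (simp add: l_def power_divide)
  obtain ys where ys: "length ys = q" "set ys \<subseteq> A"
    "?p ys
      \<le> 2 * real (card F) * exp (real q * (l^2 * B^2))"
    using empirical_list[where g = g and l = l and q = q, OF A p F(1) mean B] by blast
  have "\<bar>\<Sum>a\<leftarrow>ys. g a f\<bar> \<le> 2 * B * sqrt (real q * H)" if f: "f \<in> F" for f
  proof -
    define S where "S = (\<Sum>a\<leftarrow>ys. g a f)"
    have "exp (l * \<bar>S\<bar>) \<le> exp (l * S) + exp (- l * S)" by (auto simp: abs_if)
    also have "\<dots> \<le> ?p ys"
      unfolding S_def using F(1) f by (intro member_le_sum) auto
    also have "\<dots> \<le> 2 * real (card F) * exp H" using ys(3) by (simp add: l2)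
    also have "\<dots> = exp (H + H)"
    proof -
      have "exp H = 2 * real (card F)" using c by (simp add: H_def)
      then show ?thesis by (simp only: exp_add)
    qed
    finally have "l * \<bar>S\<bar> \<le> 2 * H" by simp
    then have "\<bar>S\<bar> \<le> 2 * H / l" using l by (simp add: field_simps)
    also have "2 * H / l = 2 * B * (H / sqrt (H / real q))" by (simp add: l_def)
    also have "H / sqrt (H / real q) = sqrt (real q * H)"
    proof -
      have "sqrt (real q * H) * sqrt (H / real q) = sqrt (H^2)"
        using q by (simp add: real_sqrt_mult[symmetric] power2_eq_square del: real_sqrt_abs real_sqrt_abs2)
      then show ?thesis using H q by (simp add: field_simps)
    qed
    finally show ?thesis by (simp add: S_def)
  qed
  then show ?thesis using ys unfolding H_def by blast
qed

text \<open>Four directions represent real and imaginary parts with sign, which at most doubles the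
  sum of absolute values; hence the radius \<open>2 * R\<close> below. The atom \<open>0\<close>
  carries left-over mass.\<close>

definition unit_atoms :: "complex set" where "unit_atoms = {0, 1, -1, \<i>, -\<i>}"

lemma sum_unit_atoms: "(\<Sum>v\<in>unit_atoms. f v) = f 0 + f 1 + f (-1) + f \<i> + f (-\<i>)"
proof -
  have "(1::complex) \<noteq> -1" "\<i> \<noteq> 1" "\<i> \<noteq> -1" "-\<i> \<noteq> 1" "\<i> \<noteq> -\<i>" "-1 \<noteq> -\<i>" by (auto simp: complex_eq_iff)
  then show ?thesis unfolding unit_atoms_def by (simp add: add.assoc)
qed

definition atom_weight :: "complex \<Rightarrow> complex \<Rightarrow> real" where
  "atom_weight z v = (if v = 1 then max 0 (Re z) else if v = -1 then max 0 (- Re z)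
    else if v = \<i> then max 0 (Im z) else if v = -\<i> then max 0 (- Im z) else 0)"

lemma atom_weight_nonneg: "atom_weight z v \<ge> 0" by (simp add: atom_weight_def)

lemma atom_weight_sums:
  "(\<Sum>v\<in>unit_atoms. atom_weight z v) = \<bar>Re z\<bar> + \<bar>Im z\<bar>"
  "(\<Sum>v\<in>unit_atoms. of_real (atom_weight z v) * v) = z"
proof -
  have n: "(1::complex) \<noteq> -1" "\<i> \<noteq> 1" "\<i> \<noteq> -1" "-\<i> \<noteq> 1" "\<i> \<noteq> -\<i>" "-\<i> \<noteq> \<i>" "-1 \<noteq> -\<i>" "-\<i> \<noteq> -1" "-1 \<noteq> (1::complex)" "0 \<noteq> -\<i>" "0 \<noteq> \<i>" "-1 \<noteq> \<i>"
    by (auto simp: complex_eq_iff)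
  show "(\<Sum>v\<in>unit_atoms. atom_weight z v) = \<bar>Re z\<bar> + \<bar>Im z\<bar>"
    unfolding sum_unit_atoms by (simp add: atom_weight_def n)
  show "(\<Sum>v\<in>unit_atoms. of_real (atom_weight z v) * v) = z"
    unfolding sum_unit_atoms by (simp add: atom_weight_def n complex_eq_iff max_def)
qed

definition atoms :: "nat \<Rightarrow> (nat \<times> complex) set" where "atoms n = {1..n} \<times> unit_atoms"

lemma card_atoms: "finite (atoms n)" "card (atoms n) \<le> 5 * n"
proof -
  have "card unit_atoms \<le> 5" unfolding unit_atoms_def
    by (intro order_trans[OF card_insert_le_m1]) auto
  then show "finite (atoms n)" "card (atoms n) \<le> 5 * n" by (simp_all add: atoms_def unit_atoms_def)
qed

definition atoms_dft :: "nat \<Rightarrow> real \<Rightarrow> (nat \<times> complex) list \<Rightarrow> nat \<Rightarrow> complex" where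
  "atoms_dft n R ys l = (\<Sum>a\<leftarrow>ys. of_real R * snd a * chi n (int l) (int (fst a)))"

lemma norm_dft_le: "cmod (dft n x l) \<le> (\<Sum>j=1..n. cmod (x j))"
  unfolding dft_def by (rule sum_norm_le) (simp add: norm_mult)

text \<open>The weights make \<open>x / (2 * R)\<close> an average of atoms. Tests are the real and
  imaginary parts at \<open>n\<close> frequencies, \<open>2 * n\<close> in all, whence
  \<open>ln (4 * n)\<close>; each deviates by at most \<open>2 * R + R\<close>, and adding both
  parts gives \<open>2 * 2 * 3 = 12\<close>.\<close>

lemma maurey:
  assumes n: "n \<ge> 1" and q: "q \<ge> 1" and R: "R > 0" and x: "(\<Sum>j=1..n. cmod (x j)) \<le> R"
  shows "\<exists>ys. length ys = q \<and> set ys \<subseteq> atoms n \<and>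
    (\<forall>l<n. cmod (atoms_dft n (2 * R) ys l / of_nat q - dft n x l) \<le> 12 * R * sqrt (ln (4 * real n) / real q))"
proof -
  define tot where "tot = (\<Sum>j=1..n. \<bar>Re (x j)\<bar> + \<bar>Im (x j)\<bar>) / (2 * R)"
  have "(\<Sum>j=1..n. \<bar>Re (x j)\<bar> + \<bar>Im (x j)\<bar>) \<le> (\<Sum>j=1..n. 2 * cmod (x j))"
    using abs_Re_le_cmod abs_Im_le_cmod by (intro sum_mono) (smt (verit))
  also have "\<dots> \<le> 2 * R" using x by (simp add: sum_distrib_left[symmetric])
  finally have tot: "tot \<le> 1" using R by (simp add: tot_def)
  \<comment> \<open>The missing mass \<open>1 - tot\<close> is spread evenly over the
    \<open>n\<close> zero atoms, which leaves the mean unchanged.\<close>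
  define p where "p a = atom_weight (x (fst a)) (snd a) / (2 * R) + (if snd a = 0 then (1 - tot) / real n else 0)" for a
  have p0: "p a \<ge> 0" for a using R tot atom_weight_nonneg by (simp add: p_def)
  have fin: "finite unit_atoms" by (simp add: unit_atoms_def)
  have pv: "(\<Sum>a\<in>atoms n. of_real (p a) * (h (fst a) * snd a)) = (\<Sum>j=1..n. h j * x j) / of_real (2 * R)" for h :: "nat \<Rightarrow> complex"
  proof -
    have "(\<Sum>a\<in>atoms n. of_real (p a) * (h (fst a) * snd a))
       = (\<Sum>j=1..n. \<Sum>v\<in>unit_atoms. of_real (p (j, v)) * (h j * v))"
      by (simp add: atoms_def sum.cartesian_product case_prod_beta)
    also have "\<dots> = (\<Sum>j=1..n. h j * (\<Sum>v\<in>unit_atoms. of_real (atom_weight (x j) v) * v) / of_real (2 * R))"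
      unfolding sum_distrib_left sum_divide_distrib
      by (intro sum.cong refl) (auto simp: p_def)
    finally show ?thesis by (simp add: atom_weight_sums sum_divide_distrib)
  qed
  have p1: "(\<Sum>a\<in>atoms n. p a) = 1"
  proof -
    have "(\<Sum>a\<in>atoms n. p a) = (\<Sum>j=1..n. \<Sum>v\<in>unit_atoms. p (j, v))"
      by (simp add: atoms_def sum.cartesian_product case_prod_beta)
    also have "\<dots> = (\<Sum>j=1..n. (\<bar>Re (x j)\<bar> + \<bar>Im (x j)\<bar>) / (2 * R) + (1 - tot) / real n)"
    proof (rule sum.cong[OF refl])
      fix j
      have "(\<Sum>v\<in>unit_atoms. p (j, v)) = (\<Sum>v\<in>unit_atoms. atom_weight (x j) v) / (2 * R)
          + (\<Sum>v\<in>unit_atoms. if v = 0 then (1 - tot) / real n else 0)"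
        by (simp add: p_def sum.distrib sum_divide_distrib)
      also have "(\<Sum>v\<in>unit_atoms. if v = 0 then (1 - tot) / real n else 0) = (1 - tot) / real n"
        using fin by (simp add: unit_atoms_def)
      finally show "(\<Sum>v\<in>unit_atoms. p (j, v)) = (\<bar>Re (x j)\<bar> + \<bar>Im (x j)\<bar>) / (2 * R) + (1 - tot) / real n"
        by (simp only: atom_weight_sums)
    qed
    also have "\<dots> = tot + (1 - tot)" using n by (simp add: sum.distrib tot_def sum_divide_distrib[symmetric])
    finally show ?thesis by simp
  qed
  define \<phi> where "\<phi> a l = of_real (2 * R) * snd a * chi n (int l) (int (fst a))" for a :: "nat \<times> complex" and l
  have mean: "(\<Sum>a\<in>atoms n. of_real (p a) * (\<phi> a l - dft n x l)) = 0" for l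
  proof -
    have "(\<Sum>a\<in>atoms n. of_real (p a) * \<phi> a l)
        = of_real (2 * R) * (\<Sum>a\<in>atoms n. of_real (p a) * (chi n (int l) (int (fst a)) * snd a))"
      unfolding sum_distrib_left \<phi>_def by (simp add: mult_ac)
    also have "\<dots> = dft n x l" unfolding pv[of "\<lambda>j. chi n (int l) (int j)"] using R by (simp add: dft_def mult_ac)
    finally have 1: "(\<Sum>a\<in>atoms n. of_real (p a) * \<phi> a l) = dft n x l" .
    have 2: "(\<Sum>a\<in>atoms n. complex_of_real (p a)) = 1" using p1 by (metis of_real_1 of_real_sum)
    show ?thesis using 1 2 by (simp add: right_diff_distrib sum_subtractf sum_distrib_right[symmetric])
  qed
  define g where "g a f = (if snd f then Re (\<phi> a (fst f) - dft n x (fst f)) else Im (\<phi> a (fst f) - dft n x (fst f)))"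
    for a and f :: "nat \<times> bool"
  define F where "F = {..<n} \<times> (UNIV :: bool set)"
  have F: "finite F" "F \<noteq> {}" "card F = 2 * n" using n by (auto simp: F_def card_cartesian_product lessThan_empty_iff)
  have gm: "(\<Sum>a\<in>atoms n. p a * g a f) = 0" for f
    using arg_cong[OF mean[of "fst f"], of Re] arg_cong[OF mean[of "fst f"], of Im]
    by (cases "snd f") (simp_all add: g_def)
  have gB: "\<bar>g a f\<bar> \<le> 3 * R" if "a \<in> atoms n" for a f
  proof -
    have "cmod (snd a) \<le> 1" using that by (auto simp: atoms_def unit_atoms_def)
    then have "cmod (\<phi> a (fst f)) \<le> 2 * R" using R by (simp add: \<phi>_def norm_mult)
    moreover have "cmod (dft n x (fst f)) \<le> R" using norm_dft_le x by (rule order_trans)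
    ultimately have "cmod (\<phi> a (fst f) - dft n x (fst f)) \<le> 3 * R"
      using norm_triangle_ineq4[of "\<phi> a (fst f)" "dft n x (fst f)"] by linarith
    then show ?thesis unfolding g_def
      using abs_Re_le_cmod[of "\<phi> a (fst f) - dft n x (fst f)"] abs_Im_le_cmod[of "\<phi> a (fst f) - dft n x (fst f)"]
      by (auto simp del: minus_complex.sel)
  qed
  have "3 * R > 0" using R by simp
  from empirical_list_bound[where g = g, OF card_atoms(1) p0 p1 F(1,2) gm gB this q]
  obtain ys where ys: "length ys = q" "set ys \<subseteq> atoms n"
    "\<forall>f\<in>F. \<bar>\<Sum>a\<leftarrow>ys. g a f\<bar> \<le> 2 * (3 * R) * sqrt (real q * ln (2 * real (card F)))" by blast
  have "cmod (atoms_dft n (2 * R) ys l / of_nat q - dft n x l) \<le> 12 * R * sqrt (ln (4 * real n) / real q)" if l: "l < n" for l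
  proof -
    define W where "W = atoms_dft n (2 * R) ys l - of_nat q * dft n x l"
    have "(\<Sum>a\<leftarrow>zs. \<phi> a l - dft n x l) = atoms_dft n (2 * R) zs l - of_nat (length zs) * dft n x l" for zs
      by (induction zs) (simp_all add: atoms_dft_def \<phi>_def algebra_simps)
    then have W: "W = (\<Sum>a\<leftarrow>ys. \<phi> a l - dft n x l)" by (simp add: W_def ys(1))
    have "Re (\<Sum>a\<leftarrow>zs. \<phi> a l - dft n x l) = (\<Sum>a\<leftarrow>zs. g a (l, True))" for zs by (induction zs) (simp_all add: g_def)
    moreover have "Im (\<Sum>a\<leftarrow>zs. \<phi> a l - dft n x l) = (\<Sum>a\<leftarrow>zs. g a (l, False))" for zs by (induction zs) (simp_all add: g_def)
    ultimately have "\<bar>Re W\<bar> \<le> 6 * R * sqrt (real q * ln (4 * real n))" "\<bar>Im W\<bar> \<le> 6 * R * sqrt (real q * ln (4 * real n))"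
      using ys(3) l by (auto simp: W F(3) F_def)
    then have "cmod W \<le> 12 * R * sqrt (real q * ln (4 * real n))" using cmod_le[of W] by linarith
    then have "cmod W / real q \<le> 12 * R * sqrt (real q * ln (4 * real n)) / real q" by (rule divide_right_mono) simp
    also have "\<dots> = 12 * R * (sqrt (real q * ln (4 * real n)) / real q)" by simp
    also have "sqrt (real q * ln (4 * real n)) / real q = sqrt (ln (4 * real n) / real q)"
    proof -
      have "sqrt (real q * ln (4 * real n)) / real q = sqrt (real q) * sqrt (ln (4 * real n)) / (sqrt (real q) * sqrt (real q))"
        by (simp add: real_sqrt_mult)
      also have "\<dots> = sqrt (ln (4 * real n)) / sqrt (real q)"
        using q by (subst mult_divide_mult_cancel_left) auto
      finally show ?thesis by (simp add: real_sqrt_divide)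
    qed
    also have "cmod W / real q = cmod (atoms_dft n (2 * R) ys l / of_nat q - dft n x l)"
    proof -
      have "atoms_dft n (2 * R) ys l / of_nat q - dft n x l = W / of_nat q" using q by (simp add: W_def field_simps)
      then show ?thesis by (simp add: norm_divide)
    qed
    finally show ?thesis .
  qed
  then show ?thesis using ys(1,2) by blast
qed

text \<open>Replaces centres outside \<open>T\<close> by members of \<open>T\<close> that share a
  centre, as chaining needs maps from \<open>T\<close> to itself. The price is a doubled
  radius.\<close>

lemma centre_selection:
  assumes "finite Z" and ex: "\<And>x. x \<in> T \<Longrightarrow> \<exists>z\<in>Z. Q x z"
  shows "\<exists>f. (\<forall>x\<in>T. f x \<in> T \<and> (\<exists>z\<in>Z. Q x z \<and> Q (f x) z)) \<and> card (f ` T) \<le> card Z"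
proof -
  from ex obtain g where g: "\<And>x. x \<in> T \<Longrightarrow> g x \<in> Z \<and> Q x (g x)" by metis
  define h where "h z = (SOME x. x \<in> T \<and> Q x z)" for z
  have h: "h (g x) \<in> T \<and> Q (h (g x)) (g x)" if "x \<in> T" for x
    unfolding h_def by (rule someI[of _ x]) (use that g in auto)
  have "(\<lambda>x. h (g x)) ` T \<subseteq> h ` Z" using g by auto
  then have "card ((\<lambda>x. h (g x)) ` T) \<le> card Z"
    by (meson assms(1) card_image_le card_mono finite_imageI order_trans)
  then show ?thesis using g h by (intro exI[of _ "\<lambda>x. h (g x)"]) blast
qed

lemma maurey_net:
  assumes n: "n \<ge> 1" and q: "q \<ge> 1" and R: "R > 0" and T: "\<And>x. x \<in> T \<Longrightarrow> (\<Sum>j=1..n. cmod (x j)) \<le> R"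
  shows "\<exists>f. (\<forall>x\<in>T. f x \<in> T \<and> (\<forall>l<n. cmod (dft n (f x) l - dft n x l) \<le> 24 * R * sqrt (ln (4 * real n) / real q)))
     \<and> card (f ` T) \<le> (5 * n) ^ q"
proof -
  define Z where "Z = {ys. set ys \<subseteq> atoms n \<and> length ys = q}"
  define e where "e = 12 * R * sqrt (ln (4 * real n) / real q)"
  define Q where "Q x ys \<longleftrightarrow> (\<forall>l<n. cmod (atoms_dft n (2 * R) ys l / of_nat q - dft n x l) \<le> e)" for x ys
  have fin: "finite Z" unfolding Z_def by (rule finite_lists_length_eq[OF card_atoms(1)])
  have "card Z = card (atoms n) ^ q" unfolding Z_def by (rule card_lists_length_eq[OF card_atoms(1)])
  also have "\<dots> \<le> (5 * n) ^ q" by (rule power_mono[OF card_atoms(2)]) simp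
  finally have cz: "card Z \<le> (5 * n) ^ q" .
  have ex: "\<exists>ys\<in>Z. Q x ys" if "x \<in> T" for x
    using maurey[OF n q R T[OF that]] unfolding Z_def Q_def e_def by blast
  have "\<exists>f. (\<forall>x\<in>T. f x \<in> T \<and> (\<exists>z\<in>Z. Q x z \<and> Q (f x) z)) \<and> card (f ` T) \<le> card Z"
    by (rule centre_selection[OF fin ex])
  then obtain f where f0: "\<forall>x\<in>T. f x \<in> T \<and> (\<exists>z\<in>Z. Q x z \<and> Q (f x) z)"
    and f2: "card (f ` T) \<le> card Z" by (elim exE conjE)
  note f = f0[rule_format] f2
  have "cmod (dft n (f x) l - dft n x l) \<le> 24 * R * sqrt (ln (4 * real n) / real q)" if x: "x \<in> T" and l: "l < n" for x l
  proof -
    obtain z where "Q x z" "Q (f x) z" using f(1)[OF x] by blast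
    then have "cmod (atoms_dft n (2 * R) z l / of_nat q - dft n x l) \<le> e" "cmod (atoms_dft n (2 * R) z l / of_nat q - dft n (f x) l) \<le> e"
      using l by (auto simp: Q_def)
    moreover have "dft n (f x) l - dft n x l = (atoms_dft n (2 * R) z l / of_nat q - dft n x l) - (atoms_dft n (2 * R) z l / of_nat q - dft n (f x) l)"
      by simp
    ultimately have "cmod (dft n (f x) l - dft n x l) \<le> e + e"
      by (simp only: order_trans[OF norm_triangle_ineq4 add_mono])
    then show ?thesis by (simp add: e_def)
  qed
  then show ?thesis using f(1) order_trans[OF f(2) cz] by (intro exI[of _ f]) simp
qed

subsection \<open>Nets of sparse vectors\<close>

text \<open>Rounding towards zero does not increase absolute values, so the unit ball is preserved.\<close>

definition rnd :: "nat \<Rightarrow> real \<Rightarrow> real" where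
  "rnd s t = (if t \<ge> 0 then of_int \<lfloor>t * (8 * real s)\<rfloor> / (8 * real s) else - of_int \<lfloor>- t * (8 * real s)\<rfloor> / (8 * real s))"

lemma rnd_bounds:
  assumes s: "s \<ge> 1"
  shows "\<bar>rnd s t\<bar> \<le> \<bar>t\<bar>" (is ?goal1) "\<bar>t - rnd s t\<bar> \<le> 1 / (8 * real s)" "rnd s 0 = 0"
proof -
  let ?f = "\<lambda>u. real_of_int \<lfloor>u * (8 * real s)\<rfloor> / (8 * real s)"
  have *: "0 \<le> ?f u" "?f u \<le> u"
    "u - ?f u \<le> 1 / (8 * real s)" if "u \<ge> 0" for u
  proof -
    have "u * (8 * real s) - real_of_int \<lfloor>u * (8 * real s)\<rfloor> \<le> 1" by linarith
    then have "(u * (8 * real s) - real_of_int \<lfloor>u * (8 * real s)\<rfloor>) / (8 * real s) \<le> 1 / (8 * real s)"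
      by (rule divide_right_mono) simp
    then show "u - ?f u \<le> 1 / (8 * real s)"
      using s by (simp add: diff_divide_distrib)
    show "0 \<le> ?f u" using that by simp
    show "?f u \<le> u" using s by (simp add: divide_le_eq)
  qed
  show ?goal1 "\<bar>t - rnd s t\<bar> \<le> 1 / (8 * real s)" "rnd s 0 = 0"
    using *[of t] *[of "-t"] by (cases "t \<ge> 0"; simp add: rnd_def)+
qed

text \<open>With spacing \<open>1 / (8 * s)\<close> an entry moves by at most
  \<open>1 / (4 * s)\<close>, hence an \<open>s\<close>-sparse vector by at most
  \<open>1 / 16\<close> in squared norm.\<close>

definition grid :: "nat \<Rightarrow> complex set" where
  "grid s = (\<lambda>(a, b). Complex (of_int a / (8 * real s)) (of_int b / (8 * real s))) `
     ({- int (8 * s)..int (8 * s)} \<times> {- int (8 * s)..int (8 * s)})"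

lemma card_grid: "finite (grid s)" "card (grid s) \<le> (16 * s + 1)^2"
proof -
  have "card (grid s) \<le> card ({- int (8 * s)..int (8 * s)} \<times> {- int (8 * s)..int (8 * s)})"
    unfolding grid_def by (rule card_image_le) simp
  also have "\<dots> = (16 * s + 1)^2" by (simp add: card_cartesian_product power2_eq_square nat_add_distrib nat_mult_distrib)
  finally show "card (grid s) \<le> (16 * s + 1)^2" .
qed (simp add: grid_def)

lemma zero_in_grid: "0 \<in> grid s"
  unfolding grid_def by (rule image_eqI[of _ _ "(0, 0)"]) (auto simp: complex_eq_iff)

definition crnd :: "nat \<Rightarrow> complex \<Rightarrow> complex" where
  "crnd s z = Complex (rnd s (Re z)) (rnd s (Im z))"

lemma crnd_bounds:
  assumes s: "s \<ge> 1"
  shows "cmod (crnd s z) \<le> cmod z" (is ?goal1) "cmod (z - crnd s z) \<le> 1 / (4 * real s)" (is ?goal2) "crnd s 0 = 0"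
proof -
  have "(rnd s (Re z))^2 \<le> (Re z)^2" "(rnd s (Im z))^2 \<le> (Im z)^2"
    using rnd_bounds(1)[OF s] by (simp_all add: abs_le_square_iff[symmetric])
  then show ?goal1 by (simp add: cmod_def crnd_def)
  have "cmod (z - crnd s z) \<le> \<bar>Re (z - crnd s z)\<bar> + \<bar>Im (z - crnd s z)\<bar>" by (rule cmod_le)
  also have "\<dots> \<le> 1 / (8 * real s) + 1 / (8 * real s)"
    using rnd_bounds(2)[OF s] by (intro add_mono) (simp_all add: crnd_def)
  finally show ?goal2 by simp
  show "crnd s 0 = 0" using rnd_bounds(3)[OF s] by (simp add: crnd_def complex_eq_iff)
qed

lemma crnd_in_grid:
  assumes s: "s \<ge> 1" and z: "cmod z \<le> 1"
  shows "crnd s z \<in> grid s"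
proof -
  have *: "\<exists>k\<in>{- int (8 * s)..int (8 * s)}. rnd s t = of_int k / (8 * real s)" if t: "\<bar>t\<bar> \<le> 1" for t
  proof -
    have f: "\<lfloor>u * (8 * real s)\<rfloor> \<in> {0..int (8 * s)}" if "0 \<le> u" "u \<le> 1" for u
    proof -
      have "u * (8 * real s) \<le> 1 * (8 * real s)" using that by (intro mult_right_mono) auto
      then have "\<lfloor>u * (8 * real s)\<rfloor> \<le> int (8 * s)" by linarith
      then show ?thesis using that by simp
    qed
    show ?thesis
    proof (cases "t \<ge> 0")
      case True
      then have "\<lfloor>t * (8 * real s)\<rfloor> \<in> {0..int (8 * s)}" using f[of t] t by (simp only: abs_le_iff)
      then have "\<lfloor>t * (8 * real s)\<rfloor> \<in> {- int (8 * s)..int (8 * s)}" unfolding atLeastAtMost_iff by linarith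
      then show ?thesis using True by (intro bexI[of _ "\<lfloor>t * (8 * real s)\<rfloor>"]) (auto simp: rnd_def)
    next
      case False
      then have "\<lfloor>- t * (8 * real s)\<rfloor> \<in> {0..int (8 * s)}" using t by (intro f) auto
      then have "- \<lfloor>- t * (8 * real s)\<rfloor> \<in> {- int (8 * s)..int (8 * s)}" unfolding atLeastAtMost_iff by linarith
      then show ?thesis using False by (intro bexI[of _ "- \<lfloor>- t * (8 * real s)\<rfloor>"]) (auto simp: rnd_def)
    qed
  qed
  have "\<bar>Re z\<bar> \<le> 1" "\<bar>Im z\<bar> \<le> 1" using z abs_Re_le_cmod abs_Im_le_cmod order_trans by blast+
  then obtain a b where "a \<in> {- int (8 * s)..int (8 * s)}" "b \<in> {- int (8 * s)..int (8 * s)}"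
    "rnd s (Re z) = of_int a / (8 * real s)" "rnd s (Im z) = of_int b / (8 * real s)"
    using * by blast
  then show ?thesis unfolding grid_def crnd_def by (intro image_eqI[of _ _ "(a, b)"]) auto
qed

text \<open>Vectors are total functions; vanishing outside \<open>{1..n}\<close> makes them
  determined by their entries, so that the net is finite.\<close>

definition sparse_ball :: "nat \<Rightarrow> nat \<Rightarrow> (nat \<Rightarrow> complex) set" where
  "sparse_ball n s = {x. (\<forall>k. k \<notin> {1..n} \<longrightarrow> x k = 0) \<and> sparse n s x \<and> (\<Sum>k=1..n. (cmod (x k))^2) \<le> 1}"

definition net :: "nat \<Rightarrow> nat \<Rightarrow> (nat \<Rightarrow> complex) set" where
  "net n s = {x \<in> sparse_ball n s. \<forall>k. x k \<in> grid s}"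

lemma zero_in_net: "(\<lambda>_. 0) \<in> net n s"
  by (simp add: net_def sparse_ball_def sparse_def zero_in_grid)

text \<open>A net point is coded by a list of exactly \<open>s\<close> position-value pairs; shorter
  supports are padded with \<open>(1, 0)\<close>, which adds nothing on decoding.\<close>

lemma net_finite_card:
  assumes n: "n \<ge> 1"
  shows "finite (net n s)" "card (net n s) \<le> (n * (16 * s + 1)^2) ^ s" (is ?goal2)
proof -
  define Z where "Z = {zs. set zs \<subseteq> {1..n} \<times> grid s \<and> length zs = s}"
  define f where "f zs = (\<lambda>k. \<Sum>(j, v)\<leftarrow>zs. if j = k then v else 0)" for zs :: "(nat \<times> complex) list"
  have finZ: "finite Z" unfolding Z_def by (intro finite_lists_length_eq finite_cartesian_product card_grid) simp
  have "card Z = card ({1..n} \<times> grid s) ^ s" unfolding Z_def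
    by (intro card_lists_length_eq finite_cartesian_product card_grid) simp
  also have "\<dots> \<le> (n * (16 * s + 1)^2) ^ s"
    using card_grid(2)[of s] by (intro power_mono) (auto simp: card_cartesian_product simp del: One_nat_def)
  finally have cZ: "card Z \<le> (n * (16 * s + 1)^2) ^ s" .
  have sub: "net n s \<subseteq> f ` Z"
  proof
    fix x assume x: "x \<in> net n s"
    define S where "S = {j \<in> {1..n}. x j \<noteq> 0}"
    have S: "finite S" "card S \<le> s" using x by (auto simp: S_def net_def sparse_ball_def sparse_def)
    obtain xs where xs: "set xs = S" "distinct xs" using finite_distinct_list[OF S(1)] by blast
    have len: "length xs = card S" using xs distinct_card by fastforce
    define zs where "zs = map (\<lambda>j. (j, x j)) xs @ replicate (s - card S) (1, 0)"
    have "zs \<in> Z" using xs S len x n zero_in_grid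
      by (auto simp: zs_def Z_def S_def net_def)
    moreover have "f zs = x"
    proof
      fix k
      have "f zs k = (\<Sum>j\<leftarrow>xs. if j = k then x j else 0)"
        by (simp add: f_def zs_def comp_def sum_list_replicate)
      also have "\<dots> = (\<Sum>j\<in>S. if j = k then x j else 0)"
        using xs by (simp add: sum_list_distinct_conv_sum_set)
      also have "\<dots> = (if k \<in> S then x k else 0)" using S(1) by simp
      also have "\<dots> = x k" using x by (auto simp: S_def net_def sparse_ball_def)
      finally show "f zs k = x k" .
    qed
    ultimately show "x \<in> f ` Z" by blast
  qed
  show "finite (net n s)" using sub finZ finite_surj by blast
  show ?goal2
    using surj_card_le[OF finZ sub] cZ by linarith
qed

lemma sparse_ball_entry_le: "x \<in> sparse_ball n s \<Longrightarrow> cmod (x k) \<le> 1"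
proof (cases "k \<in> {1..n}")
  case True
  assume x: "x \<in> sparse_ball n s"
  have "(cmod (x k))^2 \<le> (\<Sum>k=1..n. (cmod (x k))^2)" using True by (intro member_le_sum) auto
  then have "(cmod (x k))^2 \<le> 1" using x by (simp add: sparse_ball_def)
  then show ?thesis by (simp add: abs_square_le_1)
qed (auto simp: sparse_ball_def)

text \<open>Rounding keeps the support inside that of \<open>x\<close>. Combinations of
  \<open>x\<close> and its net point therefore stay \<open>s\<close>-sparse, and no passage to
  \<open>2 * s\<close> is needed.\<close>

lemma net_approx:
  assumes s: "s \<ge> 1" and x: "x \<in> sparse_ball n s"
  shows "\<exists>y\<in>net n s. (\<Sum>k=1..n. (cmod (x k - y k))^2) \<le> 1 / 16 \<and> (\<forall>k. x k = 0 \<longrightarrow> y k = 0)"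
proof -
  define y where "y k = crnd s (x k)" for k
  define S where "S = {j \<in> {1..n}. x j \<noteq> 0}"
  have S: "finite S" "card S \<le> s" using x by (auto simp: S_def sparse_ball_def sparse_def)
  have y0: "y k = 0" if "x k = 0" for k using that crnd_bounds(3)[OF s] by (simp add: y_def)
  have "card {j \<in> {1..n}. y j \<noteq> 0} \<le> card S"
    using S(1) y0 by (intro card_mono) (auto simp: S_def)
  moreover have "(\<Sum>k=1..n. (cmod (y k))^2) \<le> (\<Sum>k=1..n. (cmod (x k))^2)"
    using crnd_bounds(1)[OF s] by (intro sum_mono power_mono) (auto simp: y_def)
  ultimately have "y \<in> net n s"
    using x S y0 crnd_in_grid[OF s sparse_ball_entry_le[OF x]]
    by (auto simp: net_def sparse_ball_def sparse_def y_def)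
  moreover have "(\<Sum>k=1..n. (cmod (x k - y k))^2) \<le> 1 / 16"
  proof -
    have "(\<Sum>k=1..n. (cmod (x k - y k))^2) = (\<Sum>k\<in>S. (cmod (x k - y k))^2)"
      by (rule sum.mono_neutral_right) (auto simp: S_def y0)
    also have "\<dots> \<le> (\<Sum>k\<in>S. (1 / (4 * real s))^2)"
      using crnd_bounds(2)[OF s] by (intro sum_mono power_mono) (auto simp: y_def)
    also have "\<dots> = real (card S) * (1 / (16 * (real s * real s)))" by (simp add: power2_eq_square)
    also have "\<dots> \<le> real s * (1 / (16 * (real s * real s)))" using S(2) by (intro mult_right_mono) auto
    also have "\<dots> = 1 / 16 * (1 / real s)" using s by simp
    also have "\<dots> \<le> 1 / 16" using s by (simp add: divide_le_eq)
    finally show ?thesis .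
  qed
  ultimately show ?thesis using y0 by blast
qed

lemma sparse_ball_l1:
  assumes x: "x \<in> sparse_ball n s"
  shows "(\<Sum>k=1..n. cmod (x k)) \<le> sqrt (real s)"
proof (rule real_le_rsqrt)
  define S where "S = {j \<in> {1..n}. x j \<noteq> 0}"
  have S: "finite S" "card S \<le> s" using x by (auto simp: S_def sparse_ball_def sparse_def)
  have "(\<Sum>k=1..n. cmod (x k)) = (\<Sum>k\<in>S. cmod (x k) * 1)"
    unfolding mult_1_right by (rule sum.mono_neutral_right) (auto simp: S_def)
  then have 1: "(\<Sum>k=1..n. cmod (x k))^2 \<le> (\<Sum>k\<in>S. (cmod (x k))^2) * real (card S)"
    using Cauchy_Schwarz_ineq_sum[of "\<lambda>k. cmod (x k)" "\<lambda>_. 1" S] by simp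
  have "(\<Sum>k\<in>S. (cmod (x k))^2) \<le> (\<Sum>k=1..n. (cmod (x k))^2)"
    by (rule sum_mono2) (auto simp: S_def)
  also have "\<dots> \<le> 1" using x by (simp add: sparse_ball_def)
  finally have "(\<Sum>k\<in>S. (cmod (x k))^2) * real (card S) \<le> 1 * real s"
    using S(2) by (intro mult_mono) auto
  with 1 show "(\<Sum>k=1..n. cmod (x k))^2 \<le> real s" by simp
qed

lemma card_pairs_le: "finite T \<Longrightarrow> card ((\<lambda>t. (f t, g t)) ` T) \<le> card (f ` T) * card (g ` T)"
proof -
  assume T: "finite T"
  have "card ((\<lambda>t. (f t, g t)) ` T) \<le> card (f ` T \<times> g ` T)"
    by (rule card_mono) (use T in auto)
  then show ?thesis by (simp add: card_cartesian_product)
qed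

lemma dft_diff: "dft n (\<lambda>j. a j - b j) l = dft n a l - dft n b l"
  by (simp add: dft_def left_diff_distrib sum_subtractf)

lemma dft_zero [simp]: "dft n (\<lambda>_. 0) l = 0" by (simp add: dft_def)

text \<open>Intermediate levels come from Maurey's nets, level \<open>0\<close> is the zero vector
  and level \<open>K\<close> the whole net. Increments cost the sum of two radii, and pairs the
  product of two cardinalities; level \<open>Suc k\<close> accounts for a factor \<open>4\<close> in
  the exponent.\<close>

lemma chain_exists:
  assumes s: "2 \<le> s" and sn: "s \<le> n"
  shows "\<exists>K \<pi>. K \<ge> 1 \<and> real K \<le> 3 * ln (real s) \<and> (\<forall>k\<le>K. \<forall>x\<in>net n s. \<pi> k x \<in> net n s) \<and>
    (\<forall>x\<in>net n s. \<pi> K x = x \<and> \<pi> 0 x = (\<lambda>_. 0)) \<and>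
    (\<forall>k<K. \<forall>x\<in>net n s. \<forall>l<n. cmod (dft n (\<lambda>j. \<pi> (Suc k) x j - \<pi> k x j) l) \<le> 48 * sqrt (real s) / 2 ^ k) \<and>
    (\<forall>k<K. real (card ((\<lambda>x. (\<pi> (Suc k) x, \<pi> k x)) ` net n s)) \<le> exp (4 ^ k * (200 * (ln (real n))^2)))"
proof -
  let ?l = "ln (real n)"
  have n: "n \<ge> 2" using assms by simp
  have ln2: "ln 2 \<ge> (2/3::real)" by (rule ln2_ge_two_thirds)
  have lnn: "?l \<ge> 2/3" "ln (real s) \<ge> 2/3"
    using ln2 ln_mono[of 2 "real n"] ln_mono[of 2 "real s"] n s by linarith+
  have pw: "ln (c * real n) \<le> (1 + real d) * ?l" if "c \<le> 2 ^ d" "c > 0" for c :: real and d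
  proof -
    have "2 ^ d \<le> real n ^ d" using n by (intro power_mono) auto
    then have "c * real n \<le> real n ^ d * real n" using that by (intro mult_right_mono) auto
    then have "ln (c * real n) \<le> ln (real n ^ d * real n)" using that n by (intro ln_mono) auto
    also have "\<dots> = (1 + real d) * ?l" using n by (simp add: ln_mult ln_realpow algebra_simps)
    finally show ?thesis .
  qed
  \<comment> \<open>About the base-four logarithm of \<open>s\<close>: once
    \<open>s \<le> 4 ^ K\<close>, the full net with its exponent of order \<open>s * ln n\<close> is
    no larger than level \<open>K\<close> permits.\<close>
  define K where "K = nat \<lceil>ln (real s) / ln 4\<rceil>"
  have ln4: "ln (4::real) = 2 * ln 2" using ln_realpow[of 2 2] by simp
  then have ln4p: "ln (4::real) > 1" using ln2 by simp
  have Kge: "real K \<ge> ln (real s) / ln 4" and Kle: "real K \<le> ln (real s) / ln 4 + 1"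
  proof -
    have "0 \<le> ln (real s) / ln 4" using lnn ln4p by simp
    then have "real K = of_int \<lceil>ln (real s) / ln 4\<rceil>" unfolding K_def by simp
    then show "real K \<ge> ln (real s) / ln 4" "real K \<le> ln (real s) / ln 4 + 1" by linarith+
  qed
  have K1: "K \<ge> 1"
  proof -
    have "ln (real s) / ln 4 > 0" using lnn ln4p by simp
    then show ?thesis using Kge by (cases K) auto
  qed
  have K3: "real K \<le> 3 * ln (real s)"
  proof -
    have "ln (real s) / ln 4 \<le> ln (real s) / 1" using lnn ln4p by (intro divide_left_mono) auto
    then show ?thesis using Kle lnn by simp
  qed
  have K4: "real s \<le> 4 ^ K"
  proof -
    have "ln (real s) \<le> real K * ln 4" using Kge ln4p by (simp add: divide_le_eq)
    also have "\<dots> = ln (4 ^ K)" by (simp add: ln_realpow)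
    finally show ?thesis using s by simp
  qed
  \<comment> \<open>Lists of length \<open>4 ^ k * b\<close> cancel the logarithm in Maurey's radius
    and leave \<open>24 * sqrt s / 2 ^ k\<close>.\<close>
  define b where "b = nat \<lceil>ln (4 * real n)\<rceil>"
  have ln4n: "ln (4 * real n) > 0" using n by simp
  have b: "real b \<ge> ln (4 * real n)" "real b \<le> ln (4 * real n) + 1"
    using ln4n unfolding b_def by linarith+
  then have b1: "b \<ge> 1" using ln4n by (cases b) auto
  have net1: "(\<Sum>j=1..n. cmod (x j)) \<le> sqrt (real s)" if "x \<in> net n s" for x
    using sparse_ball_l1 that by (auto simp: net_def)
  have "\<exists>f. (\<forall>x\<in>net n s. f x \<in> net n s \<and> (\<forall>l<n. cmod (dft n (f x) l - dft n x l) \<le> 24 * sqrt (real s) * sqrt (ln (4 * real n) / real (4 ^ k * b))))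
     \<and> card (f ` net n s) \<le> (5 * n) ^ (4 ^ k * b)" for k
    by (rule maurey_net[OF _ _ _ net1]) (use n s b1 in auto)
  then obtain f where f: "\<And>k x. x \<in> net n s \<Longrightarrow> f k x \<in> net n s"
      "\<And>k x l. x \<in> net n s \<Longrightarrow> l < n \<Longrightarrow> cmod (dft n (f k x) l - dft n x l) \<le> 24 * sqrt (real s) * sqrt (ln (4 * real n) / real (4 ^ k * b))"
      "\<And>k. card (f k ` net n s) \<le> (5 * n) ^ (4 ^ k * b)" by metis
  have rad: "24 * sqrt (real s) * sqrt (ln (4 * real n) / real (4 ^ k * b)) \<le> 24 * sqrt (real s) / 2 ^ k" for k
  proof -
    have "ln (4 * real n) / real (4 ^ k * b) \<le> 1 / 4 ^ k"
      using b b1 by (simp add: field_simps)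
    also have "\<dots> = (1 / 2 ^ k)^2" by (simp add: power_divide power_mult[symmetric] mult.commute[of k] power_mult)
    finally have "sqrt (ln (4 * real n) / real (4 ^ k * b)) \<le> sqrt ((1 / 2 ^ k)^2)" by (rule real_sqrt_le_mono)
    also have "\<dots> = 1 / 2 ^ k" by (subst real_sqrt_abs) simp
    finally have "24 * sqrt (real s) * sqrt (ln (4 * real n) / real (4 ^ k * b)) \<le> 24 * sqrt (real s) * (1 / 2 ^ k)"
      by (intro mult_left_mono) auto
    then show ?thesis by simp
  qed
  define \<pi> where "\<pi> k x = (if k = 0 then (\<lambda>_. 0) else if k = K then x else f k x)" for k x
  have pin: "\<pi> k x \<in> net n s" if "x \<in> net n s" for k x
    using that f(1) zero_in_net by (simp add: \<pi>_def)
  have close: "cmod (dft n (\<pi> k x) l - dft n x l) \<le> 24 * sqrt (real s) / 2 ^ k" if "x \<in> net n s" "l < n" for k x l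
  proof -
    consider "k = 0" | "k \<noteq> 0" "k = K" | "k \<noteq> 0" "k \<noteq> K" by blast
    then show ?thesis
    proof cases
      case 1
      have "cmod (dft n x l) \<le> sqrt (real s)" using norm_dft_le net1[OF that(1)] by (rule order_trans)
      also have "\<dots> \<le> 24 * sqrt (real s)" by simp
      finally show ?thesis using 1 by (simp add: \<pi>_def)
    next
      case 2
      then show ?thesis by (simp add: \<pi>_def)
    next
      case 3
      then show ?thesis using order_trans[OF f(2)[OF that] rad] by (simp add: \<pi>_def)
    qed
  qed
  have inc: "cmod (dft n (\<lambda>j. \<pi> (Suc k) x j - \<pi> k x j) l) \<le> 48 * sqrt (real s) / 2 ^ k" if "x \<in> net n s" "l < n" for k x l
  proof -
    have "cmod (dft n (\<lambda>j. \<pi> (Suc k) x j - \<pi> k x j) l) \<le> cmod (dft n (\<pi> (Suc k) x) l - dft n x l) + cmod (dft n (\<pi> k x) l - dft n x l)"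
      using norm_triangle_ineq4[of "dft n (\<pi> (Suc k) x) l - dft n x l" "dft n (\<pi> k x) l - dft n x l"]
      by (simp add: dft_diff)
    also have "\<dots> \<le> 24 * sqrt (real s) / 2 ^ Suc k + 24 * sqrt (real s) / 2 ^ k"
      by (intro add_mono close that)
    also have "24 * sqrt (real s) / 2 ^ Suc k \<le> 24 * sqrt (real s) / 2 ^ k" by (simp add: field_simps)
    finally show ?thesis by simp
  qed
  define \<Lambda> where "\<Lambda> = real b * ln (5 * real n)"
  have ln5: "ln (5 * real n) > 0" using n by simp
  have L0: "\<Lambda> \<ge> 0" using ln5 by (simp add: \<Lambda>_def)
  have fin: "finite (net n s)" using net_finite_card n by simp
  have cf: "real (card (f k ` net n s)) \<le> exp (4 ^ k * \<Lambda>)" for k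
  proof -
    have "real (card (f k ` net n s)) \<le> real ((5 * n) ^ (4 ^ k * b))" using f(3)[of k] by linarith
    also have "\<dots> = exp (ln (5 * real n)) ^ (4 ^ k * b)" using n by simp
    also have "\<dots> = exp (4 ^ k * \<Lambda>)" by (simp add: exp_of_nat_mult[symmetric] \<Lambda>_def mult_ac)
    finally show ?thesis .
  qed
  have c0: "real (card (\<pi> k ` net n s)) \<le> exp (4 ^ k * \<Lambda>)" if "k \<noteq> K" for k
  proof (cases "k = 0")
    case True
    have "\<pi> k ` net n s \<subseteq> {\<lambda>_. 0}" using True by (auto simp: \<pi>_def)
    then have "card (\<pi> k ` net n s) \<le> 1" using card_mono[of "{\<lambda>_. 0}" "\<pi> k ` net n s"] by simp
    then have "real (card (\<pi> k ` net n s)) \<le> 1" by simp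
    also have "\<dots> \<le> exp (4 ^ k * \<Lambda>)" using L0 by simp
    finally show ?thesis .
  next
    case False
    then have "\<pi> k = f k" using that by (auto simp: \<pi>_def)
    then show ?thesis using cf by simp
  qed
  have cK: "real (card (\<pi> K ` net n s)) \<le> exp (4 ^ K * (13 * ?l))"
  proof -
    have "\<pi> K ` net n s = net n s" using K1 by (auto simp: \<pi>_def)
    then have "real (card (\<pi> K ` net n s)) \<le> real ((n * (16 * s + 1)^2) ^ s)"
      using net_finite_card(2)[of n s] n by (simp only: of_nat_le_iff)
    also have "\<dots> \<le> (real n ^ 13) ^ s"
    proof -
      have "n * (16 * s + 1)^2 \<le> n * (2 ^ 5 * n)^2"
        using sn s by (intro mult_left_mono power_mono) auto
      also have "\<dots> \<le> n * (n ^ 5 * n)^2"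
        using n by (intro mult_left_mono power_mono mult_right_mono) auto
      also have "\<dots> = n ^ 13" by (simp add: power_mult_distrib eval_nat_numeral)
      finally have "real (n * (16 * s + 1)^2) \<le> real n ^ 13" by (metis of_nat_le_iff of_nat_power)
      then show ?thesis by (simp only: of_nat_power power_mono of_nat_0_le_iff)
    qed
    also have "\<dots> = exp (13 * ?l) ^ s"
      using exp_of_nat_mult[of 13 "?l"] n by simp
    also have "\<dots> = exp (real s * (13 * ?l))" by (simp add: exp_of_nat_mult[symmetric])
    also have "\<dots> \<le> exp (4 ^ K * (13 * ?l))" using K4 lnn by (simp add: mult_right_mono)
    finally show ?thesis .
  qed
  have bn: "real b \<le> 5 * ?l" using b(2) pw[of 4 2] lnn by simp
  have L: "\<Lambda> \<le> 20 * (?l)^2"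
  proof -
    have "\<Lambda> \<le> (5 * ?l) * (4 * ?l)"
      unfolding \<Lambda>_def using bn pw[of 5 3] ln5 lnn by (intro mult_mono) auto
    then show ?thesis by (simp add: power2_eq_square)
  qed
  have l1: "?l \<le> 3/2 * (?l)^2"
    using lnn mult_right_mono[of "2/3" "?l" "?l"] by (simp add: power2_eq_square)
  have pairs: "real (card ((\<lambda>x. (\<pi> (Suc k) x, \<pi> k x)) ` net n s)) \<le> exp (4 ^ k * (200 * (?l)^2))" if k: "k < K" for k
  proof -
    have "card ((\<lambda>x. (\<pi> (Suc k) x, \<pi> k x)) ` net n s) \<le> card (\<pi> (Suc k) ` net n s) * card (\<pi> k ` net n s)"
      by (rule card_pairs_le[OF fin])
    then have "real (card ((\<lambda>x. (\<pi> (Suc k) x, \<pi> k x)) ` net n s)) \<le> real (card (\<pi> (Suc k) ` net n s)) * real (card (\<pi> k ` net n s))"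
      by (simp only: of_nat_mult[symmetric] of_nat_le_iff)
    also have "\<dots> \<le> exp (4 ^ Suc k * (30 * (?l)^2)) * exp (4 ^ k * (20 * (?l)^2))"
    proof (intro mult_mono)
      show "real (card (\<pi> k ` net n s)) \<le> exp (4 ^ k * (20 * (?l)^2))"
      proof -
        have "(4::real) ^ k * \<Lambda> \<le> 4 ^ k * (20 * (?l)^2)" using L by (rule mult_left_mono) simp
        then have "exp (4 ^ k * \<Lambda>) \<le> exp (4 ^ k * (20 * (?l)^2))" by (simp only: exp_le_cancel_iff)
        then show ?thesis using c0[of k] k by linarith
      qed
      show "real (card (\<pi> (Suc k) ` net n s)) \<le> exp (4 ^ Suc k * (30 * (?l)^2))"
      proof (cases "Suc k = K")
        case True
        have "(4::real) ^ K * (13 * ?l) \<le> 4 ^ K * (30 * (?l)^2)"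
        proof (rule mult_left_mono)
          show "13 * ?l \<le> 30 * (?l)^2"
            using l1 zero_le_power2[of "?l"] by linarith
        qed simp
        then have "exp (4 ^ K * (13 * ?l)) \<le> exp (4 ^ K * (30 * (?l)^2))" by simp
        then show ?thesis using cK unfolding True by linarith
      next
        case False
        have "\<Lambda> \<le> 30 * (?l)^2" using L zero_le_power2[of "?l"] by linarith
        then have "(4::real) ^ Suc k * \<Lambda> \<le> 4 ^ Suc k * (30 * (?l)^2)"
          by (intro mult_left_mono) auto
        then have "exp (4 ^ Suc k * \<Lambda>) \<le> exp (4 ^ Suc k * (30 * (?l)^2))" by (simp only: exp_le_cancel_iff)
        then show ?thesis using c0[OF False] by linarith
      qed
    qed auto
    also have "\<dots> = exp (4 ^ k * (140 * (?l)^2))" by (simp add: exp_add[symmetric] algebra_simps)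
    also have "\<dots> \<le> exp (4 ^ k * (200 * (?l)^2))" by simp
    finally show ?thesis .
  qed
  show ?thesis
    using K1 K3 pin inc pairs by (intro exI[of _ K] exI[of _ \<pi>]) (auto simp: \<pi>_def)
qed

subsection \<open>The partial circulant chaos\<close>

text \<open>For a net point \<open>y\<close> close to \<open>x\<close>, the quadratic form at \<open>x\<close> minus that at \<open>y\<close> is a quarter of the
  difference of its values at \<open>(5 x - 3 y) / 2 = 2 (x - y) + (x + y) / 2\<close> and at
  \<open>(3 x - 5 y) / 2\<close>. This is polarisation, weighted to profit from \<open>x - y\<close> being small.\<close>

lemma net_to_sparse:
  fixes a :: "nat \<Rightarrow> nat \<Rightarrow> complex" and \<theta> :: real
  assumes n: "n \<ge> 1" and s: "s \<ge> 1" and fO: "finite \<Omega>"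
    and net: "\<And>y. y \<in> net n s \<Longrightarrow> \<bar>(\<Sum>i\<in>\<Omega>. (cmod (\<Sum>k=1..n. a i k * y k))^2) - (\<Sum>k=1..n. (cmod (y k))^2)\<bar> \<le> \<theta>"
    and x: "sparse n s x"
  shows "\<bar>(\<Sum>i\<in>\<Omega>. (cmod (\<Sum>k=1..n. a i k * x k))^2) - (\<Sum>k=1..n. (cmod (x k))^2)\<bar> \<le> 3 * \<theta> * (\<Sum>k=1..n. (cmod (x k))^2)"
proof -
  define ns where "ns x = (\<Sum>k=1..n. (cmod (x k))^2)" for x :: "nat \<Rightarrow> complex"
  define \<Phi> where "\<Phi> x i = (\<Sum>k=1..n. a i k * x k)" for x i
  define h where "h x = (\<Sum>i\<in>\<Omega>. (cmod (\<Phi> x i))^2) - ns x" for x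
  \<comment> \<open>Absorbing \<open>5 / 8 * H\<close> later requires this supremum to be finite;
    the crude \<open>C\<close> serves only that purpose.\<close>
  define H where "H = (SUP x\<in>sparse_ball n s. \<bar>h x\<bar>)"
  have zero: "(\<lambda>_. 0) \<in> sparse_ball n s" using zero_in_net by (simp add: net_def)
  define C where "C = (\<Sum>i\<in>\<Omega>. (\<Sum>k=1..n. cmod (a i k))^2) + 1"
  have bound: "\<bar>h x\<bar> \<le> C" if "x \<in> sparse_ball n s" for x
  proof -
    have "cmod (\<Phi> x i) \<le> (\<Sum>k=1..n. cmod (a i k))" for i
      unfolding \<Phi>_def using sparse_ball_entry_le[OF that]
      by (intro sum_norm_le) (simp add: norm_mult mult_left_le)
    then have "(\<Sum>i\<in>\<Omega>. (cmod (\<Phi> x i))^2) \<le> (\<Sum>i\<in>\<Omega>. (\<Sum>k=1..n. cmod (a i k))^2)"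
      by (intro sum_mono power_mono) auto
    moreover have "0 \<le> ns x" "ns x \<le> 1" using that by (auto simp: ns_def sparse_ball_def sum_nonneg)
    moreover have "0 \<le> (\<Sum>i\<in>\<Omega>. (cmod (\<Phi> x i))^2)" by (intro sum_nonneg) auto
    ultimately show ?thesis unfolding h_def C_def by linarith
  qed
  have H: "\<bar>h x\<bar> \<le> H" if "x \<in> sparse_ball n s" for x
    unfolding H_def by (rule cSUP_upper[OF that]) (use bound in \<open>auto intro!: bdd_aboveI\<close>)
  have H0: "H \<ge> 0" using H[OF zero] by linarith
  have \<Phi>_scale: "\<Phi> (\<lambda>k. of_real c * z k) i = of_real c * \<Phi> z i" for c z i
    by (simp add: \<Phi>_def sum_distrib_left mult_ac)
  have ns_scale: "ns (\<lambda>k. of_real c * z k) = c^2 * ns z" for c z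
    by (simp add: ns_def norm_mult power_mult_distrib sum_distrib_left)
  have h_scale: "h (\<lambda>k. of_real c * z k) = c^2 * h z" for c z
    unfolding h_def \<Phi>_scale ns_scale by (simp add: norm_mult power_mult_distrib sum_distrib_left right_diff_distrib)
  have hH: "\<bar>h z\<bar> \<le> H * ns z" if z: "\<forall>k. k \<notin> {1..n} \<longrightarrow> z k = 0" "sparse n s z" for z
  proof (cases "ns z = 0")
    case True
    then have "\<forall>k\<in>{1..n}. z k = 0" by (simp add: ns_def sum_nonneg_eq_0_iff)
    then have "z = (\<lambda>_. 0)" using z(1) by blast
    then have "h z = 0" by (simp add: h_def \<Phi>_def ns_def)
    then show ?thesis using True by simp
  next
    case False
    then have pos: "ns z > 0" using sum_nonneg[of "{1..n}" "\<lambda>k. (cmod (z k))^2"] by (simp add: ns_def)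
    define c where "c = 1 / sqrt (ns z)"
    have c2: "c^2 = 1 / ns z" using pos by (simp add: c_def power_divide)
    have c0: "c \<noteq> 0" using pos by (simp add: c_def)
    have "(\<lambda>k. of_real c * z k) \<in> sparse_ball n s"
    proof -
      have "ns (\<lambda>k. of_real c * z k) \<le> 1" using pos unfolding ns_scale c2 by simp
      then show ?thesis using z c0 unfolding ns_def by (simp add: sparse_ball_def sparse_def)
    qed
    then have "\<bar>c^2 * h z\<bar> \<le> H" using H h_scale by metis
    then show ?thesis using pos by (simp add: c2 abs_mult field_simps)
  qed
  have step: "\<bar>h x\<bar> \<le> \<theta> + 5 / 8 * H" if x: "x \<in> sparse_ball n s" for x
  proof -
    obtain y where y: "y \<in> net n s" "ns (\<lambda>k. x k - y k) \<le> 1 / 16" "\<And>k. x k = 0 \<Longrightarrow> y k = 0"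
      using net_approx[OF s x] by (auto simp: ns_def)
    define u where "u k = (5 * x k - 3 * y k) / 2" for k
    define v where "v k = (3 * x k - 5 * y k) / 2" for k
    have id1: "(cmod ((5 * p - 3 * q) / 2))^2 - (cmod ((3 * p - 5 * q) / 2))^2 = 4 * ((cmod p)^2 - (cmod q)^2)" for p q :: complex
      unfolding cmod_power2 by (simp add: power2_eq_square field_simps)
    have id2: "(cmod ((5 * p - 3 * q) / 2))^2 + (cmod ((3 * p - 5 * q) / 2))^2 \<le> 8 * (cmod (p - q))^2 + (cmod p)^2 + (cmod q)^2" for p q :: complex
    proof -
      have "8 * (cmod (p - q))^2 + (cmod p)^2 + (cmod q)^2 - ((cmod ((5 * p - 3 * q) / 2))^2 + (cmod ((3 * p - 5 * q) / 2))^2)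
          = (cmod (p - q))^2 / 2"
        unfolding cmod_power2 by (simp add: power2_eq_square field_simps)
      then show ?thesis by (smt (verit) divide_nonneg_nonneg zero_le_power2)
    qed
    have pu: "\<Phi> u i = (5 * \<Phi> x i - 3 * \<Phi> y i) / 2" "\<Phi> v i = (3 * \<Phi> x i - 5 * \<Phi> y i) / 2" for i
      unfolding \<Phi>_def u_def v_def sum_distrib_left sum_subtractf[symmetric] sum_divide_distrib
      by (intro sum.cong refl; simp add: algebra_simps)+
    have "h u - h v = (\<Sum>i\<in>\<Omega>. (cmod (\<Phi> u i))^2 - (cmod (\<Phi> v i))^2) - (\<Sum>k=1..n. (cmod (u k))^2 - (cmod (v k))^2)"
      by (simp add: h_def ns_def sum_subtractf)
    also have "\<dots> = (\<Sum>i\<in>\<Omega>. 4 * ((cmod (\<Phi> x i))^2 - (cmod (\<Phi> y i))^2)) - (\<Sum>k=1..n. 4 * ((cmod (x k))^2 - (cmod (y k))^2))"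
      unfolding pu u_def v_def id1 ..
    also have "\<dots> = 4 * (h x - h y)"
      unfolding sum_distrib_left[symmetric] by (simp add: h_def ns_def sum_subtractf)
    finally have uv: "h u - h v = 4 * (h x - h y)" .
    have "{j \<in> {1..n}. u j \<noteq> 0} \<subseteq> {j \<in> {1..n}. x j \<noteq> 0}" "{j \<in> {1..n}. v j \<noteq> 0} \<subseteq> {j \<in> {1..n}. x j \<noteq> 0}"
      using y(3) by (auto simp: u_def v_def)
    then have "card {j \<in> {1..n}. u j \<noteq> 0} \<le> card {j \<in> {1..n}. x j \<noteq> 0}" "card {j \<in> {1..n}. v j \<noteq> 0} \<le> card {j \<in> {1..n}. x j \<noteq> 0}"
      by (auto intro: card_mono)
    then have su: "sparse n s u" "sparse n s v" using x by (auto simp: sparse_ball_def sparse_def)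
    have zu: "\<forall>k. k \<notin> {1..n} \<longrightarrow> u k = 0" "\<forall>k. k \<notin> {1..n} \<longrightarrow> v k = 0"
      using x y(1) by (auto simp: u_def v_def sparse_ball_def net_def)
    have "ns u + ns v \<le> (\<Sum>k=1..n. 8 * (cmod (x k - y k))^2 + (cmod (x k))^2 + (cmod (y k))^2)"
      unfolding ns_def sum.distrib[symmetric] u_def v_def by (intro sum_mono id2)
    also have "\<dots> = 8 * ns (\<lambda>k. x k - y k) + ns x + ns y" by (simp add: ns_def sum.distrib sum_distrib_left)
    \<comment> \<open>The total \<open>5 / 2\<close>, divided by the \<open>4\<close> of the
      polarisation identity, is the contraction factor \<open>5 / 8\<close>.\<close>
    also have "\<dots> \<le> 8 * (1 / 16) + 1 + 1"
      using y(1,2) x by (intro add_mono mult_left_mono) (auto simp: ns_def sparse_ball_def net_def)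
    finally have "H * (ns u + ns v) \<le> H * (5 / 2)" using H0 by (intro mult_left_mono) auto
    moreover have "\<bar>h u - h v\<bar> \<le> H * ns u + H * ns v" using hH[OF zu(1) su(1)] hH[OF zu(2) su(2)] by linarith
    ultimately have "\<bar>4 * (h x - h y)\<bar> \<le> H * (5 / 2)" unfolding uv by (simp add: distrib_left)
    then have "4 * \<bar>h x - h y\<bar> \<le> H * (5 / 2)" by (simp only: abs_mult abs_numeral)
    moreover have "\<bar>h y\<bar> \<le> \<theta>" using net[OF y(1)] by (simp add: h_def \<Phi>_def ns_def)
    moreover note abs_triangle_ineq2[of "h x" "h y"]
    moreover have gen: "c \<le> \<theta> + 5 / 8 * H" if "4 * a \<le> H * (5 / 2)" "b \<le> \<theta>" "c - b \<le> a" for a b c :: real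
      using that by (simp add: field_simps)
    ultimately show ?thesis by blast
  qed
  have "H \<le> \<theta> + 5 / 8 * H" unfolding H_def by (rule cSUP_least) (use zero step in \<open>auto simp: H_def\<close>)
  then have H3: "H \<le> 3 * \<theta>" using H0 by linarith
  \<comment> \<open>Entries outside \<open>{1..n}\<close> are arbitrary in the claim but must vanish
    in the ball, and neither side sees them.\<close>
  define x' where "x' k = (if k \<in> {1..n} then x k else 0)" for k
  have eq: "h x' = h x" "ns x' = ns x" by (simp_all add: h_def \<Phi>_def ns_def x'_def)
  have "{j \<in> {1..n}. x' j \<noteq> 0} = {j \<in> {1..n}. x j \<noteq> 0}" by (auto simp: x'_def)
  then have "sparse n s x'" using x by (simp add: sparse_def)
  then have "\<bar>h x\<bar> \<le> H * ns x" using hH[of x'] unfolding eq by (simp add: x'_def)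
  also have "\<dots> \<le> 3 * \<theta> * ns x" using H3 by (intro mult_right_mono) (auto simp: ns_def sum_nonneg)
  finally show ?thesis by (simp add: h_def \<Phi>_def ns_def)
qed

lemma inj_cyc_sub_left:
  assumes n: "n \<ge> 1" shows "inj_on (\<lambda>i. cyc_sub n i k) {1..n}"
proof (rule inj_onI)
  fix i i' assume i: "i \<in> {1..n}" "i' \<in> {1..n}" and e: "cyc_sub n i k = cyc_sub n i' k"
  have "(int i - int k) mod int n = (int i' - int k) mod int n"
    using cyc_sub_cong[OF n, of i k] cyc_sub_cong[OF n, of i' k] e by simp
  then have "int n dvd (int i - int k) - (int i' - int k)" by (simp only: mod_eq_dvd_iff)
  then have "int i mod int n = int i' mod int n" by (simp add: mod_eq_dvd_iff)
  then show "i = i'" by (rule cyc_sub_unique[OF n i])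
qed

text \<open>Centred squares are controlled only for \<open>\<bar>l\<bar> \<le> t0\<close>, the
  Bernstein range; the chaos uses the unrestricted bound inherited from
  \<open>subg_product\<close>.\<close>

locale circulant_setup = subg_product \<mu> "{1..n}" \<kappa> for \<mu> :: "nat \<Rightarrow> real measure" and n :: nat and \<kappa> :: real +
  fixes t0 :: real and m s :: nat and \<Omega> :: "nat set"
  assumes t0: "t0 > 0"
    and sq_integrable: "\<And>j l. j \<in> {1..n} \<Longrightarrow> \<bar>l\<bar> \<le> t0 \<Longrightarrow> integrable (\<mu> j) (\<lambda>x. exp (l * (x^2 - 1)))"
    and sq_le: "\<And>j l. j \<in> {1..n} \<Longrightarrow> \<bar>l\<bar> \<le> t0 \<Longrightarrow> (\<integral>x. exp (l * (x^2 - 1)) \<partial>\<mu> j) \<le> exp (\<kappa> * l^2)"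
    and Om: "\<Omega> \<subseteq> {1..n}" "card \<Omega> = m" and m1: "m \<ge> 1" and s2: "2 \<le> s" and sn: "s \<le> n"
begin

definition A :: "(nat \<Rightarrow> complex) \<Rightarrow> nat \<Rightarrow> nat \<Rightarrow> complex" where
  "A x i j = of_real (1 / sqrt (real m)) * x (cyc_sub n i j)"

text \<open>Column \<open>k\<close> of the matrix has squared norm
  \<open>1 + Dev k w / m\<close>.\<close>

definition Dev :: "nat \<Rightarrow> (nat \<Rightarrow> real) \<Rightarrow> real" where
  "Dev k w = (\<Sum>i\<in>\<Omega>. (w (cyc_sub n i k))^2 - 1)"

definition dev :: "(nat \<Rightarrow> real) \<Rightarrow> real" where
  "dev w = Max ((\<lambda>k. \<bar>Dev k w\<bar> / real m) ` {1..n})"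

lemma n1: "n \<ge> 1" using s2 sn by simp

lemma finO: "finite \<Omega>" using Om(1) finite_subset by blast

lemma finite_net: "finite (net n s)" "net n s \<noteq> {}"
  using net_finite_card(1)[OF n1] zero_in_net by auto

sublocale chaos \<mu> "{1..n}" \<kappa> "net n s" \<Omega> A
  by unfold_locales (use finite_net finO in auto)

section \<open>Exponential moments of the diagonal part\<close>

lemma Dev_mgf:
  assumes t: "\<bar>t\<bar> \<le> t0"
  shows "integrable PP (\<lambda>w. exp (t * Dev k w))" (is ?goal1) "(\<integral>w. exp (t * Dev k w) \<partial>PP) \<le> exp (\<kappa> * t^2 * real m)" (is ?goal2)
proof -
  define J where "J = (\<lambda>i. cyc_sub n i k) ` \<Omega>"
  have inj: "inj_on (\<lambda>i. cyc_sub n i k) \<Omega>" using inj_cyc_sub_left[OF n1] Om(1) inj_on_subset by blast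
  have J: "J \<subseteq> {1..n}" "card J = m" using cyc_sub_in[OF n1] inj Om(2) by (auto simp: J_def card_image)
  define f where "f j x = (if j \<in> J then exp (t * (x^2 - 1)) else 1)" for j and x :: real
  have fi: "integrable (\<mu> j) (f j)" if "j \<in> {1..n}" for j
    using sq_integrable[OF that t] by (cases "j \<in> J") (simp_all add: f_def[abs_def])
  have "exp (t * Dev k w) = (\<Prod>j\<in>{1..n}. f j (w j))" for w
  proof -
    have "Dev k w = (\<Sum>j\<in>J. (w j)^2 - 1)" unfolding Dev_def J_def by (simp add: sum.reindex[OF inj])
    then have "exp (t * Dev k w) = (\<Prod>j\<in>J. exp (t * ((w j)^2 - 1)))"
      using finO by (simp add: exp_sum[symmetric] sum_distrib_left J_def)
    also have "\<dots> = (\<Prod>j\<in>{1..n}. f j (w j))"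
      using J(1) by (intro prod.mono_neutral_cong_left) (auto simp: f_def)
    finally show ?thesis .
  qed
  then have eq: "(\<lambda>w. exp (t * Dev k w)) = (\<lambda>w. \<Prod>j\<in>{1..n}. f j (w j))" by blast
  show ?goal1
    unfolding eq by (intro product_integrable_prod fi) auto
  have "(\<integral>w. exp (t * Dev k w) \<partial>PP) = (\<Prod>j\<in>{1..n}. \<integral>x. f j x \<partial>\<mu> j)"
    unfolding eq by (intro product_integral_prod fi) auto
  also have "\<dots> \<le> (\<Prod>j\<in>{1..n}. if j \<in> J then exp (\<kappa> * t^2) else 1)"
  proof (rule prod_mono)
    fix j assume j: "j \<in> {1..n}"
    show "0 \<le> (\<integral>x. f j x \<partial>\<mu> j) \<and> (\<integral>x. f j x \<partial>\<mu> j) \<le> (if j \<in> J then exp (\<kappa> * t^2) else 1)"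
      using sq_le[OF j t] by (auto simp: f_def M.prob_space intro!: Bochner_Integration.integral_nonneg)
  qed
  also have "\<dots> = exp (\<kappa> * t^2) ^ m"
    using J by (simp add: prod.If_cases Int_absorb1)
  also have "\<dots> = exp (\<kappa> * t^2 * real m)" by (simp add: exp_of_nat_mult[symmetric] mult_ac)
  finally show ?goal2 .
qed

lemma Dev_measurable [measurable]: "Dev k \<in> borel_measurable PP"
proof -
  have "(\<lambda>w. w (cyc_sub n i k)) \<in> borel_measurable PP" for i
    using cyc_sub_in[OF n1] by (intro component_measurable) simp
  then show ?thesis unfolding Dev_def by measurable
qed

lemma dev_measurable [measurable]: "dev \<in> borel_measurable PP"
  unfolding dev_def by measurable

lemma dev_ge: "k \<in> {1..n} \<Longrightarrow> \<bar>Dev k w\<bar> \<le> real m * dev w"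
proof -
  assume "k \<in> {1..n}"
  then have "\<bar>Dev k w\<bar> / real m \<le> dev w" unfolding dev_def by (intro Max_ge) auto
  then show ?thesis using m1 by (simp add: divide_le_eq mult.commute)
qed

lemma dev_nonneg: "0 \<le> dev w"
proof -
  have "0 \<le> \<bar>Dev 1 w\<bar> / real m" by simp
  also have "\<dots> \<le> dev w" unfolding dev_def using n1 by (intro Max_ge) auto
  finally show ?thesis .
qed

text \<open>A union bound inside the expectation, over \<open>n\<close> columns and two signs. Each
  column involves \<open>m\<close> distinct variables, so independence applies to it, although
  different columns are dependent.\<close>

lemma dev_mgf:
  assumes t: "0 \<le> t" "t \<le> t0"
  shows "integrable PP (\<lambda>w. exp (t * (real m * dev w)))" (is ?goal1)
    "(\<integral>w. exp (t * (real m * dev w)) \<partial>PP) \<le> 2 * real n * exp (\<kappa> * t^2 * real m)" (is ?goal2)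
proof -
  let ?g = "\<lambda>w. \<Sum>k=1..n. exp (t * Dev k w) + exp ((-t) * Dev k w)"
  have le: "exp (t * (real m * dev w)) \<le> ?g w" for w
  proof -
    have "dev w \<in> (\<lambda>k. \<bar>Dev k w\<bar> / real m) ` {1..n}" unfolding dev_def using n1 by (intro Max_in) auto
    then obtain k where k: "k \<in> {1..n}" "real m * dev w = \<bar>Dev k w\<bar>" using m1 by auto
    have "exp (t * (real m * dev w)) \<le> exp (t * Dev k w) + exp ((-t) * Dev k w)"
      unfolding k(2) by (auto simp: abs_if)
    also have "\<dots> \<le> ?g w" using k(1) by (intro member_le_sum) auto
    finally show ?thesis .
  qed
  have tt: "\<bar>t\<bar> \<le> t0" "\<bar>-t\<bar> \<le> t0" using t by auto
  have i1: "integrable PP (\<lambda>w. exp (t * Dev k w) + exp ((-t) * Dev k w))" for k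
    by (intro Bochner_Integration.integrable_add Dev_mgf(1) tt)
  have gi: "integrable PP ?g" by (intro Bochner_Integration.integrable_sum i1)
  show i: ?goal1
  proof (rule Bochner_Integration.integrable_bound[OF gi])
    show "(\<lambda>w. exp (t * (real m * dev w))) \<in> borel_measurable PP" by measurable
    show "AE w in PP. norm (exp (t * (real m * dev w))) \<le> norm (?g w)"
      using order_trans[OF le abs_ge_self] by simp
  qed
  have "(\<integral>w. exp (t * (real m * dev w)) \<partial>PP) \<le> (\<integral>w. ?g w \<partial>PP)" by (intro integral_mono i gi le)
  also have "\<dots> = (\<Sum>k=1..n. (\<integral>w. exp (t * Dev k w) \<partial>PP) + (\<integral>w. exp ((-t) * Dev k w) \<partial>PP))"
    using Dev_mgf(1)[OF tt(1)] Dev_mgf(1)[OF tt(2)]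
    by (subst Bochner_Integration.integral_sum[OF i1]) (intro sum.cong refl Bochner_Integration.integral_add)
  also have "\<dots> \<le> (\<Sum>k=1..n. exp (\<kappa> * t^2 * real m) + exp (\<kappa> * (-t)^2 * real m))"
    by (intro sum_mono add_mono Dev_mgf(2) tt)
  also have "\<dots> = 2 * real n * exp (\<kappa> * t^2 * real m)" by simp
  finally show ?goal2 .
qed

lemma diag_eq:
  "(\<Sum>j=1..n. (w j)^2 * (\<Sum>i\<in>\<Omega>. (cmod (A x i j))^2)) = (\<Sum>k=1..n. (cmod (x k))^2 * (1 + Dev k w / real m))"
proof -
  have "(\<Sum>j=1..n. (w j)^2 * (\<Sum>i\<in>\<Omega>. (cmod (A x i j))^2)) = (\<Sum>i\<in>\<Omega>. \<Sum>j=1..n. (w j)^2 * (cmod (x (cyc_sub n i j)))^2 / real m)"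
    unfolding sum_distrib_left using m1
    by (subst sum.swap) (simp add: A_def norm_mult norm_divide power_mult_distrib power_divide)
  also have "\<dots> = (\<Sum>i\<in>\<Omega>. \<Sum>k=1..n. (w (cyc_sub n i k))^2 * (cmod (x k))^2 / real m)"
  proof (rule sum.cong[OF refl])
    fix i
    show "(\<Sum>j=1..n. (w j)^2 * (cmod (x (cyc_sub n i j)))^2 / real m) = (\<Sum>k=1..n. (w (cyc_sub n i k))^2 * (cmod (x k))^2 / real m)"
      by (rule sum_cyc_sub[OF n1, of "\<lambda>j k. (w j)^2 * (cmod (x k))^2 / real m"])
  qed
  also have "\<dots> = (\<Sum>k=1..n. \<Sum>i\<in>\<Omega>. (cmod (x k))^2 * ((w (cyc_sub n i k))^2 / real m))"
    by (subst sum.swap) (simp add: mult_ac)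
  also have "\<dots> = (\<Sum>k=1..n. (cmod (x k))^2 * (1 + Dev k w / real m))"
  proof (rule sum.cong[OF refl])
    fix k
    have "1 + Dev k w / real m = (\<Sum>i\<in>\<Omega>. (w (cyc_sub n i k))^2 / real m)"
      using m1 Om(2) by (simp add: Dev_def sum_subtractf sum_divide_distrib[symmetric] diff_divide_distrib)
    then show "(\<Sum>i\<in>\<Omega>. (cmod (x k))^2 * ((w (cyc_sub n i k))^2 / real m)) = (cmod (x k))^2 * (1 + Dev k w / real m)"
      by (simp only: sum_distrib_left)
  qed
  finally show ?thesis .
qed

lemma diag_dev_le:
  assumes "(\<Sum>k=1..n. (cmod (x k))^2) \<le> 1"
  shows "\<bar>(\<Sum>j=1..n. (w j)^2 * (\<Sum>i\<in>\<Omega>. (cmod (A x i j))^2)) - (\<Sum>k=1..n. (cmod (x k))^2)\<bar> \<le> dev w"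
proof -
  have "(\<Sum>j=1..n. (w j)^2 * (\<Sum>i\<in>\<Omega>. (cmod (A x i j))^2)) - (\<Sum>k=1..n. (cmod (x k))^2)
      = (\<Sum>k=1..n. (cmod (x k))^2 * (Dev k w / real m))"
    unfolding diag_eq by (simp add: distrib_left sum.distrib)
  also have "\<bar>\<dots>\<bar> \<le> (\<Sum>k=1..n. \<bar>(cmod (x k))^2 * (Dev k w / real m)\<bar>)" by (rule sum_abs)
  also have "\<dots> \<le> (\<Sum>k=1..n. (cmod (x k))^2 * dev w)"
  proof (rule sum_mono)
    fix k assume "k \<in> {1..n}"
    then have "\<bar>Dev k w\<bar> / real m \<le> dev w" using dev_ge m1 by (simp add: divide_le_eq mult.commute)
    then show "\<bar>(cmod (x k))^2 * (Dev k w / real m)\<bar> \<le> (cmod (x k))^2 * dev w"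
      using mult_left_mono[of "\<bar>Dev k w\<bar> / real m" "dev w" "(cmod (x k))^2"] by (simp add: abs_mult)
  qed
  also have "\<dots> = (\<Sum>k=1..n. (cmod (x k))^2) * dev w" by (rule sum_distrib_right[symmetric])
  also have "\<dots> \<le> 1 * dev w" using assms dev_nonneg by (rule mult_right_mono)
  finally show ?thesis by simp
qed

lemma D_le: "D w \<le> 1 + dev w"
  unfolding D_def
proof (rule Max_le_T)
  fix x assume "x \<in> net n s"
  then have "(\<Sum>k=1..n. (cmod (x k))^2) \<le> 1" by (simp add: net_def sparse_ball_def)
  then show "(\<Sum>j\<in>{1..n}. (w j)^2 * (\<Sum>i\<in>\<Omega>. (cmod (A x i j))^2)) \<le> 1 + dev w"
    using diag_dev_le[of x w] by linarith
qed

text \<open>With \<open>t = p / m\<close> one has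
  \<open>(1 + dev)^p \<le> exp (p * dev) = exp (t * m * dev)\<close>. The union bound factor
  \<open>2 * n\<close> is at most \<open>exp p\<close>, so it only changes the base of the moment
  bound.\<close>

lemma D_moment:
  assumes p: "real p \<ge> ln (2 * real n)" "real p \<le> real m" "real p \<le> t0 * real m"
  shows "integrable PP (\<lambda>w. D w ^ p)" (is ?goal1) "(\<integral>w. D w ^ p \<partial>PP) \<le> exp (1 + \<kappa>) ^ p" (is ?goal2)
proof -
  define t where "t = real p / real m"
  have t: "0 \<le> t" "t \<le> t0" "t * real m = real p" using p m1 by (auto simp: t_def divide_le_eq)
  have le: "D w ^ p \<le> exp (t * (real m * dev w))" for w
  proof -
    have "D w \<le> exp (dev w)" using D_le[of w] exp_ge_add_one_self[of "dev w"] by linarith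
    then have "D w ^ p \<le> exp (dev w) ^ p" using D_nonneg by (rule power_mono)
    then show ?thesis by (simp add: exp_of_nat_mult[symmetric] t(3) mult.assoc[symmetric])
  qed
  show i: ?goal1
  proof (rule Bochner_Integration.integrable_bound[OF dev_mgf(1)[OF t(1,2)]])
    show "(\<lambda>w. D w ^ p) \<in> borel_measurable PP" by measurable
    show "AE w in PP. norm (D w ^ p) \<le> norm (exp (t * (real m * dev w)))"
      using le D_nonneg by (simp add: power_abs)
  qed
  have "(\<integral>w. D w ^ p \<partial>PP) \<le> (\<integral>w. exp (t * (real m * dev w)) \<partial>PP)"
    by (intro integral_mono i dev_mgf(1) t le)
  also have "\<dots> \<le> 2 * real n * exp (\<kappa> * t^2 * real m)" by (rule dev_mgf(2)[OF t(1,2)])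
  also have "\<dots> \<le> exp (real p) * exp (\<kappa> * real p)"
  proof (intro mult_mono)
    show "2 * real n \<le> exp (real p)" using p(1) n1 by (metis exp_le_cancel_iff exp_ln of_nat_0_less_iff less_le_trans zero_less_one mult_pos_pos zero_less_numeral)
    have "t \<le> 1" using p(2) m1 by (simp add: t_def divide_le_eq)
    then have "t * real p \<le> 1 * real p" by (rule mult_right_mono) simp
    then have "\<kappa> * (t * real p) \<le> \<kappa> * real p" using kappa_pos by simp
    moreover have "\<kappa> * t^2 * real m = \<kappa> * (t * real p)" by (simp add: t(3)[symmetric] power2_eq_square)
    ultimately show "exp (\<kappa> * t^2 * real m) \<le> exp (\<kappa> * real p)" by (simp only: exp_le_cancel_iff)
  qed auto
  also have "\<dots> = exp (1 + \<kappa>) ^ p" by (simp add: exp_of_nat_mult[symmetric] exp_add[symmetric] algebra_simps)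
  finally show ?goal2 .
qed

lemma quadratic_le:
  assumes "x \<in> net n s"
  shows "\<bar>(\<Sum>i\<in>\<Omega>. (cmod (\<Sum>k=1..n. (of_real (1 / sqrt (real m)) * of_real (w (cyc_sub n i k))) * x k))^2) - (\<Sum>k=1..n. (cmod (x k))^2)\<bar>
    \<le> dev w + S {1..n} w"
proof -
  have Ye: "Y x {1..n} w i = (\<Sum>k=1..n. (of_real (1 / sqrt (real m)) * of_real (w (cyc_sub n i k))) * x k)" for i
    unfolding Y_def A_def
    using sum_cyc_sub[OF n1, of "\<lambda>j k. of_real (w j) * (of_real (1 / sqrt (real m)) * x k)" i]
    by (simp add: mult_ac)
  have b: "(\<Sum>k=1..n. (cmod (x k))^2) \<le> 1" using assms by (simp add: net_def sparse_ball_def)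
  have "(\<Sum>i\<in>\<Omega>. (cmod (Y x {1..n} w i))^2)
    = (\<Sum>j\<in>{1..n}. (w j)^2 * (\<Sum>i\<in>\<Omega>. (cmod (A x i j))^2)) + Re (off x {1..n} w)"
    using arg_cong[OF norm_square_expand[of "{1..n}" x w], of Re] by simp
  moreover have "\<bar>Re (off x {1..n} w)\<bar> \<le> S {1..n} w"
    using abs_Re_le_cmod[of "off x {1..n} w"] Max_ge_T[OF assms, of "\<lambda>t. cmod (off t {1..n} w)"] by (simp add: S_def)
  ultimately show ?thesis using diag_dev_le[OF b, of w] unfolding Ye by linarith
qed

section \<open>Tail bounds for the diagonal part and the chaos\<close>

definition tail_rate :: real where "tail_rate = min t0 (1 / (16 * \<kappa>))"

text \<open>\<open>2304 = 48 * 48\<close>: one factor is the radius constant of the chain, the other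
  bounds the sum over scales.\<close>

definition chain_const :: real where "chain_const = 2304 * sqrt (300 * \<kappa>)"

lemma dev_tail:
  assumes eta: "0 < \<eta>" and d: "0 < \<delta>" "\<delta> \<le> 1"
    and m: "16 * (ln (4 * real n) + ln (1 / \<eta>)) \<le> tail_rate * (real m * \<delta>^2)"
  shows "measure PP {w \<in> space PP. dev w \<ge> \<delta> / 8} \<le> \<eta> / 2"
proof -
  have t1: "0 < tail_rate" "tail_rate \<le> t0" "tail_rate \<le> 1 / (16 * \<kappa>)"
    using t0 kappa_pos by (auto simp: tail_rate_def)
  have tk: "\<kappa> * tail_rate \<le> 1 / 16" using t1(3) kappa_pos by (simp add: field_simps)
  \<comment> \<open>With this \<open>t\<close> and \<open>\<kappa> * tail_rate \<le> 1 / 16\<close>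
    the variance term is at most half of the linear term
    \<open>t * m * \<delta> / 8\<close>.\<close>
  define t where "t = \<delta> * tail_rate"
  have "\<delta> * tail_rate \<le> 1 * tail_rate" using d t1 by (intro mult_right_mono) auto
  then have t: "0 \<le> t" "t \<le> t0" using d t1(1,2) order_trans[of "\<delta> * tail_rate" tail_rate t0] by (auto simp: t_def)
  let ?u = "\<lambda>w. exp (t * (real m * dev w))"
  have "measure PP {w \<in> space PP. dev w \<ge> \<delta> / 8} \<le> measure PP {w \<in> space PP. ?u w \<ge> exp (t * (real m * (\<delta> / 8)))}"
  proof (rule P.finite_measure_mono)
    show "{w \<in> space PP. dev w \<ge> \<delta> / 8} \<subseteq> {w \<in> space PP. ?u w \<ge> exp (t * (real m * (\<delta> / 8)))}"
    proof -
      have "exp (t * (real m * (\<delta> / 8))) \<le> ?u w" if "\<delta> / 8 \<le> dev w" for w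
        unfolding exp_le_cancel_iff using that t by (intro mult_left_mono) auto
      then show ?thesis by blast
    qed
    show "{w \<in> space PP. ?u w \<ge> exp (t * (real m * (\<delta> / 8)))} \<in> sets PP" by measurable
  qed
  also have "\<dots> \<le> (\<integral>w. ?u w \<partial>PP) / exp (t * (real m * (\<delta> / 8)))"
    by (rule integral_Markov_inequality_measure[OF dev_mgf(1)[OF t] sets.empty_sets]) auto
  also have "\<dots> \<le> 2 * real n * exp (\<kappa> * t^2 * real m) / exp (t * (real m * (\<delta> / 8)))"
    by (intro divide_right_mono dev_mgf(2) t) auto
  also have "\<dots> = 2 * real n * exp (\<kappa> * t^2 * real m - t * (real m * (\<delta> / 8)))" by (simp add: exp_diff)
  also have "\<dots> \<le> 2 * real n * exp (- (ln (4 * real n) + ln (1 / \<eta>)))"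
  proof -
    define z where "z = tail_rate * (real m * \<delta>^2)"
    have z: "z \<ge> 0" using t1 by (simp add: z_def)
    have "\<kappa> * t^2 * real m = (\<kappa> * tail_rate) * z" by (simp add: t_def z_def power2_eq_square mult_ac)
    also have "\<dots> \<le> 1 / 16 * z" using tk z by (rule mult_right_mono)
    finally have "\<kappa> * t^2 * real m \<le> z / 16" by simp
    moreover have "t * (real m * (\<delta> / 8)) = z / 8" by (simp add: t_def z_def power2_eq_square)
    ultimately have "\<kappa> * t^2 * real m - t * (real m * (\<delta> / 8)) \<le> - (z / 16)" by linarith
    also have "\<dots> \<le> - (ln (4 * real n) + ln (1 / \<eta>))" using m by (simp add: z_def)
    finally show ?thesis using n1 by (intro mult_left_mono) auto
  qed
  also have "\<dots> = \<eta> / 2"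
    using n1 eta by (simp add: exp_add exp_diff ln_div exp_minus field_simps)
  finally show ?thesis .
qed

text \<open>The condition on \<open>Q\<close> brings \<open>\<Gamma>\<close> so far below
  \<open>\<delta>\<close> that the moment base is \<open>\<delta> / 24\<close>; Markov at level
  \<open>\<delta> / 8\<close> then leaves \<open>3^-p\<close>, which is at most
  \<open>exp (- p)\<close>.\<close>

lemma S_tail:
  assumes p1: "p \<ge> 1" and p2: "(ln (real s) * ln (real n))^2 \<le> real p" and p3: "ln (2 * real n) \<le> real p"
    and d: "0 < \<delta>" "\<delta> \<le> 1" and Q: "Q * real (s * p) \<le> real m * \<delta>^2"
    and Q1: "Q \<ge> (3840 * exp (1 + \<kappa>) * chain_const)^2" "Q \<ge> 1" "Q * t0 \<ge> 1"
  shows "measure PP {w \<in> space PP. S {1..n} w \<ge> \<delta> / 8} \<le> exp (- real p)"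
proof -
  let ?l = "ln (real n)"
  define B where "B = exp (1 + \<kappa>)"
  have B1: "B \<ge> 1" using kappa_pos by (simp add: B_def)
  have cc: "chain_const > 0" using kappa_pos by (simp add: chain_const_def)
  have d2: "\<delta>^2 \<le> 1" using d by (simp add: power_le_one)
  have psp: "p \<le> s * p" "1 \<le> s * p" using s2 p1 by auto
  have sp: "real p \<le> real (s * p)" using psp(1) by (simp only: of_nat_le_iff)
  have sp1: "1 \<le> real (s * p)" using psp(2) by (metis of_nat_1 of_nat_le_iff)
  have "Q * real (s * p) \<le> real m"
    using order_trans[OF Q mult_left_mono[OF d2, of "real m"]] by simp
  moreover have "1 * real p \<le> Q * real (s * p)" by (rule mult_mono[OF Q1(2) sp]) (use Q1(2) in auto)
  ultimately have pm: "real p \<le> real m" by linarith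
  have pt: "real p \<le> t0 * real m"
  proof -
    have "1 * real p \<le> (Q * t0) * real (s * p)"
      by (rule mult_mono[OF Q1(3) sp]) (use Q1(3) in linarith, simp)
    also have "\<dots> = t0 * (Q * real (s * p))" by (simp add: mult_ac)
    also have "\<dots> \<le> t0 * real m" using \<open>Q * real (s * p) \<le> real m\<close> t0 by (intro mult_left_mono) auto
    finally show ?thesis by simp
  qed
  from chain_exists[OF s2 sn] obtain K \<pi> where K: "K \<ge> 1" "real K \<le> 3 * ln (real s)"
    and q1: "\<forall>k\<le>K. \<forall>x\<in>net n s. \<pi> k x \<in> net n s"
    and q2: "\<forall>x\<in>net n s. \<pi> K x = x \<and> \<pi> 0 x = (\<lambda>_. 0)"
    and q3: "\<forall>k<K. \<forall>x\<in>net n s. \<forall>l<n. cmod (dft n (\<lambda>j. \<pi> (Suc k) x j - \<pi> k x j) l) \<le> 48 * sqrt (real s) / 2 ^ k"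
    and q4: "\<forall>k<K. real (card ((\<lambda>x. (\<pi> (Suc k) x, \<pi> k x)) ` net n s)) \<le> exp (4 ^ k * (200 * (?l)^2))"
    by (elim exE conjE)
  note pi1 = q1[rule_format] and pi2 = q2[rule_format, THEN conjunct1] q2[rule_format, THEN conjunct2]
    and pi3 = q3[rule_format] and pi4 = q4[rule_format]
  define d' where "d' k = 48 * sqrt (real s) / 2 ^ k / sqrt (real m)" for k :: nat
  \<comment> \<open>Adding \<open>p\<close> secures \<open>p \<le> r k\<close>; the rest is the
    entropy of level \<open>k\<close>.\<close>
  define r where "r k = p + nat \<lceil>4 ^ k * (200 * (?l)^2)\<rceil>" for k :: nat
  have r_ge: "real (r k) \<ge> 4 ^ k * (200 * (?l)^2)" for k
    unfolding r_def by (simp add: of_nat_add) linarith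
  have r_le: "real (r k) \<le> 2 * real p + 4 ^ k * (200 * (?l)^2)" for k
  proof -
    have p': "real p \<ge> 1" using p1 by simp
    have "real (nat \<lceil>4 ^ k * (200 * (?l)^2)\<rceil>) \<le> 4 ^ k * (200 * (?l)^2) + 1"
    proof -
      have "real (nat \<lceil>x\<rceil>) \<le> x + 1" if "x \<ge> 0" for x :: real
        using that of_int_ceiling_le_add_one[of x] by simp
      then show ?thesis by simp
    qed
    then show ?thesis using p' unfolding r_def of_nat_add by linarith
  qed
  interpret C: chaos_chain \<mu> "{1..n}" \<kappa> "net n s" \<Omega> A K \<pi> d' r p
  proof unfold_locales
    show "K \<ge> 1" "p \<ge> 1" by fact+
    show "\<pi> k t \<in> net n s" if "k \<le> K" "t \<in> net n s" for k t using pi1 that by blast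
    show "\<pi> K t = t" if "t \<in> net n s" for t using pi2 that by blast
    show "A (\<pi> 0 t) i j = 0" if "t \<in> net n s" for t i j using pi2(2)[OF that] by (simp add: A_def)
    show "d' k > 0" if "k < K" for k using s2 m1 by (simp add: d'_def)
    show "real (card ((\<lambda>t. (\<pi> (Suc k) t, \<pi> k t)) ` net n s)) \<le> exp (real (r k))" if "k < K" for k
      using pi4[OF that] r_ge[of k] by (meson exp_le_cancel_iff order_trans)
    show "p \<le> r k" if "k < K" for k by (simp add: r_def)
    show "(\<Sum>j\<in>{1..n}. (cmod (\<Sum>i\<in>\<Omega>. cnj (A (\<pi> (Suc k) t) i j - A (\<pi> k t) i j) * z i))^2) \<le> (d' k)^2 * (\<Sum>i\<in>\<Omega>. (cmod (z i))^2)"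
      if k: "k < K" and t: "t \<in> net n s" for k t z
    proof -
      define b where "b j = \<pi> (Suc k) t j - \<pi> k t j" for j
      have "(cmod (\<Sum>i\<in>\<Omega>. cnj (A (\<pi> (Suc k) t) i j - A (\<pi> k t) i j) * z i))^2
          = 1 / real m * (cmod (\<Sum>i\<in>\<Omega>. cnj (b (cyc_sub n i j)) * z i))^2" for j
      proof -
        have "(\<Sum>i\<in>\<Omega>. cnj (A (\<pi> (Suc k) t) i j - A (\<pi> k t) i j) * z i)
            = of_real (1 / sqrt (real m)) * (\<Sum>i\<in>\<Omega>. cnj (b (cyc_sub n i j)) * z i)"
          unfolding sum_distrib_left by (intro sum.cong refl) (simp add: A_def b_def diff_divide_distrib algebra_simps)
        then show ?thesis by (simp add: norm_mult norm_divide power_mult_distrib power_divide)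
      qed
      then have "(\<Sum>j\<in>{1..n}. (cmod (\<Sum>i\<in>\<Omega>. cnj (A (\<pi> (Suc k) t) i j - A (\<pi> k t) i j) * z i))^2)
          = 1 / real m * (\<Sum>j=1..n. (cmod (\<Sum>i\<in>\<Omega>. cnj (b (cyc_sub n i j)) * z i))^2)"
        by (simp only: sum_distrib_left)
      also have "\<dots> \<le> 1 / real m * ((48 * sqrt (real s) / 2 ^ k)^2 * (\<Sum>i\<in>\<Omega>. (cmod (z i))^2))"
        using pi3[OF k t] by (intro mult_left_mono convolution_bound n1 Om(1)) (auto simp: b_def)
      also have "\<dots> = (d' k)^2 * (\<Sum>i\<in>\<Omega>. (cmod (z i))^2)" by (simp add: d'_def power_divide power_mult_distrib)
      finally show ?thesis .
    qed
  qed
  define g where "g = sqrt (real (s * p) / real m)"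
  have lnn: "?l \<ge> 0" "ln (real s) \<ge> 0" using n1 s2 by auto
  \<comment> \<open>The \<open>2 ^ k\<close> in the root of the entropy cancels the
    \<open>2 ^ k\<close> in the radius, so each scale contributes \<open>15 * ln n\<close> (as
    \<open>200 \<le> 15^2\<close>); the part from \<open>p\<close> is a geometric series.\<close>
  have Gam: "C.\<Gamma> \<le> chain_const * g"
  proof -
    let ?c = "48 * sqrt (real s) / sqrt (real m) * sqrt (300 * \<kappa>)"
    have one: "d' k * C.\<rho> k \<le> ?c * (sqrt (2 * real p) * (1 / 2) ^ k + 15 * ?l)" for k
    proof -
      have "C.\<rho> k \<le> sqrt (300 * \<kappa> * (2 * real p + 4 ^ k * (200 * (?l)^2)))"
        unfolding C.\<rho>_def using r_le kappa_pos by (intro real_sqrt_le_mono mult_left_mono) auto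
      also have "\<dots> = sqrt (300 * \<kappa>) * sqrt (2 * real p + 4 ^ k * (200 * (?l)^2))" by (simp add: real_sqrt_mult)
      also have "\<dots> \<le> sqrt (300 * \<kappa>) * (sqrt (2 * real p) + 2 ^ k * (15 * ?l))"
      proof (rule mult_left_mono)
        have "sqrt (4 ^ k * (200 * (?l)^2)) \<le> 2 ^ k * (15 * ?l)"
        proof (rule real_le_lsqrt)
          have "(2 ^ k * (15 * ?l))^2 = 4 ^ k * (225 * (?l)^2)"
            by (simp add: power_mult_distrib power_mult[symmetric] mult.commute[of k] power_mult)
          then show "4 ^ k * (200 * (?l)^2) \<le> (2 ^ k * (15 * ?l))^2" by simp
        qed (use lnn in auto)
        then show "sqrt (2 * real p + 4 ^ k * (200 * (?l)^2)) \<le> sqrt (2 * real p) + 2 ^ k * (15 * ?l)"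
          using sqrt_add_le_add_sqrt[of "2 * real p" "4 ^ k * (200 * (?l)^2)"] by simp
      qed (use kappa_pos in auto)
      finally have "d' k * C.\<rho> k \<le> d' k * (sqrt (300 * \<kappa>) * (sqrt (2 * real p) + 2 ^ k * (15 * ?l)))"
        by (rule mult_left_mono) (simp add: d'_def)
      also have "\<dots> = ?c * ((sqrt (2 * real p) + 2 ^ k * (15 * ?l)) / 2 ^ k)"
        by (simp add: d'_def mult_ac)
      also have "(sqrt (2 * real p) + 2 ^ k * (15 * ?l)) / 2 ^ k = sqrt (2 * real p) * (1 / 2) ^ k + 15 * ?l"
        by (simp add: add_divide_distrib power_divide)
      finally show ?thesis .
    qed
    have geo: "(\<Sum>k<K. (1 / 2 :: real) ^ k) \<le> 2"
      using sum_gp_strict[of "1 / 2 :: real" K] by simp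
    have sp15: "sqrt (2 * real p) \<le> 3 / 2 * sqrt (real p)"
    proof -
      have "sqrt (2 * real p) \<le> sqrt ((3 / 2)^2 * real p)" by (rule real_sqrt_le_mono) (simp add: power2_eq_square)
      also have "\<dots> = 3 / 2 * sqrt (real p)" by (simp only: real_sqrt_mult real_sqrt_abs)
      finally show ?thesis .
    qed
    have lp: "ln (real s) * ?l \<le> sqrt (real p)" using p2 by (rule real_le_rsqrt)
    have "(\<Sum>k<K. sqrt (2 * real p) * (1 / 2) ^ k + 15 * ?l) = sqrt (2 * real p) * (\<Sum>k<K. (1 / 2) ^ k) + real K * (15 * ?l)"
      by (simp add: sum.distrib sum_distrib_left)
    \<comment> \<open>\<open>K \<le> 3 * ln s\<close> and \<open>ln s * ln n \<le> sqrt p\<close>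
      turn the second summand into \<open>45 * sqrt p\<close>; this is where the squared logarithms
      in the lower bound on \<open>p\<close> are spent.\<close>
    also have "\<dots> \<le> (3 / 2 * sqrt (real p)) * 2 + (3 * ln (real s)) * (15 * ?l)"
      using sp15 geo K(2) lnn by (intro add_mono mult_mono sum_nonneg) auto
    also have "\<dots> \<le> 48 * sqrt (real p)" using lp by simp
    finally have tot: "(\<Sum>k<K. sqrt (2 * real p) * (1 / 2) ^ k + 15 * ?l) \<le> 48 * sqrt (real p)" .
    have "C.\<Gamma> \<le> (\<Sum>k<K. ?c * (sqrt (2 * real p) * (1 / 2) ^ k + 15 * ?l))"
      unfolding C.\<Gamma>_def by (intro sum_mono one)
    also have "\<dots> = ?c * (\<Sum>k<K. sqrt (2 * real p) * (1 / 2) ^ k + 15 * ?l)"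
      by (rule sum_distrib_left[symmetric])
    also have "\<dots> \<le> ?c * (48 * sqrt (real p))"
      using tot kappa_pos by (intro mult_left_mono) auto
    also have "\<dots> = chain_const * g" by (simp add: chain_const_def g_def real_sqrt_mult real_sqrt_divide)
    finally show ?thesis .
  qed
  \<comment> \<open>\<open>3840 = 160 * 24\<close>, with \<open>160\<close> from the moment bound of
    the chaos.\<close>
  have Gd: "3840 * B * C.\<Gamma> \<le> \<delta>"
  proof -
    define c where "c = 3840 * B * chain_const"
    have c0: "c \<ge> 0" using B1 cc by (simp add: c_def)
    have "c^2 * real (s * p) \<le> Q * real (s * p)" using Q1(1) by (intro mult_right_mono) (auto simp: c_def B_def)
    then have "c^2 * real (s * p) \<le> real m * \<delta>^2" using Q by linarith
    then have "c^2 * (real (s * p) / real m) \<le> \<delta>^2" using m1 by (simp add: field_simps)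
    then have "sqrt (c^2 * (real (s * p) / real m)) \<le> sqrt (\<delta>^2)" by (rule real_sqrt_le_mono)
    then have "c * g \<le> \<delta>" using c0 d by (simp only: real_sqrt_mult g_def real_sqrt_abs abs_of_nonneg abs_of_pos)
    moreover have "3840 * B * C.\<Gamma> \<le> 3840 * B * (chain_const * g)" using Gam B1 by (intro mult_left_mono) auto
    ultimately show ?thesis by (simp add: c_def mult.assoc)
  qed
  have G16: "C.\<Gamma> \<le> 1 / 16"
  proof -
    have "1 * C.\<Gamma> \<le> B * C.\<Gamma>" using B1 C.Gamma_pos by (intro mult_right_mono) auto
    then show ?thesis using Gd d by linarith
  qed
  have "(\<integral>w. S {1..n} w ^ p \<partial>PP) \<le> (160 * C.\<Gamma> * B) ^ p"
    using C.chaos_moment[OF D_moment(1)[OF p3 pm pt] D_moment(2)[OF p3 pm pt]] B1 G16 by (simp add: B_def)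
  also have "\<dots> \<le> (\<delta> / 24) ^ p" using Gd B1 C.Gamma_pos by (intro power_mono) (auto simp: mult_ac)
  finally have mom: "(\<integral>w. S {1..n} w ^ p \<partial>PP) \<le> (\<delta> / 24) ^ p" .
  have "measure PP {w \<in> space PP. S {1..n} w \<ge> \<delta> / 8} \<le> measure PP {w \<in> space PP. S {1..n} w ^ p \<ge> (\<delta> / 8) ^ p}"
  proof (rule P.finite_measure_mono)
    show "{w \<in> space PP. S {1..n} w \<ge> \<delta> / 8} \<subseteq> {w \<in> space PP. S {1..n} w ^ p \<ge> (\<delta> / 8) ^ p}"
      using d by (auto intro!: power_mono)
    show "{w \<in> space PP. S {1..n} w ^ p \<ge> (\<delta> / 8) ^ p} \<in> sets PP"
    proof -
      note [measurable] = S_measurable[OF order_refl]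
      show ?thesis by measurable
    qed
  qed
  also have "\<dots> \<le> (\<integral>w. S {1..n} w ^ p \<partial>PP) / (\<delta> / 8) ^ p"
    by (rule integral_Markov_inequality_measure[OF S_power_integrable sets.empty_sets])
      (use p1 d S_nonneg in auto)
  also have "\<dots> \<le> (\<delta> / 24) ^ p / (\<delta> / 8) ^ p" using mom d by (intro divide_right_mono) auto
  also have "\<dots> = ((\<delta> / 24) / (\<delta> / 8)) ^ p" by (simp only: power_divide)
  also have "(\<delta> / 24) / (\<delta> / 8) = 1 / 3" using d by simp
  also have "(1 / 3 :: real) ^ p \<le> exp (- 1) ^ p"
    by (intro power_mono) (use exp_le in \<open>auto simp: exp_minus field_simps\<close>)
  also have "\<dots> = exp (- real p)" by (simp add: exp_of_nat_mult[symmetric])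
  finally show ?thesis .
qed

text \<open>Each of the two parts receives half of \<open>\<delta> / 4\<close> and half of
  \<open>\<eta>\<close>. The term \<open>ln (4 * n)\<close> in \<open>p\<close> pays for the union
  over columns and supplies the \<open>ln 2\<close> of the halving.\<close>

lemma bad_event:
  assumes p1: "p \<ge> 1" and p2: "(ln (real s) * ln (real n))^2 \<le> real p" and p3: "ln (4 * real n) + ln (1 / \<eta>) \<le> real p"
    and eta: "0 < \<eta>" "\<eta> < 1" and d: "0 < \<delta>" "\<delta> \<le> 1" and Q: "Q * real (s * p) \<le> real m * \<delta>^2"
    and Q1: "Q \<ge> (3840 * exp (1 + \<kappa>) * chain_const)^2" "Q \<ge> 1" "Q * t0 \<ge> 1" "Q * tail_rate \<ge> 16"
  shows "measure PP {w \<in> space PP. dev w + S {1..n} w > \<delta> / 4} \<le> \<eta>"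
proof -
  let ?d = "{w \<in> space PP. dev w \<ge> \<delta> / 8}" and ?S = "{w \<in> space PP. S {1..n} w \<ge> \<delta> / 8}"
  have le: "ln (1 / \<eta>) > 0" using eta by simp
  have l24: "ln (2 * real n) \<le> ln (4 * real n)" "ln (4 * real n) \<ge> ln 2" using n1 by auto
  have tr: "tail_rate > 0" using t0 kappa_pos by (simp add: tail_rate_def)
  have "p \<le> s * p" using s2 by simp
  then have "real p \<le> real (s * p)" by (simp only: of_nat_le_iff)
  then have "16 * real p \<le> (Q * tail_rate) * real (s * p)"
    using Q1(4) by (intro mult_mono) auto
  also have "\<dots> = tail_rate * (Q * real (s * p))" by (simp add: mult_ac)
  also have "\<dots> \<le> tail_rate * (real m * \<delta>^2)" using tr Q by (intro mult_left_mono) auto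
  finally have "16 * (ln (4 * real n) + ln (1 / \<eta>)) \<le> tail_rate * (real m * \<delta>^2)"
    using order_trans[OF mult_left_mono[OF p3, of 16]] by simp
  then have b1: "measure PP ?d \<le> \<eta> / 2" by (rule dev_tail[OF eta(1) d])
  have "ln (2 * real n) \<le> real p" using p3 le l24 by linarith
  then have "measure PP ?S \<le> exp (- real p)"
    by (rule S_tail[OF p1 p2 _ d Q Q1(1-3)])
  also have "\<dots> \<le> exp (- (ln 2 + ln (1 / \<eta>)))" using p3 l24 by simp
  also have "\<dots> = \<eta> / 2" using eta by (simp add: exp_diff ln_div exp_minus field_simps)
  finally have b2: "measure PP ?S \<le> \<eta> / 2" .
  have "measure PP {w \<in> space PP. dev w + S {1..n} w > \<delta> / 4}
      \<le> measure PP (?d \<union> ?S)"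
  proof (rule P.finite_measure_mono)
    show "?d \<union> ?S \<in> sets PP"
      using S_measurable[OF order_refl] by measurable
  qed auto
  also have "\<dots> \<le> measure PP ?d + measure PP ?S"
    by (rule measure_Un_le) (use S_measurable[OF order_refl] in measurable)
  also have "\<dots> \<le> \<eta>" using b1 b2 by linarith
  finally show ?thesis .
qed

end

subsection \<open>The restricted isometry constant\<close>

lemma sum_restrict_to:
  assumes "finite \<Omega>" "card \<Omega> = m"
  shows "(\<Sum>i=1..m. f (restrict_to \<Omega> g i)) = (\<Sum>i\<in>\<Omega>. f (g i))"
proof -
  have b: "bij_betw (\<lambda>i. sorted_list_of_set \<Omega> ! i) {..<m} \<Omega>"
    using bij_betw_nth[of "sorted_list_of_set \<Omega>" "{..<m}" \<Omega>] assms by simp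
  have "(\<Sum>i=1..m. f (restrict_to \<Omega> g i)) = (\<Sum>i<m. f (g (sorted_list_of_set \<Omega> ! i)))"
    by (rule sum.reindex_bij_witness[of _ "Suc" "\<lambda>i. i - 1"]) (auto simp: restrict_to_def)
  also have "\<dots> = (\<Sum>i\<in>\<Omega>. f (g i))" by (rule sum.reindex_bij_betw[OF b])
  finally show ?thesis .
qed

lemma l2norm_partial_circulant:
  assumes "finite \<Omega>" "card \<Omega> = m"
  shows "(l2norm m (mat_vec n (partial_circulant m n \<Omega> z) x))^2
    = (\<Sum>i\<in>\<Omega>. (cmod (\<Sum>k=1..n. (of_real (1 / sqrt (real m)) * of_real (z (cyc_sub n i k))) * x k))^2)"
proof -
  have "(l2norm m (mat_vec n (partial_circulant m n \<Omega> z) x))^2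
    = (\<Sum>i=1..m. (cmod (complex_of_real (1 / sqrt (real m)) * restrict_to \<Omega> (circ_conv n (\<lambda>j. complex_of_real (z j)) x) i))^2)"
    unfolding l2norm_sq partial_circulant_mat_vec ..
  also have "\<dots> = (\<Sum>i\<in>\<Omega>. (cmod (complex_of_real (1 / sqrt (real m)) * circ_conv n (\<lambda>j. complex_of_real (z j)) x i))^2)"
    by (rule sum_restrict_to[OF assms])
  finally show ?thesis by (simp add: circ_conv_def sum_distrib_left mult.assoc)
qed

text \<open>The event in the theorem is an uncountable intersection; closedness makes it measurable.\<close>

lemma closed_rip: "closed {z. rip_bound m n s (partial_circulant m n \<Omega> z) \<delta>}"
proof -
  have "continuous_on UNIV (\<lambda>z. (l2norm m (mat_vec n (partial_circulant m n \<Omega> z) x))^2)" for x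
    unfolding l2norm_sq mat_vec_def partial_circulant_def restrict_to_def circulant_def
    by (intro continuous_intros continuous_on_product_coordinates)
  then show ?thesis
    unfolding rip_bound_def
    by (intro closed_Collect_all closed_Collect_imp closed_Collect_conj closed_Collect_le
        open_Collect_const continuous_on_const continuous_on_mult) auto
qed

context circulant_setup begin

text \<open>Passing from the net to all sparse vectors costs a factor \<open>3\<close>, and
  \<open>3 / 4 \<le> 1\<close>. Agreement on \<open>{1..n}\<close> is all that is asked of
  \<open>z\<close>, because points of the product space are undefined elsewhere.\<close>

lemma rip_of_small_deviation:
  assumes "dev w + S {1..n} w \<le> \<delta> / 4" "\<delta> > 0" and z: "\<And>j. j \<in> {1..n} \<Longrightarrow> z j = w j"
  shows "rip_bound m n s (partial_circulant m n \<Omega> z) \<delta>"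
  unfolding rip_bound_def
proof (intro allI impI)
  fix x assume x: "sparse n s x"
  define q where "q = (l2norm m (mat_vec n (partial_circulant m n \<Omega> z) x))^2"
  have zz: "z (cyc_sub n i k) = w (cyc_sub n i k)" for i k by (rule z[OF cyc_sub_in[OF n1]])
  have "\<bar>q - (\<Sum>k=1..n. (cmod (x k))^2)\<bar> \<le> 3 * (\<delta> / 4) * (\<Sum>k=1..n. (cmod (x k))^2)"
    unfolding q_def l2norm_partial_circulant[OF finO Om(2)] zz
  proof (rule net_to_sparse[OF n1 _ finO _ x])
    fix y assume "y \<in> net n s"
    then show "\<bar>(\<Sum>i\<in>\<Omega>. (cmod (\<Sum>k=1..n. (of_real (1 / sqrt (real m)) * of_real (w (cyc_sub n i k))) * y k))^2) - (\<Sum>k=1..n. (cmod (y k))^2)\<bar> \<le> \<delta> / 4"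
      using order_trans[OF quadratic_le assms(1)] by blast
  qed (use s2 in auto)
  moreover have "3 * (\<delta> / 4) * (\<Sum>k=1..n. (cmod (x k))^2) \<le> \<delta> * (\<Sum>k=1..n. (cmod (x k))^2)"
    using assms(2) by (intro mult_right_mono sum_nonneg) auto
  ultimately have "\<bar>q - (l2norm n x)^2\<bar> \<le> \<delta> * (l2norm n x)^2" unfolding l2norm_sq by (rule order_trans)
  then show "(1 - \<delta>) * (l2norm n x)^2 \<le> (l2norm m (mat_vec n (partial_circulant m n \<Omega> z) x))^2 \<and>
      (l2norm m (mat_vec n (partial_circulant m n \<Omega> z) x))^2 \<le> (1 + \<delta>) * (l2norm n x)^2"
    unfolding q_def[symmetric] by (simp add: left_diff_distrib distrib_right abs_le_iff)
qed

end

text \<open>Since \<open>ln s \<ge> 2 / 3\<close>, the first entry of the maximum dominates a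
  multiple of \<open>ln n\<close>: \<open>ln (4 * n) \<le> 3 * ln n\<close> is at most
  \<open>81 / 8 * P\<close>, and with \<open>ln (1 / \<eta>) \<le> P\<close> the factor
  \<open>12\<close> suffices. The rounding error is below \<open>6 * P\<close> because
  \<open>P \<ge> 16 / 81\<close>.\<close>

lemma moment_exponent:
  fixes s n :: nat and \<eta> :: real
  assumes s: "2 \<le> s" "s \<le> n" and eta: "0 < \<eta>" "\<eta> < 1"
    and P: "P = max ((ln (real s))^2 * (ln (real n))^2) (ln (1 / \<eta>))" and p: "p = nat \<lceil>12 * P\<rceil>"
  shows "p \<ge> 1" "(ln (real s) * ln (real n))^2 \<le> real p" (is ?goal2) "ln (4 * real n) + ln (1 / \<eta>) \<le> real p" (is ?goal3) "real p \<le> 18 * P"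
proof -
  have l2: "ln 2 \<ge> (2/3::real)" by (rule ln2_ge_two_thirds)
  have n2: "n \<ge> 2" using s by simp
  have ls: "ln (real s) \<ge> 2/3" and ln: "ln (real n) \<ge> 2/3"
    using l2 ln_mono[of 2 "real s"] ln_mono[of 2 "real n"] s n2 by linarith+
  define a where "a = ln (real n)"
  have "(2/3)^2 \<le> (ln (real s))^2" using ls by (intro power_mono) auto
  then have "4/9 * a^2 \<le> (ln (real s))^2 * a^2" by (intro mult_right_mono) (auto simp: power2_eq_square)
  then have P1: "4/9 * a^2 \<le> P" unfolding P a_def by linarith
  have a2: "2/3 * a \<le> a^2" unfolding power2_eq_square a_def using ln by (intro mult_right_mono) auto
  have a: "a \<ge> 2/3" using ln by (simp add: a_def)
  have P2: "8/27 * a \<le> P" using P1 a2 by linarith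
  have P3: "16/81 \<le> P" using P2 a by linarith
  have P4: "ln (1 / \<eta>) \<le> P" "(ln (real s) * ln (real n))^2 \<le> P" unfolding P by (auto simp: power_mult_distrib)
  have p12: "12 * P \<le> real p" "real p \<le> 12 * P + 1"
    using P3 unfolding p by linarith+
  show "p \<ge> 1" using p12(1) P3 by linarith
  show ?goal2 using P4(2) p12(1) P3 by linarith
  have "ln (4 * real n) = 2 * ln 2 + a" using n2 ln_realpow[of 2 2] by (simp add: ln_mult a_def)
  moreover have "ln 2 \<le> a" using n2 by (simp add: a_def)
  ultimately show ?goal3 using P2 P4(1) p12(1) P3 by linarith
  show "real p \<le> 18 * P" using p12(2) P3 by linarith
qed

text \<open>For \<open>s = 1\<close> the term \<open>(ln s)^2 * (ln n)^2\<close> vanishes, and the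
  hypothesis on \<open>m\<close> would not pay for the union over the \<open>n\<close> columns;
  hence \<open>2 \<le> s\<close>.\<close>

theorem theorem4p1:
  fixes L :: real
  assumes "L > 0"
  shows "\<exists>c::real. c > 0 \<and>
    (\<forall>(M :: 'a measure) (m::nat) (n::nat) (\<Omega> :: nat set) (\<xi> :: nat \<Rightarrow> 'a \<Rightarrow> real)
       (s::nat) (\<eta>::real) (\<delta>::real).
       prob_space M \<longrightarrow>
       1 \<le> m \<longrightarrow> m \<le> n \<longrightarrow> \<Omega> \<subseteq> {1..n} \<longrightarrow> card \<Omega> = m \<longrightarrow>
       prob_space.indep_vars M (\<lambda>_. borel) \<xi> {1..n} \<longrightarrow>
       (\<forall>j\<in>{1..n}. integrable M (\<xi> j) \<and> prob_space.expectation M (\<xi> j) = 0 \<and>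
          prob_space.variance M (\<xi> j) = 1 \<and> subgaussian M L (\<xi> j)) \<longrightarrow>
       2 \<le> s \<longrightarrow> s \<le> n \<longrightarrow> 0 < \<eta> \<longrightarrow> \<eta> < 1 \<longrightarrow> 0 < \<delta> \<longrightarrow> \<delta> < 1 \<longrightarrow>
       real m \<ge> c * (1 / \<delta>\<^sup>2) * real s *
         max ((ln (real s))\<^sup>2 * (ln (real n))\<^sup>2) (ln (1 / \<eta>)) \<longrightarrow>
       measure M {\<omega> \<in> space M.
         ri_const m n s (partial_circulant m n \<Omega> (\<lambda>j. \<xi> j \<omega>)) \<le> \<delta>} \<ge> 1 - \<eta>)"
proof -
  define \<kappa> where "\<kappa> = mgf_const L"
  have kap: "\<kappa> > 0" unfolding \<kappa>_def by (rule mgf_const_pos[OF assms])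
  define t0 where "t0 = 1 / (8 * L^2)"
  have t0: "t0 > 0" using assms by (simp add: t0_def)
  define q1 where "q1 = (3840 * exp (1 + \<kappa>) * (2304 * sqrt (300 * \<kappa>)))^2"
  define tr where "tr = min t0 (1 / (16 * \<kappa>))"
  have tr: "tr > 0" using t0 kap by (simp add: tr_def)
  \<comment> \<open>The sum dominates every lower bound that \<open>bad_event\<close> puts on
    \<open>Q\<close>. As the constant must precede \<open>M\<close>, \<open>m\<close> and
    \<open>n\<close>, \<open>tr\<close> and \<open>q1\<close> repeat the later
    \<open>tail_rate\<close> and \<open>chain_const\<close> with values depending on
    \<open>L\<close> only.\<close>
  define Q where "Q = q1 + 1 + 1 / t0 + 16 / tr"
  have q0: "q1 \<ge> 0" "1 / t0 > 0" "16 / tr > 0" using t0 tr by (auto simp: q1_def)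
  have Q: "Q \<ge> q1" "Q \<ge> 1" "Q \<ge> 1 / t0" "Q \<ge> 16 / tr" "Q > 0" using q0 unfolding Q_def by linarith+
  have main: "measure M {\<omega> \<in> space M. ri_const m n s (partial_circulant m n \<Omega> (\<lambda>j. \<xi> j \<omega>)) \<le> \<delta>} \<ge> 1 - \<eta>"
    if "prob_space M" and m: "1 \<le> m" "m \<le> n" and Om: "\<Omega> \<subseteq> {1..n}" "card \<Omega> = m"
      and indep: "prob_space.indep_vars M (\<lambda>_. borel) \<xi> {1..n}"
      and xi: "\<forall>j\<in>{1..n}. integrable M (\<xi> j) \<and> prob_space.expectation M (\<xi> j) = 0 \<and>
          prob_space.variance M (\<xi> j) = 1 \<and> subgaussian M L (\<xi> j)"
      and s: "2 \<le> s" "s \<le> n" and eta: "0 < \<eta>" "\<eta> < 1" and del: "0 < \<delta>" "\<delta> < 1"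
      and big: "real m \<ge> 18 * Q * (1 / \<delta>^2) * real s * max ((ln (real s))^2 * (ln (real n))^2) (ln (1 / \<eta>))"
    for M :: "'a measure" and m n \<Omega> \<xi> s \<eta> \<delta>
  proof -
    interpret prob_space M by fact
    \<comment> \<open>Extension by zero makes every \<open>\<mu> j\<close> a probability measure,
      and the whole sequence a measurable map into the function space in which
      \<open>closed_rip\<close> is stated.\<close>
    define \<zeta> where "\<zeta> j = (if j \<in> {1..n} then \<xi> j else (\<lambda>_. 0))" for j
    have xm: "\<xi> j \<in> borel_measurable M" if "j \<in> {1..n}" for j using xi that by auto
    have zm [measurable]: "\<zeta> j \<in> borel_measurable M" for j using xm by (simp add: \<zeta>_def)
    define \<mu> where "\<mu> j = distr M borel (\<zeta> j)" for j
    have pm: "prob_space (\<mu> j)" for j unfolding \<mu>_def by (rule prob_space_distr) simp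
    have mgf: "integrable M (\<lambda>\<omega>. exp (l * \<xi> j \<omega>))" "expectation (\<lambda>\<omega>. exp (l * \<xi> j \<omega>)) \<le> exp (\<kappa> * l^2)"
      "\<bar>l\<bar> \<le> t0 \<Longrightarrow> integrable M (\<lambda>\<omega>. exp (l * ((\<xi> j \<omega>)^2 - 1)))"
      "\<bar>l\<bar> \<le> t0 \<Longrightarrow> expectation (\<lambda>\<omega>. exp (l * ((\<xi> j \<omega>)^2 - 1))) \<le> exp (\<kappa> * l^2)"
      if "j \<in> {1..n}" for j l
      unfolding t0_def \<kappa>_def using subgaussian_mgf[OF assms, of "\<xi> j" l] xi that by blast+
    interpret pp: product_prob_space \<mu> by (intro product_prob_spaceI pm)
    interpret cs: circulant_setup \<mu> n \<kappa> t0 m s \<Omega>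
    proof unfold_locales
      show "finite {1..n}" by simp
      show "sets (\<mu> j) = sets borel" for j by (simp add: \<mu>_def)
      show "\<kappa> > 0" "t0 > 0" by fact+
      show "\<Omega> \<subseteq> {1..n}" "card \<Omega> = m" "m \<ge> 1" "2 \<le> s" "s \<le> n" by fact+
      fix j l assume j: "j \<in> {1..n}"
      have z: "\<zeta> j = \<xi> j" using j by (simp add: \<zeta>_def)
      show "integrable (\<mu> j) (\<lambda>x. exp (l * x))"
        unfolding \<mu>_def by (subst integrable_distr_eq) (use mgf(1)[OF j] z xm[OF j] in auto)
      show "(\<integral>x. exp (l * x) \<partial>\<mu> j) \<le> exp (\<kappa> * l^2)"
        unfolding \<mu>_def by (subst integral_distr) (use mgf(2)[OF j] z xm[OF j] in auto)
      assume l: "\<bar>l\<bar> \<le> t0"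
      show "integrable (\<mu> j) (\<lambda>x. exp (l * (x^2 - 1)))"
        unfolding \<mu>_def by (subst integrable_distr_eq) (use mgf(3)[OF j l] z xm[OF j] in auto)
      show "(\<integral>x. exp (l * (x^2 - 1)) \<partial>\<mu> j) \<le> exp (\<kappa> * l^2)"
        unfolding \<mu>_def by (subst integral_distr) (use mgf(4)[OF j l] z xm[OF j] in auto)
    qed
    define P where "P = max ((ln (real s))^2 * (ln (real n))^2) (ln (1 / \<eta>))"
    define p where "p = nat \<lceil>12 * P\<rceil>"
    note pe = moment_exponent[OF s eta P_def p_def]
    have Qsp: "Q * real (s * p) \<le> real m * \<delta>^2"
    proof -
      have "Q * real (s * p) = Q * real s * real p" by simp
      also have "\<dots> \<le> Q * real s * (18 * P)" using pe(4) Q(5) by (intro mult_left_mono) auto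
      also have "\<dots> = 18 * Q * (1 / \<delta>^2) * real s * P * \<delta>^2" using del by simp
      also have "\<dots> \<le> real m * \<delta>^2" using big by (intro mult_right_mono) (simp_all add: P_def)
      finally show ?thesis .
    qed
    have bad: "measure cs.PP {w \<in> space cs.PP. cs.dev w + cs.S {1..n} w > \<delta> / 4} \<le> \<eta>"
    proof (rule cs.bad_event[OF pe(1-3) eta del(1) _ Qsp])
      show "\<delta> \<le> 1" using del by simp
      show "(3840 * exp (1 + \<kappa>) * cs.chain_const)^2 \<le> Q" using Q(1) by (simp add: cs.chain_const_def q1_def)
      show "1 \<le> Q" by (rule Q(2))
      show "1 \<le> Q * t0" using Q(3) t0 by (simp add: divide_le_eq)
      show "16 \<le> Q * cs.tail_rate" using Q(4) tr by (simp add: divide_le_eq cs.tail_rate_def tr_def)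
    qed
    define W where "W \<omega> = (\<lambda>j\<in>{1..n}. \<xi> j \<omega>)" for \<omega>
    define Bd where "Bd = {w \<in> space cs.PP. cs.dev w + cs.S {1..n} w > \<delta> / 4}"
    \<comment> \<open>Independence is used exactly here, to identify the joint law with the product
      measure.\<close>
    have "distr M (PiM {1..n} (\<lambda>_. borel)) W = PiM {1..n} (\<lambda>j. distr M borel (\<xi> j))"
      using indep_vars_iff_distr_eq_PiM'[where I = "{1..n}" and M' = "\<lambda>_. borel" and X = \<xi>] indep xm s by (auto simp: W_def[abs_def])
    also have "\<dots> = cs.PP" by (rule PiM_cong) (auto simp: \<mu>_def \<zeta>_def)
    finally have dist: "distr M (PiM {1..n} (\<lambda>_. borel)) W = cs.PP" .
    have Wm: "W \<in> measurable M (PiM {1..n} (\<lambda>_. borel))"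
      unfolding W_def[abs_def] by (intro measurable_restrict xm)
    have Bs: "Bd \<in> sets cs.PP" unfolding Bd_def using cs.S_measurable[OF order_refl] by measurable
    then have Bs': "Bd \<in> sets (PiM {1..n} (\<lambda>_. borel :: real measure))" using dist by (metis sets_distr)
    have "prob (W -` Bd \<inter> space M) = measure cs.PP Bd"
      unfolding dist[symmetric] by (rule measure_distr[OF Wm Bs', symmetric])
    then have pb: "prob (W -` Bd \<inter> space M) \<le> \<eta>" using bad by (simp add: Bd_def)
    have Wb: "W -` Bd \<inter> space M \<in> sets M" using measurable_sets[OF Wm Bs'] .
    let ?E = "{\<omega> \<in> space M. ri_const m n s (partial_circulant m n \<Omega> (\<lambda>j. \<xi> j \<omega>)) \<le> \<delta>}"
    have pc: "partial_circulant m n \<Omega> (\<lambda>j. \<xi> j \<omega>) = partial_circulant m n \<Omega> (\<lambda>j. \<zeta> j \<omega>)" for \<omega>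
      using cyc_sub_in[OF cs.n1] by (simp add: partial_circulant_def restrict_to_def circulant_def \<zeta>_def)
    have s1: "s \<ge> 1" using s by simp
    have ri: "ri_const m n s A \<le> \<delta> \<longleftrightarrow> rip_bound m n s A \<delta>" for A
      using rip_bound_ri_const(1,2)[OF cs.n1 s1] rip_bound_mono by blast
    have "(\<lambda>\<omega> j. \<zeta> j \<omega>) \<in> borel_measurable M"
      by (rule measurable_coordinatewise_then_product) simp
    moreover have "{z. rip_bound m n s (partial_circulant m n \<Omega> z) \<delta>} \<in> sets borel"
      by (rule borel_closed[OF closed_rip])
    ultimately have "(\<lambda>\<omega> j. \<zeta> j \<omega>) -` {z. rip_bound m n s (partial_circulant m n \<Omega> z) \<delta>} \<inter> space M \<in> sets M"
      by (rule measurable_sets)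
    also have "(\<lambda>\<omega> j. \<zeta> j \<omega>) -` {z. rip_bound m n s (partial_circulant m n \<Omega> z) \<delta>} \<inter> space M = ?E"
      unfolding ri pc by auto
    finally have Es: "?E \<in> sets M" .
    have sub: "space M - (W -` Bd \<inter> space M) \<subseteq> ?E"
    proof
      fix \<omega> assume w: "\<omega> \<in> space M - (W -` Bd \<inter> space M)"
      have "W \<omega> \<in> space cs.PP" using w measurable_space[OF Wm] dist by (metis Diff_iff space_distr)
      then have "cs.dev (W \<omega>) + cs.S {1..n} (W \<omega>) \<le> \<delta> / 4" using w by (auto simp: Bd_def)
      then have "rip_bound m n s (partial_circulant m n \<Omega> (\<lambda>j. \<xi> j \<omega>)) \<delta>"
        by (rule cs.rip_of_small_deviation[OF _ del(1)]) (simp add: W_def)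
      then show "\<omega> \<in> ?E" using w unfolding ri by simp
    qed
    have "1 - \<eta> \<le> 1 - prob (W -` Bd \<inter> space M)" using pb by simp
    also have "\<dots> = prob (space M - (W -` Bd \<inter> space M))" by (rule prob_compl[OF Wb, symmetric])
    also have "\<dots> \<le> prob ?E" by (rule finite_measure_mono[OF sub Es])
    finally show ?thesis .
  qed
  show ?thesis
    by (rule exI[of _ "18 * Q"], rule conjI) (use Q(5) main in \<open>simp, blast\<close>)
qed

end
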